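(* Let $\nu$ be a probability measure on $\mathbb{R}^d$ that is absolutely continuous with respect to the Lebesgue measure and has a finite second moment. Suppose that $\nu$ satisfies at least one of the following: (i) $\nu$ is $\beta$-semi-log-convex for some $\beta>0$ and $\kappa$-semi-log-concave for some $\kappa>0$, with $\mathrm{supp}(\nu)=\mathbb{R}^d$; (iii) $\nu=N(0,\sigma^2\mathbf{I}_d)*\rho$ with $\sigma>0$, where $\rho$ is a probability measure supported on a Euclidean ball of radius $R$ in $\mathbb{R}^d$; (iv) $\nu$ is $\beta$-semi-log-convex for some $\beta>0$, $\kappa$-semi-log-concave for some $\kappa\le0$, and $\frac{d\nu}{d\gamma_d}(x)$ is $L$-log-Lipschitz in $x$ for some $L\ge0$, with $\mathrm{supp}(\nu)=\mathbb{R}^d$. Then the Gaussian interpolation flow $(X_t)_{t\in[0,1]}$ and its time-reversed flow $(X_t^* )_{t\in[0,1]}$ form an auto-encoder with a Lipschitz encoder $X_1^*(x)$ and a Lipschitz decoder $X_1(x)$: the maps $X_1^*$ and $X_1$ are Lipschitz continuous, and $$X_1\circ X_1^*=\mathrm{id},$$ the identity map of $\mathbb{R}^d$.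
   Context: Fix functions $a_t,b_t$ of $t\in[0,1]$ (a dot denotes the time derivative) satisfying: $\dot a_t\le 0$, $\dot b_t\ge 0$, $a_0>0$, $b_0\ge 0$, $a_1=0$, $b_1=1$; $a_t>0$ and $b_t>0$ for all $t\in(0,1)$; $a_t,b_t\in C^2([0,1))$, $a_t^2\in C^1([0,1])$, $b_t\in C^1([0,1])$. Let $\gamma_d:=N(0,\mathbf{I}_d)$, let $\mathsf{Z}\sim\gamma_d$ and $\mathsf{X}_1\sim\nu$ be independent, and $\mathsf{X}_t=a_t\mathsf{Z}+b_t\mathsf{X}_1$. The velocity field is $v(t,x)=\mathbb{E}[\dot a_t\mathsf{Z}+\dot b_t\mathsf{X}_1\mid\mathsf{X}_t=x]$ for $t\in(0,1)$, $v(0,x)=\lim_{t\downarrow0}v(t,x)$, $v(1,x)=\lim_{t\uparrow1}v(t,x)$. The Gaussian interpolation flow is the solution $X_t(x)$ of $\frac{d}{dt}X_t(x)=v(t,X_t(x))$, $X_0(x)=x$, $t\in[0,1]$; the time-reversed flow is the solution $X_t^*(x)$ of $\frac{d}{dt}X_t^*(x)=-v(1-t,X_t^*(x))$, $X_0^*(x)=x$, $t\in[0,1]$. A probability measure $\exp(-U)\,dx$ is $\kappa$-semi-log-concave ($\kappa\in\mathbb{R}$) if its support $\Omega\subseteq\mathbb{R}^d$ is convex and $U\in C^2(\Omega)$ satisfies $\nabla^2U(x)\succeq\kappa\mathbf{I}_d$ on $\Omega$; it is $\beta$-semi-log-convex ($\beta>0$) if its support $\Omega$ is convex and $U\in C^2(\Omega)$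 satisfies $\nabla^2U(x)\preceq\beta\mathbf{I}_d$ on $\Omega$. A function $f:\mathbb{R}^d\to\mathbb{R}_+$ is $L$-log-Lipschitz if $\log f$ is $L$-Lipschitz. *)

theory Defs
  imports "HOL-Probability.Probability"
begin

section \<open>Interpolation schedules\<close>

text \<open>Derivatives in time are taken within the unit interval, hence one-sided at its end points.\<close>

abbreviation time_deriv :: "(real \<Rightarrow> real) \<Rightarrow> real \<Rightarrow> real" where
  "time_deriv f t \<equiv> vector_derivative f (at t within {0..1})"

definition C1_on :: "(real \<Rightarrow> real) \<Rightarrow> real set \<Rightarrow> bool" where
  "C1_on f S \<longleftrightarrow>
     (\<exists>f'. (\<forall>t\<in>S. (f has_real_derivative f' t) (at t within S)) \<and> continuous_on S f')"

definition C2_on :: "(real \<Rightarrow> real) \<Rightarrow> real set \<Rightarrow> bool" where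
  "C2_on f S \<longleftrightarrow>
     (\<exists>f'. (\<forall>t\<in>S. (f has_real_derivative f' t) (at t within S)) \<and> C1_on f' S)"

text \<open>The monotonicity of \<open>a\<close> is required on \<open>[0,1)\<close> only, since \<open>a\<close> need not be differentiable
  at \<open>1\<close>, as for \<open>a t = sqrt (1 - t\<^sup>2)\<close>.\<close>

definition interpolation_schedule :: "(real \<Rightarrow> real) \<Rightarrow> (real \<Rightarrow> real) \<Rightarrow> bool" where
  "interpolation_schedule a b \<longleftrightarrow>
     (\<forall>t\<in>{0..<1}. time_deriv a t \<le> 0) \<and> (\<forall>t\<in>{0..1}. time_deriv b t \<ge> 0) \<and>
     a 0 > 0 \<and> b 0 \<ge> 0 \<and> a 1 = 0 \<and> b 1 = 1 \<and>
     (\<forall>t\<in>{0<..<1}. a t > 0 \<and> b t > 0) \<and>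
     C2_on a {0..<1} \<and> C2_on b {0..<1} \<and>
     C1_on (\<lambda>t. (a t)\<^sup>2) {0..1} \<and> C1_on b {0..1}"

section \<open>Measures on Euclidean space\<close>

text \<open>The centred Gaussian with covariance \<open>\<sigma>\<^sup>2 I\<close>.\<close>

definition gaussian :: "real \<Rightarrow> (real ^ 'n) measure" where
  "gaussian \<sigma> = density lborel (\<lambda>x. ennreal (\<Prod>i\<in>UNIV. normal_density 0 \<sigma> (x $ i)))"

definition msupport :: "(real ^ 'n) measure \<Rightarrow> (real ^ 'n) set" where
  "msupport \<nu> = {x. \<forall>S. open S \<longrightarrow> x \<in> S \<longrightarrow> emeasure \<nu> S > 0}"

text \<open>\<open>\<nu> = exp (-U) dx\<close> on its convex support, where \<open>U\<close> is twice continuously differentiable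
  with Hessian \<open>H\<close>. A convex support of an absolutely continuous probability measure has non-empty
  interior, so derivatives within it are unique, also at boundary points.\<close>

definition C2_potential ::
  "(real ^ 'n) measure \<Rightarrow> (real ^ 'n \<Rightarrow> real) \<Rightarrow> (real ^ 'n \<Rightarrow> (real ^ 'n) \<Rightarrow>\<^sub>L (real ^ 'n)) \<Rightarrow> bool" where
  "C2_potential \<nu> U H \<longleftrightarrow>
     convex (msupport \<nu>) \<and>
     \<nu> = density lborel (\<lambda>x. ennreal (indicator (msupport \<nu>) x * exp (- U x))) \<and>
     (\<exists>G. \<forall>x\<in>msupport \<nu>.
        (U has_derivative (\<lambda>h. G x \<bullet> h)) (at x within msupport \<nu>) \<and>
        (G has_derivative blinfun_apply (H x)) (at x within msupport \<nu>)) \<and>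
     continuous_on (msupport \<nu>) H"

definition semi_log_concave :: "real \<Rightarrow> (real ^ 'n) measure \<Rightarrow> bool" where
  "semi_log_concave \<kappa> \<nu> \<longleftrightarrow>
     (\<exists>U H. C2_potential \<nu> U H \<and>
        (\<forall>x\<in>msupport \<nu>. \<forall>h. h \<bullet> blinfun_apply (H x) h \<ge> \<kappa> * (h \<bullet> h)))"

definition semi_log_convex :: "real \<Rightarrow> (real ^ 'n) measure \<Rightarrow> bool" where
  "semi_log_convex \<beta> \<nu> \<longleftrightarrow>
     (\<exists>U H. C2_potential \<nu> U H \<and>
        (\<forall>x\<in>msupport \<nu>. \<forall>h. h \<bullet> blinfun_apply (H x) h \<le> \<beta> * (h \<bullet> h)))"

definition log_lipschitz :: "real \<Rightarrow> (real ^ 'n \<Rightarrow> real) \<Rightarrow> bool" where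
  "log_lipschitz L f \<longleftrightarrow> (\<forall>x. f x > 0) \<and> L-lipschitz_on UNIV (\<lambda>x. ln (f x))"

section \<open>The velocity field\<close>

text \<open>The function \<open>x \<mapsto> E[Y | X = x]\<close>. Conditional expectations determine it only up to null sets
  of the law of \<open>X\<close>; pointwise values are those of the continuous version, which is unique as soon
  as the law of \<open>X\<close> has full support.\<close>

definition cond_mean ::
  "'w measure \<Rightarrow> ('w \<Rightarrow> real ^ 'n) \<Rightarrow> ('w \<Rightarrow> real ^ 'n) \<Rightarrow> real ^ 'n \<Rightarrow> real ^ 'n" where
  "cond_mean M Y X =
     (THE f. continuous_on UNIV f \<and>
        (\<forall>i. AE \<omega> in M.
           real_cond_exp M (vimage_algebra (space M) X borel) (\<lambda>\<omega>. Y \<omega> $ i) \<omega> = f (X \<omega>) $ i))"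

definition interior_velocity ::
  "'w measure \<Rightarrow> (real \<Rightarrow> real) \<Rightarrow> (real \<Rightarrow> real) \<Rightarrow> ('w \<Rightarrow> real ^ 'n) \<Rightarrow> ('w \<Rightarrow> real ^ 'n) \<Rightarrow>
   real \<Rightarrow> real ^ 'n \<Rightarrow> real ^ 'n" where
  "interior_velocity M a b Z X1 t =
     cond_mean M (\<lambda>\<omega>. time_deriv a t *\<^sub>R Z \<omega> + time_deriv b t *\<^sub>R X1 \<omega>)
                 (\<lambda>\<omega>. a t *\<^sub>R Z \<omega> + b t *\<^sub>R X1 \<omega>)"

definition velocity ::
  "'w measure \<Rightarrow> (real \<Rightarrow> real) \<Rightarrow> (real \<Rightarrow> real) \<Rightarrow> ('w \<Rightarrow> real ^ 'n) \<Rightarrow> ('w \<Rightarrow> real ^ 'n) \<Rightarrow>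
   real \<Rightarrow> real ^ 'n \<Rightarrow> real ^ 'n" where
  "velocity M a b Z X1 t x =
     (if t = 0 then Lim (at_right 0) (\<lambda>s. interior_velocity M a b Z X1 s x)
      else if t = 1 then Lim (at_left 1) (\<lambda>s. interior_velocity M a b Z X1 s x)
      else interior_velocity M a b Z X1 t x)"

section \<open>Flows on the unit time interval\<close>

text \<open>Solutions are functions on \<open>[0,1]\<close>, represented as extensional functions on the reals.\<close>

definition is_flow_line ::
  "(real \<Rightarrow> real ^ 'n \<Rightarrow> real ^ 'n) \<Rightarrow> real ^ 'n \<Rightarrow> (real \<Rightarrow> real ^ 'n) \<Rightarrow> bool" where
  "is_flow_line F x \<phi> \<longleftrightarrow>
     \<phi> \<in> extensional {0..1} \<and> \<phi> 0 = x \<and>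
     (\<forall>t\<in>{0..1}. (\<phi> has_vector_derivative F t (\<phi> t)) (at t within {0..1}))"

definition flow :: "(real \<Rightarrow> real ^ 'n \<Rightarrow> real ^ 'n) \<Rightarrow> real \<Rightarrow> real ^ 'n \<Rightarrow> real ^ 'n" where
  "flow F t x = (THE \<phi>. is_flow_line F x \<phi>) t"

definition time_reversal ::
  "(real \<Rightarrow> real ^ 'n \<Rightarrow> real ^ 'n) \<Rightarrow> real \<Rightarrow> real ^ 'n \<Rightarrow> real ^ 'n" where
  "time_reversal F t x = - F (1 - t) x"

end

theory Submission
  imports Defs
begin

text \<open>In each case the rescaled target \<open>Y = X1 / s\<close> (with \<open>s = \<sigma>\<close> for a mixture and \<open>s = 1\<close> otherwise)
  has density \<open>exp (- (norm y)\<^sup>2 / 2 - g y)\<close>, where the gradient \<open>D\<close> of \<open>g\<close> is Lipschitz and \<open>g\<close> is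
  either Lipschitz or semi-convex with a constant below 1. Put \<open>\<beta> t = s * b t\<close>, \<open>c\<^sup>2 = a\<^sup>2 + \<beta>\<^sup>2\<close>,
  \<open>p = \<beta> / c\<^sup>2\<close> and \<open>q = a / c\<close>. Rotating \<open>(Z, Y)\<close> to \<open>(X, N)\<close> with \<open>X = a Z + \<beta> Y\<close> and \<open>Y = p X + q N\<close>
  shows that, given \<open>X = x\<close>, the vector \<open>N\<close> has density proportional to
  \<open>exp (- (norm n)\<^sup>2 / 2 - g (p x + q n))\<close>. An integration by parts then turns the velocity into
  \<open>\<alpha> t x - \<delta> t E[D (p x + q N) | X = x]\<close>, whose coefficients involve \<open>a\<close> only through \<open>a\<^sup>2\<close> and its
  derivative, hence are continuous on all of \<open>[0, 1]\<close>. The tilted mean is Lipschitz in \<open>x\<close> uniformly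
  in \<open>t\<close>: only a crude bound on exponential moments around the minimiser of the potential is needed,
  not the sharp covariance inequalities. So the velocity is a continuous, globally Lipschitz field;
  its flow and the time-reversed flow exist, are Lipschitz and invert each other.\<close>

section \<open>Flows of globally Lipschitz fields\<close>

text \<open>The obstacle is time 1: \<open>a\<close> tends to 0 there and its derivative may be
  unbounded, while recovering \<open>Z\<close> from \<open>X\<close> and \<open>Y\<close> divides by
  \<open>a\<close>. The integration by parts supplies an additional factor \<open>q\<close>,
  proportional to \<open>a\<close>, so the derivative of \<open>a\<close> survives only in a product
  with \<open>a\<close>. At time 1 itself \<open>q = 0\<close>, and the tilted mean is simply
  \<open>D\<close>. The standard Gaussian factor is split off because it is rotation invariant: only
  \<open>g\<close> notices the change of coordinates, and its argument moves with \<open>n\<close>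
  at speed \<open>q\<close>, at most 1. A curvature loss below 1 is therefore beaten by the Gaussian
  decay at all times simultaneously. A mixture carries a Gaussian of variance \<sigma> squared,
  whence the rescaling. Conditional expectations determine the velocity only almost everywhere.
  Continuity of the formula and strict positivity of the density of \<open>X\<close> turn it into an
  identity at every point, as a differential equation requires.\<close>

lemma continuous_on_lipschitz_field:
  fixes F :: "real \<Rightarrow> 'a::metric_space \<Rightarrow> 'a"
  assumes cont: "\<And>x. continuous_on S (\<lambda>t. F t x)"
    and lip: "\<And>t. t \<in> S \<Longrightarrow> K-lipschitz_on UNIV (F t)"
    and \<phi>: "continuous_on S \<phi>"
  shows "continuous_on S (\<lambda>t. F t (\<phi> t))"
  unfolding continuous_on
proof
  fix t assume t: "t \<in> S"
  have "((\<lambda>s. dist (\<phi> s) (\<phi> t)) \<longlongrightarrow> 0) (at t within S)"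
    by (rule tendsto_dist_iff[THEN iffD1, OF bspec[OF \<phi>[unfolded continuous_on] t]])
  moreover have "((\<lambda>s. dist (F s (\<phi> t)) (F t (\<phi> t))) \<longlongrightarrow> 0) (at t within S)"
    by (rule tendsto_dist_iff[THEN iffD1, OF bspec[OF cont[unfolded continuous_on] t]])
  ultimately have lim: "((\<lambda>s. K * dist (\<phi> s) (\<phi> t) + dist (F s (\<phi> t)) (F t (\<phi> t))) \<longlongrightarrow> K * 0 + 0) (at t within S)"
    by (intro tendsto_add tendsto_mult tendsto_const)
  have bound: "\<forall>\<^sub>F s in at t within S. dist (F s (\<phi> s)) (F t (\<phi> t))
      \<le> K * dist (\<phi> s) (\<phi> t) + dist (F s (\<phi> t)) (F t (\<phi> t))"
    unfolding eventually_at_filter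
  proof (intro always_eventually allI impI)
    fix s assume "s \<in> S"
    then have "dist (F s (\<phi> s)) (F s (\<phi> t)) \<le> K * dist (\<phi> s) (\<phi> t)"
      using lipschitz_onD[OF lip] by blast
    then show "dist (F s (\<phi> s)) (F t (\<phi> t)) \<le> K * dist (\<phi> s) (\<phi> t) + dist (F s (\<phi> t)) (F t (\<phi> t))"
      using dist_triangle[of "F s (\<phi> s)" "F t (\<phi> t)" "F s (\<phi> t)"] by linarith
  qed
  have "((\<lambda>s. dist (F s (\<phi> s)) (F t (\<phi> t))) \<longlongrightarrow> 0) (at t within S)"
    by (rule tendsto_sandwich[OF _ bound tendsto_const lim[simplified]]) simp
  then show "((\<lambda>t. F t (\<phi> t)) \<longlongrightarrow> F t (\<phi> t)) (at t within S)"
    by (rule tendsto_dist_iff[THEN iffD2])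
qed

text \<open>The Picard operator is conjugated by the weight \<open>exp (- 2 K t)\<close>, which makes it a
  contraction on the whole interval at once.\<close>

lemma picard_existence:
  fixes F :: "real \<Rightarrow> 'a::euclidean_space \<Rightarrow> 'a"
  assumes cont: "\<And>x. continuous_on {0..1} (\<lambda>t. F t x)"
    and lip: "\<And>t. t \<in> {0..1} \<Longrightarrow> K-lipschitz_on UNIV (F t)"
    and K: "K > 0"
  shows "\<exists>\<phi>. \<phi> 0 = x \<and> (\<forall>t\<in>{0..1}. (\<phi> has_vector_derivative F t (\<phi> t)) (at t within {0..1}))"
proof -
  define w where "w t = exp (2 * K * t)" for t
  \<comment> \<open>Clamping time to the unit interval lets the fixed point be sought among the
    bounded continuous functions on the whole line, a complete metric space available as a
    type.\<close>
  define c :: "real \<Rightarrow> real" where "c t = max 0 (min 1 t)" for t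
  have w_pos: "w t > 0" for t by (simp add: w_def)
  have c01: "c t \<in> {0..1}" for t by (auto simp: c_def)
  have c_id: "t \<in> {0..1} \<Longrightarrow> c t = t" for t by (auto simp: c_def)
  have c_cont: "continuous_on UNIV c" unfolding c_def by (intro continuous_intros)
  have w_cont: "continuous_on S w" for S unfolding w_def by (intro continuous_intros)
  define P where "P \<psi> t = x + integral {0..t} (\<lambda>s. F s (w s *\<^sub>R \<psi> s))" for \<psi> t
  have F_cont: "continuous_on {0..1} (\<lambda>s. F s (w s *\<^sub>R \<psi> s))" if "continuous_on UNIV \<psi>" for \<psi>
    by (rule continuous_on_lipschitz_field[OF cont lip])
       (auto intro!: continuous_intros continuous_on_subset[OF that] w_cont)
  have F_int: "(\<lambda>s. F s (w s *\<^sub>R \<psi> s)) integrable_on {0..t}"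
    if "continuous_on UNIV \<psi>" "t \<in> {0..1}" for \<psi> t
    using continuous_on_subset[OF F_cont[OF that(1)], of "{0..t}"] that(2)
    by (intro integrable_continuous_real) auto
  have P_deriv: "(P \<psi> has_vector_derivative F t (w t *\<^sub>R \<psi> t)) (at t within {0..1})"
    if "continuous_on UNIV \<psi>" "t \<in> {0..1}" for \<psi> t
    unfolding P_def using integral_has_vector_derivative[OF F_cont[OF that(1)] that(2)]
    by (auto intro!: derivative_eq_intros)
  \<comment> \<open>A fixed point \<open>\<psi>\<close> of \<open>T\<close> is a solution divided by
    the weight: \<open>w t *\<^sub>R \<psi> t = P \<psi> t\<close>, and \<open>P \<psi>\<close> is
    the solution itself.\<close>
  define T where "T \<psi> t = (1 / w (c t)) *\<^sub>R P \<psi> (c t)" for \<psi> t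
  have T_bcont: "T \<psi> \<in> bcontfun" if "continuous_on UNIV \<psi>" for \<psi>
  proof -
    define Q where "Q t = (1 / w t) *\<^sub>R P \<psi> t" for t
    have "continuous_on {0..1} (P \<psi>)"
      unfolding continuous_on_eq_continuous_within
      using P_deriv[OF that] has_vector_derivative_continuous by blast
    then have Q: "continuous_on {0..1} Q"
      unfolding Q_def using w_pos by (intro continuous_intros w_cont) (auto simp: less_le)
    have "continuous_on UNIV (\<lambda>t. Q (c t))"
      by (rule continuous_on_compose2[OF Q c_cont]) (use c01 in auto)
    moreover have "bounded (range (\<lambda>t. Q (c t)))"
      by (rule bounded_subset[OF compact_imp_bounded[OF compact_continuous_image[OF Q]]])
         (use c01 in auto)
    ultimately show ?thesis
      unfolding bcontfun_def T_def Q_def by simp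
  qed
  define TT :: "(real \<Rightarrow>\<^sub>C 'a) \<Rightarrow> (real \<Rightarrow>\<^sub>C 'a)" where "TT \<psi> = Bcontfun (T (apply_bcontfun \<psi>))" for \<psi>
  have TT: "apply_bcontfun (TT \<psi>) = T (apply_bcontfun \<psi>)" for \<psi>
    unfolding TT_def using T_bcont by (simp add: Bcontfun_inverse)
  have contr: "dist (TT \<psi>) (TT \<eta>) \<le> 1/2 * dist \<psi> \<eta>" for \<psi> \<eta>
  proof (rule dist_bound)
    fix t
    define \<tau> where "\<tau> = c t"
    have \<tau>: "\<tau> \<in> {0..1}" using c01 \<tau>_def by auto
    \<comment> \<open>Origin of the contraction factor 1/2: the Lipschitz constant is
      \<open>K\<close>, while the weight grows at rate \<open>2 * K\<close>.\<close>
    have wint: "((\<lambda>s. K * dist \<psi> \<eta> * w s) has_integral (dist \<psi> \<eta> / 2 * w \<tau> - dist \<psi> \<eta> / 2 * w 0)) {0..\<tau>}"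
      unfolding w_def using \<tau>
      by (intro fundamental_theorem_of_calculus)
         (auto simp: has_real_derivative_iff_has_vector_derivative[symmetric] intro!: derivative_eq_intros)
    have "dist (T \<psi> t) (T \<eta> t) = 1 / w \<tau> * norm (P \<psi> \<tau> - P \<eta> \<tau>)"
      unfolding T_def \<tau>_def[symmetric] dist_norm scaleR_diff_right[symmetric] norm_scaleR
      using w_pos[of \<tau>] by simp
    also have "P \<psi> \<tau> - P \<eta> \<tau> = integral {0..\<tau>} (\<lambda>s. F s (w s *\<^sub>R \<psi> s) - F s (w s *\<^sub>R \<eta> s))"
      unfolding P_def using F_int \<tau> by (subst integral_diff) auto
    finally have T_diff: "dist (T \<psi> t) (T \<eta> t)
        = 1 / w \<tau> * norm (integral {0..\<tau>} (\<lambda>s. F s (w s *\<^sub>R \<psi> s) - F s (w s *\<^sub>R \<eta> s)))" .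
    have "norm (integral {0..\<tau>} (\<lambda>s. F s (w s *\<^sub>R \<psi> s) - F s (w s *\<^sub>R \<eta> s))) \<le> integral {0..\<tau>} (\<lambda>s. K * dist \<psi> \<eta> * w s)"
    proof (rule integral_norm_bound_integral)
      show "(\<lambda>s. F s (w s *\<^sub>R \<psi> s) - F s (w s *\<^sub>R \<eta> s)) integrable_on {0..\<tau>}"
        using F_int \<tau> by (intro integrable_diff) auto
      show "(\<lambda>s. K * dist \<psi> \<eta> * w s) integrable_on {0..\<tau>}" using wint by blast
      fix s assume s: "s \<in> {0..\<tau>}"
      have "norm (F s (w s *\<^sub>R \<psi> s) - F s (w s *\<^sub>R \<eta> s)) \<le> K * norm (w s *\<^sub>R \<psi> s - w s *\<^sub>R \<eta> s)"
        using lipschitz_onD[OF lip, of s "w s *\<^sub>R \<psi> s" "w s *\<^sub>R \<eta> s"] s \<tau> by (auto simp: dist_norm)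
      also have "\<dots> = K * (w s * dist (\<psi> s) (\<eta> s))"
        using w_pos[of s] by (simp add: scaleR_diff_right[symmetric] dist_norm)
      also have "\<dots> \<le> K * (w s * dist \<psi> \<eta>)"
        using K w_pos[of s] by (intro mult_left_mono dist_bounded) auto
      finally show "norm (F s (w s *\<^sub>R \<psi> s) - F s (w s *\<^sub>R \<eta> s)) \<le> K * dist \<psi> \<eta> * w s"
        by (simp add: mult_ac)
    qed
    also have "\<dots> = dist \<psi> \<eta> / 2 * (w \<tau> - w 0)"
      using integral_unique[OF wint] by (simp add: algebra_simps)
    also have "\<dots> \<le> dist \<psi> \<eta> / 2 * w \<tau>"
      using w_pos[of 0] by (intro mult_left_mono) auto
    finally show "dist (apply_bcontfun (TT \<psi>) t) (apply_bcontfun (TT \<eta>) t) \<le> 1/2 * dist \<psi> \<eta>"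
      unfolding TT T_diff using w_pos[of \<tau>] by (simp add: divide_le_eq mult_ac)
  qed
  obtain \<psi> where \<psi>: "TT \<psi> = \<psi>"
    using banach_fix_type[of "1/2" TT] contr by auto
  have fp: "\<psi> t = (1 / w t) *\<^sub>R P \<psi> t" if "t \<in> {0..1}" for t
    using TT[of \<psi>] that unfolding \<psi> T_def by (metis c_id)
  then have fp': "w t *\<^sub>R \<psi> t = P \<psi> t" if "t \<in> {0..1}" for t
    using that w_pos[of t] by simp
  show ?thesis
  proof (intro exI[of _ "P \<psi>"] conjI ballI)
    show "P \<psi> 0 = x" by (simp add: P_def)
    fix t :: real assume "t \<in> {0..1}"
    then show "(P \<psi> has_vector_derivative F t (P \<psi> t)) (at t within {0..1})"
      using P_deriv[of \<psi> t] fp' by simp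
  qed
qed

text \<open>Gronwall's inequality: by Cauchy-Schwarz the squared distance of two solutions,
  discounted by \<open>exp (- 2 * K * s)\<close>, never increases. Squaring keeps it differentiable
  where the solutions meet. Equal starting points give uniqueness; time 1 gives the Lipschitz
  constant \<open>exp K\<close> of the flow map.\<close>

lemma flow_line_growth:
  fixes F :: "real \<Rightarrow> 'a::real_inner \<Rightarrow> 'a"
  assumes lip: "\<And>t. t \<in> {0..1} \<Longrightarrow> K-lipschitz_on UNIV (F t)"
    and \<phi>: "\<And>t. t \<in> {0..1} \<Longrightarrow> (\<phi> has_vector_derivative F t (\<phi> t)) (at t within {0..1})"
    and \<psi>: "\<And>t. t \<in> {0..1} \<Longrightarrow> (\<psi> has_vector_derivative F t (\<psi> t)) (at t within {0..1})"
    and t: "t \<in> {0..1}"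
  shows "norm (\<phi> t - \<psi> t) \<le> exp (K * t) * norm (\<phi> 0 - \<psi> 0)"
proof -
  define u where "u s = exp (- 2 * K * s) * ((\<phi> s - \<psi> s) \<bullet> (\<phi> s - \<psi> s))" for s
  define u' where "u' s = exp (- 2 * K * s) * (2 * ((\<phi> s - \<psi> s) \<bullet> (F s (\<phi> s) - F s (\<psi> s)))
      - 2 * K * ((\<phi> s - \<psi> s) \<bullet> (\<phi> s - \<psi> s)))" for s
  have u: "(u has_real_derivative u' s) (at s within {0..1})" if "s \<in> {0..1}" for s
    unfolding u_def u'_def has_field_derivative_def
    using \<phi>[OF that] \<psi>[OF that] unfolding has_vector_derivative_def
    by (auto intro!: derivative_eq_intros ext simp: inner_commute algebra_simps)
  have u'_le: "u' s \<le> 0" if "s \<in> {0..1}" for s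
  proof -
    have "(\<phi> s - \<psi> s) \<bullet> (F s (\<phi> s) - F s (\<psi> s)) \<le> norm (\<phi> s - \<psi> s) * norm (F s (\<phi> s) - F s (\<psi> s))"
      by (rule norm_cauchy_schwarz)
    also have "\<dots> \<le> norm (\<phi> s - \<psi> s) * (K * norm (\<phi> s - \<psi> s))"
      using lipschitz_onD[OF lip[OF that], of "\<phi> s" "\<psi> s"]
      by (intro mult_left_mono) (auto simp: dist_norm)
    finally show ?thesis
      unfolding u'_def by (auto simp: mult_le_0_iff power2_norm_eq_inner[symmetric] power2_eq_square mult_ac)
  qed
  have "u t \<le> u 0"
  proof (rule DERIV_nonpos_imp_decreasing_open[of 0 t u])
    show "0 \<le> t" using t by auto
    show "continuous_on {0..t} u"
      by (rule continuous_on_subset[of "{0..1}"], unfold continuous_on_eq_continuous_within)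
         (use t DERIV_continuous[OF u] in auto)
    fix s assume s: "0 < s" "s < t"
    then have "(u has_real_derivative u' s) (at s)"
      using u[of s] t at_within_Icc_at[of 0 s 1] by auto
    then show "\<exists>y. (u has_real_derivative y) (at s) \<and> y \<le> 0"
      using u'_le s t by auto
  qed
  then have "exp (2 * (K * t)) * u t \<le> exp (2 * (K * t)) * (norm (\<phi> 0 - \<psi> 0))\<^sup>2"
    by (intro mult_left_mono) (simp_all add: u_def power2_norm_eq_inner)
  also have "exp (2 * (K * t)) * u t = (norm (\<phi> t - \<psi> t))\<^sup>2"
    by (simp add: u_def power2_norm_eq_inner mult.assoc[symmetric] exp_add[symmetric])
  finally have "(norm (\<phi> t - \<psi> t))\<^sup>2 \<le> (exp (K * t) * norm (\<phi> 0 - \<psi> 0))\<^sup>2"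
    by (simp only: power_mult_distrib exp_double)
  then show ?thesis
    by (rule power2_le_imp_le) auto
qed

text \<open>This is all that the conclusion uses about the velocity. It is stable under time
  reversal, so encoder and decoder are handled by the same lemmas.\<close>

definition lipschitz_field :: "(real \<Rightarrow> real ^ 'n \<Rightarrow> real ^ 'n) \<Rightarrow> bool" where
  "lipschitz_field F \<longleftrightarrow> (\<forall>x. continuous_on {0..1} (\<lambda>t. F t x)) \<and>
     (\<exists>K>0. \<forall>t\<in>{0..1}. K-lipschitz_on UNIV (F t))"

lemma lipschitz_field_time_reversal:
  assumes "lipschitz_field F"
  shows "lipschitz_field (time_reversal F)"
proof -
  obtain K where K: "K > 0" "\<And>t. t \<in> {0..1} \<Longrightarrow> K-lipschitz_on UNIV (F t)"
    using assms unfolding lipschitz_field_def by blast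
  have "continuous_on {0..1} (\<lambda>t. - F (1 - t) x)" for x
    by (intro continuous_intros continuous_on_compose2[of "{0..1}" "\<lambda>t. F t x" _ "\<lambda>t. 1 - t"])
       (use assms in \<open>auto simp: lipschitz_field_def\<close>)
  moreover have "K-lipschitz_on UNIV (\<lambda>x. - F (1 - t) x)" if "t \<in> {0..1}" for t
    using K(2)[of "1 - t"] that by (intro lipschitz_on_minus) auto
  ultimately show ?thesis
    unfolding lipschitz_field_def time_reversal_def using K(1) by blast
qed

lemma flow_line_exists:
  assumes "lipschitz_field F"
  shows "\<exists>\<phi>. is_flow_line F x \<phi>"
proof -
  obtain \<phi> where \<phi>: "\<phi> 0 = x" "\<And>t. t \<in> {0..1} \<Longrightarrow> (\<phi> has_vector_derivative F t (\<phi> t)) (at t within {0..1})"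
    using picard_existence[of F _ x] assms unfolding lipschitz_field_def by metis
  \<comment> \<open>The Picard solution has arbitrary values outside the unit interval; the
    restriction makes it extensional, so that uniqueness can hold as an equality of
    functions.\<close>
  have "(restrict \<phi> {0..1} has_vector_derivative F t (restrict \<phi> {0..1} t)) (at t within {0..1})"
    if "t \<in> {0..1}" for t
    by (rule has_vector_derivative_transform[OF that _ \<phi>(2)[OF that, THEN has_vector_derivative_eq_rhs]])
       (use that in auto)
  then show ?thesis
    using \<phi>(1) unfolding is_flow_line_def by (intro exI[of _ "restrict \<phi> {0..1}"]) auto
qed

lemma flow_line_unique:
  assumes "lipschitz_field F" "is_flow_line F x \<phi>" "is_flow_line F x \<psi>"
  shows "\<phi> = \<psi>"
proof (rule extensionalityI)
  obtain K where "\<And>t. t \<in> {0..1} \<Longrightarrow> K-lipschitz_on UNIV (F t)"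
    using assms(1) unfolding lipschitz_field_def by blast
  then show "\<phi> t = \<psi> t" if "t \<in> {0..1}" for t
    using flow_line_growth[of K F \<phi> \<psi> t] assms(2,3) that by (auto simp: is_flow_line_def)
qed (use assms in \<open>auto simp: is_flow_line_def\<close>)

lemma ex1_flow_line:
  assumes "lipschitz_field F"
  shows "\<exists>!\<phi>. is_flow_line F x \<phi>"
  using flow_line_exists[OF assms] flow_line_unique[OF assms] by blast

lemma flow_eqI:
  assumes "lipschitz_field F" "is_flow_line F x \<phi>"
  shows "flow F t x = \<phi> t"
  unfolding flow_def using the_equality[of "is_flow_line F x" \<phi>] flow_line_unique assms by metis

lemma flow_lipschitz:
  assumes "lipschitz_field F"
  shows "\<exists>C. C-lipschitz_on UNIV (flow F 1)"
proof -
  obtain K where K: "\<And>t. t \<in> {0..1} \<Longrightarrow> K-lipschitz_on UNIV (F t)"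
    using assms unfolding lipschitz_field_def by blast
  have "(exp K)-lipschitz_on UNIV (flow F 1)"
  proof (rule lipschitz_onI)
    fix x y
    obtain \<phi> \<psi> where l: "is_flow_line F x \<phi>" "is_flow_line F y \<psi>"
      using flow_line_exists[OF assms] by blast
    show "dist (flow F 1 x) (flow F 1 y) \<le> exp K * dist x y"
      using flow_line_growth[of K F \<phi> \<psi> 1, OF K] l
      by (auto simp: is_flow_line_def flow_eqI[OF assms l(1)] flow_eqI[OF assms l(2)] dist_norm)
  qed simp
  then show ?thesis by blast
qed

text \<open>A line of the reversed field run backwards is a line of the field: the sign from the
  chain rule cancels the sign in \<open>time_reversal\<close>. It starts at \<open>\<phi> 1\<close>
  and ends at \<open>\<phi> 0 = x\<close>.\<close>

lemma flow_inverts_time_reversal: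
  assumes F: "lipschitz_field F"
  shows "flow F 1 \<circ> flow (time_reversal F) 1 = id"
proof
  fix x
  obtain \<phi> where l: "is_flow_line (time_reversal F) x \<phi>"
    using flow_line_exists[OF lipschitz_field_time_reversal[OF F]] by blast
  define \<psi> where "\<psi> = restrict (\<lambda>t. \<phi> (1 - t)) {0..1}"
  have "(\<psi> has_vector_derivative F t (\<psi> t)) (at t within {0..1})" if t: "t \<in> {0..1}" for t
  proof (rule has_vector_derivative_transform[OF t])
    have "(\<phi> has_vector_derivative - F t (\<phi> (1 - t))) (at (1 - t) within (\<lambda>t. 1 - t) ` {0..1})"
      using l t by (force simp: is_flow_line_def time_reversal_def image_diff_atLeastAtMost dest: bspec[of _ _ "1 - t"])
    moreover have "((\<lambda>t. 1 - t) has_vector_derivative - 1) (at t within {0..1})"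
      by (auto intro!: derivative_eq_intros simp: has_real_derivative_iff_has_vector_derivative[symmetric])
    ultimately show "((\<lambda>t. \<phi> (1 - t)) has_vector_derivative F t (\<psi> t)) (at t within {0..1})"
      using vector_diff_chain_within[of "\<lambda>t. 1 - t" "- 1" t "{0..1}" \<phi> "- F t (\<phi> (1 - t))"] t
      by (auto simp: o_def \<psi>_def)
  qed (simp add: \<psi>_def)
  then have "is_flow_line F (\<phi> 1) \<psi>"
    by (auto simp: is_flow_line_def \<psi>_def)
  then have "flow F 1 (\<phi> 1) = \<phi> 0"
    by (simp add: flow_eqI[OF F] \<psi>_def)
  then show "(flow F 1 \<circ> flow (time_reversal F) 1) x = id x"
    using flow_eqI[OF lipschitz_field_time_reversal[OF F] l] l by (simp add: is_flow_line_def)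
qed

section \<open>Integrals over Euclidean space\<close>

text \<open>Scalar substitutions suffice for the rotation of the Gaussian pair, because it is
  carried out one vector at a time with the other held fixed.\<close>

lemma nn_integral_lborel_affine:
  fixes f :: "'a::euclidean_space \<Rightarrow> ennreal"
  assumes [measurable]: "f \<in> borel_measurable borel" and "c > 0"
  shows "(\<integral>\<^sup>+x. f x \<partial>lborel) = ennreal (c ^ DIM('a)) * (\<integral>\<^sup>+x. f (t + c *\<^sub>R x) \<partial>lborel)"
  using \<open>c > 0\<close>
  by (subst lborel_affine[of c t], simp, subst nn_integral_density)
     (auto simp: nn_integral_distr nn_integral_cmult)

lemma integrable_lborel_shift:
  fixes f :: "'a::euclidean_space \<Rightarrow> 'b::{banach, second_countable_topology}"
  assumes "integrable lborel f"
  shows "integrable lborel (\<lambda>x. f (t + x))"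
  using assms by (subst (asm) lborel_distr_plus[of t, symmetric], subst (asm) integrable_distr_eq) auto

lemma integral_lborel_shift:
  fixes f :: "'a::euclidean_space \<Rightarrow> 'b::{banach, second_countable_topology}"
  assumes [measurable]: "f \<in> borel_measurable borel"
  shows "(\<integral>x. f (t + x) \<partial>lborel) = (\<integral>x. f x \<partial>lborel)"
  by (subst (2) lborel_distr_plus[of t, symmetric], subst integral_distr) auto

lemma integrable_gaussian:
  fixes k :: real
  assumes "k > 0"
  shows "integrable lborel (\<lambda>x::'a::euclidean_space. exp (- k * (norm x)\<^sup>2))"
proof (rule integrableI_nonneg)
  define s where "s = 1 / sqrt (2 * k)"
  have s: "s > 0" "s\<^sup>2 = 1 / (2 * k)" using assms by (auto simp: s_def power_divide)
  have 1: "exp (- k * y\<^sup>2) = sqrt (2 * pi * s\<^sup>2) * normal_density 0 s y" for y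
    using assms unfolding normal_density_def s(2) by simp
  have "integrable lborel (\<lambda>y. exp (- k * y\<^sup>2))"
    unfolding 1 using s by (intro integrable_mult_right integrable_normal_density)
  then have fin: "(\<integral>\<^sup>+y. ennreal (exp (- k * y\<^sup>2)) \<partial>lborel) < \<infinity>"
    by (simp add: integrable_iff_bounded)
  have "ennreal (exp (- k * (norm x)\<^sup>2)) = (\<Prod>b\<in>Basis. ennreal (exp (- k * (x \<bullet> b)\<^sup>2)))" for x :: 'a
  proof -
    have "- k * (norm x)\<^sup>2 = (\<Sum>b\<in>Basis. - k * (x \<bullet> b)\<^sup>2)"
      by (subst power2_norm_eq_inner, subst euclidean_inner) (simp add: power2_eq_square sum_distrib_left)
    then show ?thesis by (simp add: prod_ennreal exp_sum)
  qed
  then have "(\<integral>\<^sup>+(x::'a). ennreal (exp (- k * (norm x)\<^sup>2)) \<partial>lborel)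
      = (\<Prod>b\<in>(Basis::'a set). \<integral>\<^sup>+y. ennreal (exp (- k * y\<^sup>2)) \<partial>lborel)"
    using nn_integral_lborel_prod[of "\<lambda>b::'a. \<lambda>y. exp (- k * y\<^sup>2)"] by simp
  also have "\<dots> < \<infinity>" using fin by (simp add: power_less_top_ennreal)
  finally show "(\<integral>\<^sup>+(x::'a). ennreal (exp (- k * (norm x)\<^sup>2)) \<partial>lborel) < \<infinity>" .
qed auto

text \<open>Young's inequality spends half of the quadratic decay on the linear term. Functions of
  this kind dominate the tilted integrals below.\<close>

lemma integrable_exp_linear_gaussian:
  fixes k A :: real
  assumes k: "k > 0"
  shows "integrable lborel (\<lambda>x::'a::euclidean_space. exp (A * norm x - k * (norm x)\<^sup>2))"
proof (rule Bochner_Integration.integrable_bound)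
  show "integrable lborel (\<lambda>x::'a. exp (A\<^sup>2 / (2 * k)) * exp (- (k/2) * (norm x)\<^sup>2))"
    using k by (intro integrable_mult_right integrable_gaussian) simp
  have "A * norm x - k * (norm x)\<^sup>2 \<le> A\<^sup>2 / (2 * k) + - (k/2) * (norm x)\<^sup>2" for x :: 'a
  proof -
    have "0 \<le> (A - k * norm x)\<^sup>2 / (2 * k)" using k by simp
    also have "\<dots> = A\<^sup>2 / (2 * k) - A * norm x + k / 2 * (norm x)\<^sup>2"
      using k by (simp add: power2_eq_square field_simps)
    finally show ?thesis by (simp add: algebra_simps)
  qed
  then have "exp (A * norm x - k * (norm x)\<^sup>2) \<le> exp (A\<^sup>2 / (2 * k)) * exp (- (k/2) * (norm x)\<^sup>2)" for x :: 'a
    by (simp only: exp_add[symmetric] exp_le_cancel_iff)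
  then show "AE x::'a in lborel. norm (exp (A * norm x - k * (norm x)\<^sup>2))
      \<le> norm (exp (A\<^sup>2 / (2 * k)) * exp (- (k/2) * (norm x)\<^sup>2))"
    by (simp add: abs_mult)
qed auto

lemma le_exp: "x \<le> exp x" for x :: real
  using exp_ge_add_one_self[of x] by linarith

text \<open>By translation invariance the increments \<open>f (x + e) - f x\<close> integrate to zero, and they are
  averages over \<open>s\<close> of the derivative at \<open>x + s e\<close>.\<close>

lemma integral_directional_derivative_eq_0:
  fixes f :: "'a::euclidean_space \<Rightarrow> real"
  assumes deriv: "\<And>x. (f has_derivative f' x) (at x)"
    and cont: "continuous_on UNIV (\<lambda>x. f' x e)"
    and f: "integrable lborel f" and f': "integrable lborel (\<lambda>x. f' x e)"
  shows "(\<integral>x. f' x e \<partial>lborel) = 0"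
proof -
  define h where "h x = f' x e" for x
  have [measurable]: "h \<in> borel_measurable borel" "f \<in> borel_measurable borel"
    using cont f by (auto intro: borel_measurable_continuous_onI simp: h_def)
  have h_int: "integrable lborel h" using f' unfolding h_def .
  define w where "w s x = (indicator {0..1} s :: real) *\<^sub>R h (s *\<^sub>R e + x)" for s :: real and x :: 'a
  have w_meas [measurable]: "case_prod w \<in> borel_measurable (lborel \<Otimes>\<^sub>M lborel)"
    unfolding w_def by measurable
  have "integrable (lborel \<Otimes>\<^sub>M lborel) (case_prod w)"
  proof (rule lborel_pair.Fubini_integrable)
    have "(\<integral>x. norm (w s x) \<partial>lborel) = indicator {0..1} s *\<^sub>R (\<integral>x. \<bar>h x\<bar> \<partial>lborel)" for s
      using integral_lborel_shift[of "\<lambda>x. \<bar>h x\<bar>" "s *\<^sub>R e"] by (simp add: w_def abs_mult)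
    then show "integrable lborel (\<lambda>s. \<integral>x. norm (case (s, x) of (s, x) \<Rightarrow> w s x) \<partial>lborel)"
      by (simp add: integrable_real_indicator)
    show "AE s in lborel. integrable lborel (\<lambda>x. case (s, x) of (s, x) \<Rightarrow> w s x)"
      unfolding w_def by (auto intro!: integrable_lborel_shift h_int)
  qed simp
  \<comment> \<open>Integrating over \<open>s\<close> first gives an increment of \<open>f\<close>;
    integrating over \<open>x\<close> first gives the same integral of \<open>h\<close> for every
    \<open>s\<close> in the unit interval.\<close>
  then have "(\<integral>x. (\<integral>s. w s x \<partial>lborel) \<partial>lborel) = (\<integral>s. (\<integral>x. w s x \<partial>lborel) \<partial>lborel)"
    by (rule lborel_pair.Fubini_integral)
  moreover have "(\<integral>s. w s x \<partial>lborel) = f (e + x) - f x" for x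
  proof -
    have "(\<integral>s. w s x \<partial>lborel) = f (1 *\<^sub>R e + x) - f (0 *\<^sub>R e + x)"
      unfolding w_def
    proof (rule integral_FTC_atLeastAtMost)
      fix s :: real
      have "((\<lambda>s. f (s *\<^sub>R e + x)) has_derivative (\<lambda>r. f' (s *\<^sub>R e + x) (r *\<^sub>R e))) (at s within {0..1})"
        by (rule has_derivative_compose[of "\<lambda>s. s *\<^sub>R e + x" _ _ _ f, OF _ deriv])
           (auto intro!: derivative_eq_intros)
      then show "((\<lambda>s. f (s *\<^sub>R e + x)) has_vector_derivative h (s *\<^sub>R e + x)) (at s within {0..1})"
        unfolding has_vector_derivative_def h_def
        by (simp add: linear_scale[OF has_derivative_linear[OF deriv]])
    next
      show "continuous_on {0..1} (\<lambda>s. h (s *\<^sub>R e + x))"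
        unfolding h_def by (rule continuous_on_compose2[OF cont]) (auto intro!: continuous_intros)
    qed simp
    then show ?thesis by simp
  qed
  moreover have "(\<integral>x. f (e + x) - f x \<partial>lborel) = 0"
    using f by (subst Bochner_Integration.integral_diff) (auto simp: integrable_lborel_shift integral_lborel_shift)
  moreover have "(\<integral>x. w s x \<partial>lborel) = indicator {0..1} s *\<^sub>R (\<integral>x. h x \<partial>lborel)" for s
    using integral_lborel_shift[of h "s *\<^sub>R e"] by (simp add: w_def)
  ultimately show ?thesis by (simp add: h_def)
qed

text \<open>The set of disagreement is open and Lebesgue null, hence empty. This is what fixes
  pointwise values of conditional means and identifies potentials of equal densities.\<close>

lemma continuous_AE_eq:
  fixes f g :: "'a::euclidean_space \<Rightarrow> 'b::t2_space"
  assumes "continuous_on UNIV f" "continuous_on UNIV g" and "AE x in lborel. f x = g x"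
  shows "f = g"
proof -
  have op: "open {x. f x \<noteq> g x}"
    using assms by (intro open_Collect_neq) auto
  then have "{x. f x \<noteq> g x} \<in> null_sets lborel"
    using assms(3) by (subst (asm) AE_iff_null) auto
  then have "negligible {x. f x \<noteq> g x}"
    by (simp add: negligible_iff_null_sets null_sets_completionI)
  then show ?thesis
    using open_not_negligible[OF op] by blast
qed

section \<open>Tilted Gaussian means\<close>

lemma gradient_mvt:
  fixes g :: "'a::real_inner \<Rightarrow> real"
  assumes "\<And>x. (g has_derivative (\<lambda>h. D x \<bullet> h)) (at x)"
  shows "\<exists>s\<in>{0<..<1}. g (x + h) - g x = D (x + s *\<^sub>R h) \<bullet> h"
proof -
  have "((\<lambda>s. g (x + s *\<^sub>R h)) has_derivative (\<lambda>r. D (x + s *\<^sub>R h) \<bullet> (r *\<^sub>R h))) (at s within {0..1})"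
    for s :: real
    by (rule has_derivative_compose[of "\<lambda>s. x + s *\<^sub>R h" _ _ _ g, OF _ assms])
       (auto intro!: derivative_eq_intros)
  from mvt_simple[OF zero_less_one this] show ?thesis by simp
qed

text \<open>A long segment is cut into steps of length at most 1. Short increments are the
  convenient ones for exponential weights, since factors like
  \<open>exp (K * norm u * norm n)\<close> are then bounded independently of
  \<open>u\<close>.\<close>

lemma lipschitz_on_UNIV_local:
  fixes f :: "'a::real_normed_vector \<Rightarrow> 'b::real_normed_vector"
  assumes local: "\<And>x u. norm u \<le> 1 \<Longrightarrow> norm (f (x + u) - f x) \<le> C * norm u" and C: "C \<ge> 0"
  shows "C-lipschitz_on UNIV f"
proof (rule lipschitz_onI)
  fix x y :: 'a
  obtain N :: nat where N: "norm (x - y) < real N" using reals_Archimedean2 by blast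
  then have N0: "real N > 0" using norm_ge_zero[of "x - y"] by linarith
  define u where "u = (1 / real N) *\<^sub>R (x - y)"
  have u: "norm u \<le> 1" "real N * norm u = norm (x - y)" "real N *\<^sub>R u = x - y"
    using N N0 by (auto simp: u_def divide_le_eq)
  have "norm (f (y + real j *\<^sub>R u) - f y) \<le> real j * (C * norm u)" for j
  proof (induction j)
    case (Suc j)
    have "f (y + real (Suc j) *\<^sub>R u) - f y
        = (f ((y + real j *\<^sub>R u) + u) - f (y + real j *\<^sub>R u)) + (f (y + real j *\<^sub>R u) - f y)"
      by (simp add: scaleR_add_left algebra_simps)
    also have "norm \<dots> \<le> C * norm u + real j * (C * norm u)"
      by (rule norm_triangle_mono[OF local[OF u(1)] Suc])
    finally show ?case by (simp add: algebra_simps)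
  qed simp
  from this[of N] show "dist (f x) (f y) \<le> C * dist x y"
    using u by (simp add: dist_norm mult.left_commute)
qed (rule C)

lemma norm_integral_le:
  fixes f :: "'a \<Rightarrow> 'b::{banach, second_countable_topology}"
  assumes "f \<in> borel_measurable M" "integrable M b" "\<And>x. norm (f x) \<le> b x"
  shows "integrable M f" and "norm (\<integral>x. f x \<partial>M) \<le> (\<integral>x. b x \<partial>M)"
proof -
  show f: "integrable M f"
    using assms by (intro Bochner_Integration.integrable_bound[OF assms(2)])
      (auto intro!: always_eventually order_trans[OF _ abs_ge_self])
  have "norm (\<integral>x. f x \<partial>M) \<le> (\<integral>x. norm (f x) \<partial>M)" by (rule integral_norm_bound)
  also have "\<dots> \<le> (\<integral>x. b x \<partial>M)" using f assms by (intro integral_mono) auto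
  finally show "norm (\<integral>x. f x \<partial>M) \<le> (\<integral>x. b x \<partial>M)" .
qed

lemma abs_exp_minus_1_le: "\<bar>exp x - 1\<bar> \<le> \<bar>x\<bar> * exp \<bar>x\<bar>" for x :: real
proof (cases "x \<ge> 0")
  case True
  have "exp x * (1 - x) \<le> exp x * exp (- x)"
    using exp_ge_add_one_self[of "- x"] by (intro mult_left_mono) auto
  then show ?thesis using True by (simp add: exp_minus algebra_simps)
next
  case False
  then have "1 - exp x \<le> - x" "1 \<le> exp (- x)" using exp_ge_add_one_self[of x] by (linarith, simp)
  then have "1 - exp x \<le> - x * exp (- x)" using False
    by (smt (verit) mult_left_mono mult_cancel_left2)
  then show ?thesis using False by simp
qed

text \<open>The measures of interest have density proportional to
  \<open>exp (- (norm n)\<^sup>2 / 2 - g (y + q *\<^sub>R n))\<close> with \<open>q\<close> in \<open>[0, 1]\<close>. The lower bound on \<open>g\<close> covers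
  semi-convex potentials (\<open>L = 0\<close>) as well as Lipschitz ones (\<open>\<mu> = 0\<close>).\<close>

locale tilt =
  fixes g :: "'a::euclidean_space \<Rightarrow> real" and D :: "'a \<Rightarrow> 'a" and K L \<mu> :: real
  assumes gradient: "\<And>x. (g has_derivative (\<lambda>h. D x \<bullet> h)) (at x)"
    and gradient_lipschitz: "K-lipschitz_on UNIV D"
    and lower: "\<And>x h. g (x + h) \<ge> g x + D x \<bullet> h - \<mu> / 2 * (norm h)\<^sup>2 - L * norm h"
    and constants: "0 \<le> \<mu>" "\<mu> < 1" "0 \<le> L"
begin

definition weight :: "'a \<Rightarrow> real \<Rightarrow> 'a \<Rightarrow> real" where
  "weight y q n = exp (- (norm n)\<^sup>2 / 2 - g (y + q *\<^sub>R n))"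

text \<open>Mathematically the gradient in \<open>y\<close> of the smoothed potential, minus the
  logarithm of the integral of \<open>weight y q\<close>. For \<open>q = 0\<close> it is
  \<open>D y\<close>.\<close>

definition tilted_mean :: "'a \<Rightarrow> real \<Rightarrow> 'a" where
  "tilted_mean y q = (1 / (\<integral>n. weight y q n \<partial>lborel)) *\<^sub>R (\<integral>n. weight y q n *\<^sub>R D (y + q *\<^sub>R n) \<partial>lborel)"

section \<open>Growth and integrability of the tilted weights\<close>

lemma K_nonneg: "K \<ge> 0"
  using gradient_lipschitz by (rule lipschitz_on_nonneg)

lemma D_diff: "norm (D x - D y) \<le> K * norm (x - y)"
  using lipschitz_onD[OF gradient_lipschitz, of x y] by (simp add: dist_norm)

lemma continuous_D: "continuous_on S D"
  using lipschitz_on_continuous_on[OF gradient_lipschitz] continuous_on_subset by blast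

lemma continuous_g: "continuous_on S g"
  using has_derivative_continuous[OF gradient] continuous_at_imp_continuous_on by blast

lemma measurable_gD [measurable]: "g \<in> borel_measurable borel" "D \<in> borel_measurable borel"
  by (auto intro: borel_measurable_continuous_onI continuous_D continuous_g)

lemma measurable_weight [measurable]: "weight y q \<in> borel_measurable borel"
  unfolding weight_def by measurable

lemma weight_pos: "weight y q n > 0"
  by (simp add: weight_def)

text \<open>Using the mean value theorem instead of an integral remainder costs a factor of two in
  the quadratic term.\<close>

lemma upper: "g (x + h) \<le> g x + D x \<bullet> h + K * (norm h)\<^sup>2"
proof -
  obtain s where s: "s \<in> {0<..<1}" "g (x + h) - g x = D (x + s *\<^sub>R h) \<bullet> h"
    using gradient_mvt[of g D, OF gradient] by blast
  have "(D (x + s *\<^sub>R h) - D x) \<bullet> h \<le> norm (D (x + s *\<^sub>R h) - D x) * norm h"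
    by (rule norm_cauchy_schwarz)
  also have "\<dots> \<le> K * norm (s *\<^sub>R h) * norm h"
    using D_diff[of "x + s *\<^sub>R h" x] by (intro mult_right_mono) auto
  also have "\<dots> \<le> K * (1 * norm h) * norm h"
    using s K_nonneg unfolding norm_scaleR by (intro mult_right_mono mult_left_mono) auto
  finally show ?thesis using s by (simp add: inner_diff_left power2_eq_square)
qed

lemma lower_scaled:
  assumes "q \<in> {0..1}"
  shows "g (x + q *\<^sub>R h) \<ge> g x + q * (D x \<bullet> h) - \<mu> / 2 * (norm h)\<^sup>2 - L * norm h"
proof -
  have q: "\<bar>q\<bar> * norm h \<le> norm h" using assms by (auto intro!: mult_left_le_one_le)
  have "(norm (q *\<^sub>R h))\<^sup>2 \<le> (norm h)\<^sup>2" unfolding norm_scaleR by (rule power_mono[OF q]) auto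
  then have "\<mu> / 2 * (norm (q *\<^sub>R h))\<^sup>2 \<le> \<mu> / 2 * (norm h)\<^sup>2" "L * norm (q *\<^sub>R h) \<le> L * norm h"
    using constants q by (auto intro!: mult_left_mono)
  then show ?thesis using lower[of x "q *\<^sub>R h"] by simp
qed

text \<open>The Gaussian contributes curvature 1 and \<open>g\<close> takes away at most \<mu>, so
  quadratic decay with coefficient \<open>(1 - \<mu>) / 2\<close> remains, uniformly in
  \<open>q\<close>.\<close>

lemma weight_le:
  assumes "q \<in> {0..1}"
  shows "weight y q n \<le> exp (- g y) * exp ((norm (D y) + L) * norm n - (1 - \<mu>) / 2 * (norm n)\<^sup>2)"
proof -
  have "\<bar>q * (D y \<bullet> n)\<bar> \<le> 1 * (norm (D y) * norm n)"
    unfolding abs_mult using assms Cauchy_Schwarz_ineq2[of "D y" n] by (intro mult_mono) auto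
  then have "- (norm n)\<^sup>2 / 2 - g (y + q *\<^sub>R n)
      \<le> - g y + ((norm (D y) + L) * norm n - (1 - \<mu>) / 2 * (norm n)\<^sup>2)"
    using lower_scaled[OF assms, of y n] by (simp add: field_simps)
  then show ?thesis unfolding weight_def exp_add[symmetric] by simp
qed

lemma integrable_weight:
  fixes f :: "'a \<Rightarrow> 'b::{banach, second_countable_topology}"
  assumes q: "q \<in> {0..1}" and [measurable]: "f \<in> borel_measurable borel"
    and f: "\<And>n. norm (f n) \<le> C * exp (A * norm n)"
  shows "integrable lborel (\<lambda>n. weight y q n *\<^sub>R f n)"
proof (rule Bochner_Integration.integrable_bound)
  define B where "B n = (C * exp (- g y)) * exp ((A + norm (D y) + L) * norm n - (1 - \<mu>) / 2 * (norm n)\<^sup>2)" for n :: 'a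
  show "integrable lborel B"
    unfolding B_def using constants by (intro integrable_mult_right integrable_exp_linear_gaussian) auto
  have "norm (weight y q n *\<^sub>R f n) \<le> norm (B n)" for n
  proof -
    have "norm (weight y q n *\<^sub>R f n) \<le> (exp (- g y) * exp ((norm (D y) + L) * norm n - (1 - \<mu>) / 2 * (norm n)\<^sup>2))
        * (C * exp (A * norm n))"
      unfolding norm_scaleR abs_of_pos[OF weight_pos] using weight_le[OF q] f by (intro mult_mono) auto
    also have "\<dots> = B n"
      unfolding B_def by (simp add: algebra_simps exp_add[symmetric])
    finally show ?thesis by simp
  qed
  then show "AE n in lborel. norm (weight y q n *\<^sub>R f n) \<le> norm (B n)" by simp
qed simp

lemma norm_D_le:
  assumes "q \<in> {0..1}"
  shows "norm (D (y + q *\<^sub>R n)) \<le> (norm (D y) + K) * exp (1 * norm n)"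
proof -
  have "norm (D (y + q *\<^sub>R n)) \<le> norm (D y) + norm (D (y + q *\<^sub>R n) - D y)"
    using norm_triangle_sub by blast
  also have "norm (D (y + q *\<^sub>R n) - D y) \<le> K * norm (q *\<^sub>R n)"
    using D_diff[of "y + q *\<^sub>R n" y] by simp
  also have "K * norm (q *\<^sub>R n) \<le> K * exp (norm n)"
    using assms le_exp[of "norm n"] mult_left_le_one_le[of "norm n" q]
    by (intro mult_left_mono K_nonneg) simp
  also have "norm (D y) \<le> norm (D y) * exp (norm n)"
    by (simp add: mult_le_cancel_left1)
  finally show ?thesis by (simp add: algebra_simps)
qed

lemma integrable_weight_simps:
  assumes "q \<in> {0..1}"
  shows "integrable lborel (weight y q)"
    and "integrable lborel (\<lambda>n. weight y q n *\<^sub>R D (y + q *\<^sub>R n))"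
    and "integrable lborel (\<lambda>n. weight y q n *\<^sub>R n)"
proof -
  show "integrable lborel (weight y q)"
    using integrable_weight[OF assms, of "\<lambda>_. 1 :: real" 1 0] by simp
  show "integrable lborel (\<lambda>n. weight y q n *\<^sub>R D (y + q *\<^sub>R n))"
    by (rule integrable_weight[OF assms _ norm_D_le[OF assms]]) measurable
  show "integrable lborel (\<lambda>n. weight y q n *\<^sub>R n)"
    by (rule integrable_weight[OF assms, of _ 1 1]) (auto simp: le_exp)
qed

lemma integral_pos:
  fixes f :: "'a \<Rightarrow> real"
  assumes "integrable lborel f" "\<And>x. f x > 0"
  shows "(\<integral>x. f x \<partial>lborel) > 0"
proof -
  have "\<not> (AE x in lborel. f x = 0)"
  proof
    assume "AE x in lborel. f x = 0"
    then have "AE x in lborel. x \<notin> (UNIV :: 'a set)"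
      by eventually_elim (use assms(2) in \<open>simp add: less_le\<close>)
    then show False
      by (subst (asm) AE_iff_measurable[OF _ refl]) (simp_all add: emeasure_lborel_UNIV)
  qed
  then have "(\<integral>x. f x \<partial>lborel) \<noteq> 0"
    using assms by (subst integral_nonneg_eq_0_iff_AE) (auto simp: less_imp_le)
  then show ?thesis
    using Bochner_Integration.integral_nonneg[of lborel f] assms(2) by (simp add: less_le)
qed

lemma mass_pos: "q \<in> {0..1} \<Longrightarrow> (\<integral>n. weight y q n \<partial>lborel) > 0"
  by (intro integral_pos integrable_weight_simps weight_pos)

section \<open>Integration by parts and critical points of the tilted potential\<close>

lemma potential_deriv:
  "((\<lambda>n. (norm n)\<^sup>2 / 2 + g (y + q *\<^sub>R n)) has_derivative (\<lambda>h. (n + q *\<^sub>R D (y + q *\<^sub>R n)) \<bullet> h)) (at n)"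
proof -
  have "((\<lambda>n. g (y + q *\<^sub>R n)) has_derivative (\<lambda>h. D (y + q *\<^sub>R n) \<bullet> (q *\<^sub>R h))) (at n)"
    by (rule has_derivative_compose[of "\<lambda>n. y + q *\<^sub>R n" _ _ _ g, OF _ gradient])
       (auto intro!: derivative_eq_intros)
  then show ?thesis
    unfolding power2_norm_eq_inner
    by (auto intro!: derivative_eq_intros ext simp: inner_add_left inner_add_right inner_commute)
qed

text \<open>The gradient \<open>n + q *\<^sub>R D (y + q *\<^sub>R n)\<close> of the potential has
  mean zero under the density that the potential defines. The factor \<open>q\<close> gained on the
  right is what cancels the singularity at time 1.\<close>

lemma gaussian_integration_by_parts:
  assumes q: "q \<in> {0..1}"
  shows "(\<integral>n. weight y q n *\<^sub>R n \<partial>lborel) = - q *\<^sub>R (\<integral>n. weight y q n *\<^sub>R D (y + q *\<^sub>R n) \<partial>lborel)"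
proof -
  have int: "integrable lborel (\<lambda>n. weight y q n *\<^sub>R n + q *\<^sub>R (weight y q n *\<^sub>R D (y + q *\<^sub>R n)))"
    by (intro Bochner_Integration.integrable_add integrable_scaleR_right impI integrable_weight_simps q)
  have "(\<integral>n. weight y q n *\<^sub>R n + q *\<^sub>R (weight y q n *\<^sub>R D (y + q *\<^sub>R n)) \<partial>lborel) \<bullet> e = 0" for e
  proof -
    have w: "weight y q n = exp (- ((norm n)\<^sup>2 / 2 + g (y + q *\<^sub>R n)))" for n
      by (simp add: weight_def)
    have "(\<integral>n. weight y q n * - ((n + q *\<^sub>R D (y + q *\<^sub>R n)) \<bullet> e) \<partial>lborel) = 0"
    proof (rule integral_directional_derivative_eq_0[where f = "weight y q"
          and f' = "\<lambda>n h. weight y q n * - ((n + q *\<^sub>R D (y + q *\<^sub>R n)) \<bullet> h)"])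
      show "(weight y q has_derivative (\<lambda>h. weight y q n * - ((n + q *\<^sub>R D (y + q *\<^sub>R n)) \<bullet> h))) (at n)" for n
        unfolding w
        by (rule has_derivative_eq_rhs[OF has_derivative_exp[OF has_derivative_minus[OF potential_deriv]]])
           (simp add: mult.commute)
      show "continuous_on UNIV (\<lambda>n. weight y q n * - ((n + q *\<^sub>R D (y + q *\<^sub>R n)) \<bullet> e))"
        unfolding weight_def
        by (intro continuous_intros continuous_on_compose2[OF continuous_g[of UNIV]]
            continuous_on_compose2[OF continuous_D[of UNIV]]) auto
      have "integrable lborel (\<lambda>n. - ((weight y q n *\<^sub>R n + q *\<^sub>R (weight y q n *\<^sub>R D (y + q *\<^sub>R n))) \<bullet> e))"
        by (intro Bochner_Integration.integrable_minus integrable_inner_left impI int)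
      then show "integrable lborel (\<lambda>n. weight y q n * - ((n + q *\<^sub>R D (y + q *\<^sub>R n)) \<bullet> e))"
        by (simp add: inner_add_left algebra_simps)
    qed (rule integrable_weight_simps(1)[OF q])
    moreover have "(\<integral>n. weight y q n *\<^sub>R n + q *\<^sub>R (weight y q n *\<^sub>R D (y + q *\<^sub>R n)) \<partial>lborel) \<bullet> e
        = - (\<integral>n. weight y q n * - ((n + q *\<^sub>R D (y + q *\<^sub>R n)) \<bullet> e) \<partial>lborel)"
      unfolding integral_inner_left[OF int, symmetric] integral_minus[symmetric]
      by (rule Bochner_Integration.integral_cong) (simp_all add: inner_add_left algebra_simps)
    ultimately show ?thesis by simp
  qed
  then have "(\<integral>n. weight y q n *\<^sub>R n + q *\<^sub>R (weight y q n *\<^sub>R D (y + q *\<^sub>R n)) \<partial>lborel) = 0"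
    by (subst inner_eq_zero_iff[symmetric])
  moreover have "(\<integral>n. weight y q n *\<^sub>R n + q *\<^sub>R (weight y q n *\<^sub>R D (y + q *\<^sub>R n)) \<partial>lborel)
      = (\<integral>n. weight y q n *\<^sub>R n \<partial>lborel) + q *\<^sub>R (\<integral>n. weight y q n *\<^sub>R D (y + q *\<^sub>R n) \<partial>lborel)"
    using integrable_weight_simps[OF q]
    by (subst Bochner_Integration.integral_add) (auto simp only: integral_scaleR_right intro: integrable_scaleR_right)
  ultimately show ?thesis
    by (simp add: eq_neg_iff_add_eq_0)
qed

text \<open>Coercivity: beyond radius \<open>A / k\<close> the quadratic decay outweighs the linear
  term and the potential is at least its value at 0. The minimum over that ball is therefore global,
  and the gradient vanishes there.\<close>

lemma exists_critical_point:
  assumes q: "q \<in> {0..1}"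
  shows "\<exists>m. m + q *\<^sub>R D (y + q *\<^sub>R m) = 0"
proof -
  define \<Phi> where "\<Phi> n = (norm n)\<^sup>2 / 2 + g (y + q *\<^sub>R n)" for n
  define A where "A = norm (D y) + L"
  define k where "k = (1 - \<mu>) / 2"
  have k: "k > 0" and A: "A \<ge> 0" using constants by (auto simp: k_def A_def)
  have \<Phi>: "(\<Phi> has_derivative (\<lambda>h. (n + q *\<^sub>R D (y + q *\<^sub>R n)) \<bullet> h)) (at n)" for n
    unfolding \<Phi>_def by (rule potential_deriv)
  have cont: "continuous_on S \<Phi>" for S
    by (intro continuous_at_imp_continuous_on ballI has_derivative_continuous[OF \<Phi>])
  have far: "\<Phi> n \<ge> \<Phi> 0" if "norm n \<ge> A / k" for n
  proof -
    have "\<Phi> n \<ge> g y - (A * norm n - k * (norm n)\<^sup>2)"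
      using weight_le[OF q, of y n] unfolding weight_def exp_add[symmetric] A_def k_def \<Phi>_def by simp
    moreover have "A * norm n \<le> (k * norm n) * norm n"
      using that k by (intro mult_right_mono) (auto simp: divide_le_eq mult.commute)
    ultimately show ?thesis by (simp add: \<Phi>_def power2_eq_square mult.assoc)
  qed
  have "\<exists>m\<in>cball 0 (A / k). \<forall>n\<in>cball 0 (A / k). \<Phi> m \<le> \<Phi> n"
    using divide_nonneg_pos[OF A k] cont by (intro continuous_attains_inf) auto
  then obtain m where m: "\<And>n. norm n \<le> A / k \<Longrightarrow> \<Phi> m \<le> \<Phi> n"
    unfolding Ball_def mem_cball_0 by blast
  have "\<Phi> m \<le> \<Phi> n" for n
  proof (cases "norm n \<le> A / k")
    case False
    then have "\<Phi> 0 \<le> \<Phi> n" by (intro far) simp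
    moreover have "\<Phi> m \<le> \<Phi> 0" using divide_nonneg_pos[OF A k] by (intro m) simp
    ultimately show ?thesis by simp
  qed (rule m)
  then have "(\<lambda>h. (m + q *\<^sub>R D (y + q *\<^sub>R m)) \<bullet> h) = (\<lambda>h. 0)"
    by (intro has_derivative_local_min[OF \<Phi>]) simp
  then show ?thesis by (metis inner_eq_zero_iff)
qed

text \<open>Centring at a critical point \<open>m\<close> of the potential makes the bounds independent of \<open>y\<close> and \<open>q\<close>.\<close>

lemma weight_bounds:
  assumes q: "q \<in> {0..1}" and m: "m + q *\<^sub>R D (y + q *\<^sub>R m) = 0"
  defines "W \<equiv> \<lambda>n. weight y q n / weight y q m"
  shows "W n \<le> exp (L * norm (n - m) - (1 - \<mu>) / 2 * (norm (n - m))\<^sup>2)"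
    and "W n \<ge> exp (- (1/2 + K) * (norm (n - m))\<^sup>2)"
proof -
  define h where "h = n - m"
  have n: "n = m + h" "y + q *\<^sub>R n = (y + q *\<^sub>R m) + q *\<^sub>R h" by (auto simp: h_def algebra_simps)
  \<comment> \<open>Criticality of \<open>m\<close> cancels the terms linear in \<open>h\<close>,
    which are the only ones carrying the unbounded quantities \<open>m\<close> and
    \<open>D (y + q *\<^sub>R m)\<close>.\<close>
  have "m \<bullet> h + q * (D (y + q *\<^sub>R m) \<bullet> h) = 0"
    using arg_cong[OF m, of "\<lambda>x. x \<bullet> h"] by (simp add: inner_add_left)
  moreover have "(norm n)\<^sup>2 = (norm m)\<^sup>2 + 2 * (m \<bullet> h) + (norm h)\<^sup>2"
    unfolding n(1) power2_norm_eq_inner by (simp add: inner_add_left inner_add_right inner_commute)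
  ultimately have *: "(norm n)\<^sup>2 / 2 + q * (D (y + q *\<^sub>R m) \<bullet> h) = (norm m)\<^sup>2 / 2 + (norm h)\<^sup>2 / 2"
    by linarith
  have W: "W n = exp (((norm m)\<^sup>2 / 2 + g (y + q *\<^sub>R m)) - ((norm n)\<^sup>2 / 2 + g (y + q *\<^sub>R n)))"
    unfolding W_def weight_def exp_diff[symmetric] by simp
  show "W n \<le> exp (L * norm (n - m) - (1 - \<mu>) / 2 * (norm (n - m))\<^sup>2)"
    unfolding W exp_le_cancel_iff h_def[symmetric]
    using lower_scaled[OF q, of "y + q *\<^sub>R m" h] * unfolding n(2) by (simp add: field_simps)
  have "K * (norm (q *\<^sub>R h))\<^sup>2 \<le> K * (norm h)\<^sup>2"
    unfolding norm_scaleR using q by (intro mult_left_mono K_nonneg power_mono mult_left_le_one_le) auto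
  then show "W n \<ge> exp (- (1/2 + K) * (norm (n - m))\<^sup>2)"
    unfolding W exp_le_cancel_iff h_def[symmetric]
    using upper[of "y + q *\<^sub>R m" "q *\<^sub>R h"] * unfolding n(2) by (simp add: field_simps)
qed

text \<open>Moving \<open>y\<close> by \<open>u\<close> multiplies the density normalised at \<open>m\<close> by \<open>exp r\<close> with
  \<open>\<bar>r n\<bar> \<le> K * norm u * norm (n - m)\<close>, so both integrals in the mean change by a multiple of \<open>norm u\<close>.\<close>

lemma tilted_mean_lipschitz:
  "\<exists>C\<ge>0. \<forall>q\<in>{0..1}. C-lipschitz_on UNIV (\<lambda>y. tilted_mean y q)"
proof -
  define k where "k = (1 - \<mu>) / 2"
  have k: "k > 0" using constants by (simp add: k_def)
  \<comment> \<open>The linear rate collects \<open>L\<close> from the upper bound on the weight,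
    \<open>K\<close> from \<open>exp \<bar>r n\<bar>\<close>, and 2 to absorb up to two factors
    \<open>norm (n - m)\<close>.\<close>
  define E where "E h = exp ((L + K + 2) * norm h - k * (norm h)\<^sup>2)" for h :: 'a
  define S where "S = (\<integral>h. E h \<partial>lborel)"
  \<comment> \<open>A common lower bound for the old and the new normalised weight; its integral
    \<open>z\<close> keeps both normalising constants away from 0, independently of \<open>y\<close>
    and \<open>q\<close>.\<close>
  define B where "B h = exp (- K * norm h - (1/2 + K) * (norm h)\<^sup>2)" for h :: 'a
  define z where "z = (\<integral>h. B h \<partial>lborel)"
  have E_int: "integrable lborel E" and B_int: "integrable lborel B"
    unfolding E_def B_def using k K_nonneg by (intro integrable_exp_linear_gaussian; simp)+
  have E_int': "integrable lborel (\<lambda>n. E (n - m))" and S: "(\<integral>n. E (n - m) \<partial>lborel) = S" for m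
    using integrable_lborel_shift[OF E_int, of "- m"] integral_lborel_shift[of E "- m"] E_int
    by (simp_all add: S_def)
  have B_int': "integrable lborel (\<lambda>n. B (n - m))" and z: "(\<integral>n. B (n - m) \<partial>lborel) = z" for m
    using integrable_lborel_shift[OF B_int, of "- m"] integral_lborel_shift[of B "- m"] B_int
    by (simp_all add: z_def)
  have z_pos: "z > 0" unfolding z_def by (rule integral_pos[OF B_int]) (simp add: B_def)
  have S_nonneg: "S \<ge> 0" unfolding S_def E_def by simp
  \<comment> \<open>The three terms come, in order, from the change of \<open>D\<close> at a fixed
    weight, from the change of the weight, and from the change of the normalising constant.\<close>
  define C where "C = K + K * K * S / z + (K * S) * (K * S) / (z * z)"
  have C: "C \<ge> 0" unfolding C_def using K_nonneg z_pos S_nonneg by simp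
  have "norm (tilted_mean (y + u) q - tilted_mean y q) \<le> C * norm u"
    if q: "q \<in> {0..1}" and u: "norm u \<le> 1" for q y u
  proof -
    obtain m where m: "m + q *\<^sub>R D (y + q *\<^sub>R m) = 0" using exists_critical_point[OF q] by blast
    define W where "W n = weight y q n / weight y q m" for n
    \<comment> \<open>The shifted weight is normalised at the same \<open>m\<close>, critical for
      \<open>y\<close> only, so that the ratio of the two weights equals 1 at
      \<open>m\<close>.\<close>
    define W' where "W' n = weight (y + u) q n / weight (y + u) q m" for n
    define r where "r n = (g (y + q *\<^sub>R n) - g (y + q *\<^sub>R m)) - (g (y + u + q *\<^sub>R n) - g (y + u + q *\<^sub>R m))" for n
    have W_meas [measurable]: "W \<in> borel_measurable borel" "W' \<in> borel_measurable borel"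
      unfolding W_def W'_def by measurable
    have W_pos: "W n > 0" "W' n > 0" for n unfolding W_def W'_def by (simp_all add: weight_pos)
    have W_upper: "W n \<le> exp (L * norm (n - m) - k * (norm (n - m))\<^sup>2)" for n
      using weight_bounds(1)[OF q m] unfolding W_def k_def .
    have W_lower: "W n \<ge> exp (- (1/2 + K) * (norm (n - m))\<^sup>2)" for n
      using weight_bounds(2)[OF q m] unfolding W_def .
    have W'_eq: "W' n = W n * exp (r n)" for n
      unfolding W_def W'_def weight_def r_def exp_diff[symmetric] exp_add[symmetric] by (simp add: algebra_simps)
    have r: "\<bar>r n\<bar> \<le> K * norm u * norm (n - m)" for n
    proof -
      \<comment> \<open>\<open>r n\<close> is a mixed second difference of \<open>g\<close>: the
        gradient of \<open>d\<close> compares \<open>D\<close> at two points that differ by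
        \<open>u\<close>, and the mean value theorem over the step
        \<open>q *\<^sub>R (n - m)\<close> yields the product bound.\<close>
      define d where "d x = g (y + x) - g (y + u + x)" for x
      have d: "(d has_derivative (\<lambda>h. (D (y + x) - D (y + u + x)) \<bullet> h)) (at x)" for x
      proof -
        have "((\<lambda>x. g (c + x)) has_derivative (\<lambda>h. D (c + x) \<bullet> h)) (at x)" for c
          by (rule has_derivative_compose[of "\<lambda>x. c + x" _ _ _ g, OF _ gradient])
             (auto intro!: derivative_eq_intros)
        then show ?thesis unfolding d_def inner_diff_left by (intro has_derivative_diff)
      qed
      have "r n = d (q *\<^sub>R m + q *\<^sub>R (n - m)) - d (q *\<^sub>R m)" unfolding r_def d_def by (simp add: algebra_simps)
      then obtain x where "r n = (D (y + x) - D (y + u + x)) \<bullet> (q *\<^sub>R (n - m))"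
        using gradient_mvt[of d "\<lambda>x. D (y + x) - D (y + u + x)" "q *\<^sub>R m" "q *\<^sub>R (n - m)", OF d] by auto
      then have "\<bar>r n\<bar> \<le> norm (D (y + x) - D (y + u + x)) * norm (q *\<^sub>R (n - m))"
        using Cauchy_Schwarz_ineq2 by metis
      also have "\<dots> \<le> (K * norm u) * (1 * norm (n - m))"
        unfolding norm_scaleR
        using q D_diff[of "y + x" "y + u + x"] K_nonneg
        by (intro mult_mono) (auto simp: norm_minus_commute)
      finally show ?thesis by simp
    qed
    have r1: "\<bar>r n\<bar> \<le> K * norm (n - m)" for n
    proof -
      have "K * norm u * norm (n - m) \<le> K * 1 * norm (n - m)"
        using u K_nonneg by (intro mult_right_mono mult_left_mono) auto
      then show ?thesis using r[of n] by simp
    qed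
    have W_E: "x * exp (K * norm (n - m)) * W n \<le> E (n - m)" if "x \<le> exp (2 * norm (n - m))" for x n
    proof -
      have "x * exp (K * norm (n - m)) * W n \<le> exp (2 * norm (n - m)) * exp (K * norm (n - m))
          * exp (L * norm (n - m) - k * (norm (n - m))\<^sup>2)"
        using that W_pos by (intro mult_mono W_upper) (auto simp: less_imp_le)
      also have "\<dots> = E (n - m)"
        unfolding E_def exp_add[symmetric] by (simp add: algebra_simps)
      finally show ?thesis .
    qed
    have one_le: "1 \<le> exp (K * norm (n - m))" for n using K_nonneg by simp
    have W_E': "x * W n \<le> E (n - m)" if "0 \<le> x" "x \<le> exp (2 * norm (n - m))" for x n
      using W_E[OF that(2)] mult_right_mono[OF one_le[of n], of "x * W n"] that(1) W_pos(1)[of n]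
      by (simp add: mult_ac)
    have norm_le: "norm (n - m) \<le> exp (2 * norm (n - m))" for n
      using le_exp[of "norm (n - m)"] exp_le_cancel_iff[of "norm (n - m)" "2 * norm (n - m)"]
        norm_ge_zero[of "n - m"] by linarith
    have norm_sq_le: "norm (n - m) * norm (n - m) \<le> exp (2 * norm (n - m))" for n
      using mult_mono[OF le_exp[of "norm (n - m)"] le_exp[of "norm (n - m)"]]
      by (simp add: exp_add[symmetric])
    have diff: "\<bar>W' n - W n\<bar> \<le> K * norm u * (norm (n - m) * exp (K * norm (n - m)) * W n)" for n
    proof -
      have "\<bar>W' n - W n\<bar> = W n * \<bar>exp (r n) - 1\<bar>"
        using W_pos(1)[of n] abs_mult[of "W n" "exp (r n) - 1"] by (simp add: W'_eq right_diff_distrib)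
      also have "\<dots> \<le> W n * (\<bar>r n\<bar> * exp \<bar>r n\<bar>)"
        using W_pos(1)[of n] by (intro mult_left_mono abs_exp_minus_1_le) auto
      also have "\<dots> \<le> W n * ((K * norm u * norm (n - m)) * exp (K * norm (n - m)))"
        using W_pos(1)[of n] r[of n] r1[of n] K_nonneg by (intro mult_left_mono mult_mono) auto
      finally show ?thesis by (simp add: mult_ac)
    qed
    have W_int: "integrable lborel W" and W'_int: "integrable lborel W'"
      unfolding W_def W'_def using integrable_weight_simps(1)[OF q] by auto
    define I where "I = (\<integral>n. W n \<partial>lborel)"
    define I' where "I' = (\<integral>n. W' n \<partial>lborel)"
    have "B (n - m) \<le> W n" "B (n - m) \<le> W' n" for n
    proof -
      have "B (n - m) = exp (- (1/2 + K) * (norm (n - m))\<^sup>2) * exp (- K * norm (n - m))"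
        unfolding B_def exp_add[symmetric] by (simp add: algebra_simps)
      also have "\<dots> \<le> W n * exp (- \<bar>r n\<bar>)"
        using r1[of n] W_pos(1)[of n] by (intro mult_mono W_lower) auto
      finally have *: "B (n - m) \<le> W n * exp (- \<bar>r n\<bar>)" .
      also have "\<dots> \<le> W n * 1" using W_pos(1)[of n] by (intro mult_left_mono) auto
      finally show "B (n - m) \<le> W n" by simp
      note *
      also have "W n * exp (- \<bar>r n\<bar>) \<le> W' n"
        unfolding W'_eq using W_pos(1)[of n] by (intro mult_left_mono) auto
      finally show "B (n - m) \<le> W' n" .
    qed
    then have I_ge: "I \<ge> z" "I' \<ge> z"
      unfolding I_def I'_def z[of m, symmetric] by (auto intro!: integral_mono B_int' W_int W'_int)
    \<comment> \<open>The values of \<open>D\<close> are centred at the vector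
      \<open>a0 = D (y + u + q *\<^sub>R m)\<close>, common to both means. It cancels in their
      difference, and no bound depends on the size of \<open>D\<close>.\<close>
    define A where "A n = D (y + u + q *\<^sub>R n) - D (y + u + q *\<^sub>R m)" for n
    define A0 where "A0 n = D (y + q *\<^sub>R n) - D (y + u + q *\<^sub>R n)" for n
    have [measurable]: "A \<in> borel_measurable borel" "A0 \<in> borel_measurable borel"
      unfolding A_def A0_def by measurable
    have A_le: "norm (A n) \<le> K * norm (n - m)" for n
    proof -
      have "norm (A n) \<le> K * (\<bar>q\<bar> * norm (n - m))"
        unfolding A_def using D_diff[of "y + u + q *\<^sub>R n" "y + u + q *\<^sub>R m"]
        by (simp add: scaleR_diff_right[symmetric])
      also have "\<dots> \<le> K * norm (n - m)"
        using q K_nonneg by (intro mult_left_mono mult_left_le_one_le) auto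
      finally show ?thesis .
    qed
    have A0_le: "norm (A0 n) \<le> K * norm u" for n
      unfolding A0_def using D_diff[of "y + q *\<^sub>R n" "y + u + q *\<^sub>R n"] by simp
    have WA: "integrable lborel (\<lambda>n. W n *\<^sub>R A n)" "norm (\<integral>n. W n *\<^sub>R A n \<partial>lborel) \<le> (\<integral>n. K * E (n - m) \<partial>lborel)"
    proof (rule_tac [!] norm_integral_le)
      show "norm (W n *\<^sub>R A n) \<le> K * E (n - m)" for n
      proof -
        have "norm (W n *\<^sub>R A n) \<le> W n * (K * norm (n - m))"
          using W_pos(1)[of n] A_le[of n] by (simp add: mult_left_mono)
        also have "\<dots> = K * (norm (n - m) * W n)" by simp
        also have "\<dots> \<le> K * E (n - m)" using norm_le by (intro mult_left_mono W_E' K_nonneg) auto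
        finally show ?thesis .
      qed
      then show "norm (W n *\<^sub>R A n) \<le> K * E (n - m)" for n .
    qed (use E_int'[of m] in auto)
    have dWA: "integrable lborel (\<lambda>n. (W' n - W n) *\<^sub>R A n)"
      "norm (\<integral>n. (W' n - W n) *\<^sub>R A n \<partial>lborel) \<le> (\<integral>n. K * K * norm u * E (n - m) \<partial>lborel)"
    proof (rule_tac [!] norm_integral_le)
      show "norm ((W' n - W n) *\<^sub>R A n) \<le> K * K * norm u * E (n - m)" for n
      proof -
        have "norm ((W' n - W n) *\<^sub>R A n)
            \<le> (K * norm u * (norm (n - m) * exp (K * norm (n - m)) * W n)) * (K * norm (n - m))"
          unfolding norm_scaleR real_norm_def using K_nonneg W_pos(1)[of n]
          by (intro mult_mono diff A_le) auto
        also have "\<dots> = K * K * norm u * ((norm (n - m) * norm (n - m)) * exp (K * norm (n - m)) * W n)"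
          by (simp add: mult_ac)
        also have "\<dots> \<le> K * K * norm u * E (n - m)"
          using K_nonneg by (intro mult_left_mono W_E norm_sq_le) auto
        finally show ?thesis .
      qed
      then show "norm ((W' n - W n) *\<^sub>R A n) \<le> K * K * norm u * E (n - m)" for n .
    qed (use E_int'[of m] in auto)
    have WA0: "integrable lborel (\<lambda>n. W n *\<^sub>R A0 n)" "norm (\<integral>n. W n *\<^sub>R A0 n \<partial>lborel) \<le> (\<integral>n. K * norm u * W n \<partial>lborel)"
    proof (rule_tac [!] norm_integral_le)
      show "norm (W n *\<^sub>R A0 n) \<le> K * norm u * W n" for n
        using mult_left_mono[OF A0_le[of n], of "W n"] W_pos(1)[of n] by (simp add: mult.commute)
      then show "norm (W n *\<^sub>R A0 n) \<le> K * norm u * W n" for n .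
    qed (use W_int in auto)
    have dI: "\<bar>I' - I\<bar> \<le> K * norm u * S"
    proof -
      have "\<bar>I' - I\<bar> = norm (\<integral>n. W' n - W n \<partial>lborel)"
        unfolding I_def I'_def using W_int W'_int by simp
      also have "\<dots> \<le> (\<integral>n. K * norm u * E (n - m) \<partial>lborel)"
      proof (rule norm_integral_le)
        show "norm (W' n - W n) \<le> K * norm u * E (n - m)" for n
          unfolding real_norm_def using K_nonneg
          by (intro order_trans[OF diff] mult_left_mono W_E norm_le) auto
      qed (use E_int'[of m] in auto)
      finally show ?thesis using S[of m] by simp
    qed
    \<comment> \<open>The mean is invariant under a constant rescaling of its weight, so each weight
      may be normalised at \<open>m\<close>.\<close>
    have mean: "tilted_mean y' q = (1 / (\<integral>n. weight y' q n / c \<partial>lborel)) *\<^sub>R (\<integral>n. (weight y' q n / c) *\<^sub>R D (y' + q *\<^sub>R n) \<partial>lborel)"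
      if "c > 0" for y' c
    proof -
      have "(\<integral>n. (weight y' q n / c) *\<^sub>R D (y' + q *\<^sub>R n) \<partial>lborel)
          = (1 / c) *\<^sub>R (\<integral>n. weight y' q n *\<^sub>R D (y' + q *\<^sub>R n) \<partial>lborel)"
        by (subst integral_scaleR_right[symmetric]) simp
      then show ?thesis unfolding tilted_mean_def using that by simp
    qed
    have I_pos: "I > 0" "I' > 0" using I_ge z_pos by auto
    have W'A: "(\<integral>n. W' n *\<^sub>R A n \<partial>lborel) = (\<integral>n. (W' n - W n) *\<^sub>R A n \<partial>lborel) + (\<integral>n. W n *\<^sub>R A n \<partial>lborel)"
      and W'A_int: "integrable lborel (\<lambda>n. W' n *\<^sub>R A n)"
      using Bochner_Integration.integral_add[OF dWA(1) WA(1)] Bochner_Integration.integrable_add[OF dWA(1) WA(1)]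
      by (simp_all add: scaleR_diff_left)
    define a0 where "a0 = D (y + u + q *\<^sub>R m)"
    have "tilted_mean (y + u) q = (1 / I') *\<^sub>R (\<integral>n. W' n *\<^sub>R A n + W' n *\<^sub>R a0 \<partial>lborel)"
      unfolding mean[OF weight_pos[of "y + u" q m], of "y + u"] I'_def W'_def[symmetric]
      by (simp add: A_def a0_def scaleR_diff_right)
    also have "\<dots> = (1 / I') *\<^sub>R (\<integral>n. W' n *\<^sub>R A n \<partial>lborel) + a0"
      using W'A_int W'_int I_pos by (simp add: I'_def[symmetric] scaleR_add_right)
    finally have mean': "tilted_mean (y + u) q = (1 / I') *\<^sub>R (\<integral>n. W' n *\<^sub>R A n \<partial>lborel) + a0" .
    have "tilted_mean y q = (1 / I) *\<^sub>R (\<integral>n. W n *\<^sub>R A n + W n *\<^sub>R A0 n + W n *\<^sub>R a0 \<partial>lborel)"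
      unfolding mean[OF weight_pos[of y q m], of y] I_def W_def[symmetric]
      by (simp add: A_def A0_def a0_def scaleR_diff_right)
    also have "\<dots> = (1 / I) *\<^sub>R (\<integral>n. W n *\<^sub>R A n \<partial>lborel) + (1 / I) *\<^sub>R (\<integral>n. W n *\<^sub>R A0 n \<partial>lborel) + a0"
      using WA(1) WA0(1) W_int I_pos by (simp add: I_def[symmetric] scaleR_add_right)
    finally have eq: "tilted_mean (y + u) q - tilted_mean y q
        = (1 / I') *\<^sub>R (\<integral>n. (W' n - W n) *\<^sub>R A n \<partial>lborel)
          + ((1 / I' - 1 / I) *\<^sub>R (\<integral>n. W n *\<^sub>R A n \<partial>lborel) - (1 / I) *\<^sub>R (\<integral>n. W n *\<^sub>R A0 n \<partial>lborel))"
      unfolding mean' W'A by (simp add: scaleR_add_right scaleR_diff_left)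
    have "norm ((1 / I') *\<^sub>R (\<integral>n. (W' n - W n) *\<^sub>R A n \<partial>lborel)) \<le> (1 / z) * (K * K * norm u * S)"
      unfolding norm_scaleR using dWA(2) S[of m] I_ge z_pos K_nonneg S_nonneg
      by (intro mult_mono) (auto simp: frac_le)
    moreover have "norm ((1 / I' - 1 / I) *\<^sub>R (\<integral>n. W n *\<^sub>R A n \<partial>lborel)) \<le> (K * norm u * S / (z * z)) * (K * S)"
    proof -
      have "\<bar>1 / I' - 1 / I\<bar> = \<bar>I' - I\<bar> / (I' * I)"
        using I_pos by (simp add: diff_frac_eq abs_mult abs_minus_commute)
      also have "\<dots> \<le> K * norm u * S / (z * z)"
        using dI I_ge z_pos I_pos by (intro frac_le mult_mono) auto
      finally show ?thesis
        unfolding norm_scaleR real_norm_def using WA(2) S[of m] z_pos K_nonneg S_nonneg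
        by (intro mult_mono) auto
    qed
    moreover have "norm ((1 / I) *\<^sub>R (\<integral>n. W n *\<^sub>R A0 n \<partial>lborel)) \<le> K * norm u"
      using WA0(2) I_pos by (simp add: I_def[symmetric] divide_le_eq)
    ultimately have "norm (tilted_mean (y + u) q - tilted_mean y q)
        \<le> (1 / z) * (K * K * norm u * S) + ((K * norm u * S / (z * z)) * (K * S) + K * norm u)"
      unfolding eq by (intro norm_triangle_mono norm_triangle_le_diff) auto
    also have "\<dots> = C * norm u" unfolding C_def using z_pos by (simp add: field_simps)
    finally show ?thesis .
  qed
  then have "C-lipschitz_on UNIV (\<lambda>y. tilted_mean y q)" if "q \<in> {0..1}" for q
    using that by (intro lipschitz_on_UNIV_local C)
  then show ?thesis using C by blast
qed

text \<open>Dominated convergence along a sequence: \<open>g (y i)\<close> and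
  \<open>D (y i)\<close> stay bounded because they converge, so one Gaussian-type function dominates
  all the integrands. The point \<open>q = 0\<close> is included, which is needed at time 1.\<close>

lemma continuous_tilted_mean:
  "continuous_on (UNIV \<times> {0..1}) (\<lambda>(y, q). tilted_mean y q)"
proof (rule continuous_on_sequentiallyI)
  fix s :: "nat \<Rightarrow> 'a \<times> real" and a
  assume s_in: "\<forall>i. s i \<in> UNIV \<times> {0..1}" and a_in: "a \<in> UNIV \<times> {0..1}" and lim: "s \<longlonglongrightarrow> a"
  obtain y0 q0 where a: "a = (y0, q0)" by fastforce
  define y where "y i = fst (s i)" for i
  define q where "q i = snd (s i)" for i
  have q: "q i \<in> {0..1}" and q0: "q0 \<in> {0..1}" for i
    using s_in a_in by (auto simp: q_def a mem_Times_iff)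
  have y_lim: "y \<longlonglongrightarrow> y0" and q_lim: "q \<longlonglongrightarrow> q0"
    using tendsto_fst[OF lim] tendsto_snd[OF lim] by (simp_all add: y_def[abs_def] q_def[abs_def] a)
  have iso: "isCont g x" "isCont D x" for x
    using continuous_g[of UNIV] continuous_D[of UNIV] by (simp_all add: continuous_on_eq_continuous_at)
  have arg_lim: "(\<lambda>i. y i + q i *\<^sub>R n) \<longlonglongrightarrow> y0 + q0 *\<^sub>R n" for n
    by (intro tendsto_intros y_lim q_lim)
  have weight_lim: "(\<lambda>i. weight (y i) (q i) n) \<longlonglongrightarrow> weight y0 q0 n" for n
    unfolding weight_def by (intro tendsto_intros isCont_tendsto_compose[OF iso(1)] arg_lim)
  have D_lim: "(\<lambda>i. D (y i + q i *\<^sub>R n)) \<longlonglongrightarrow> D (y0 + q0 *\<^sub>R n)" for n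
    by (intro isCont_tendsto_compose[OF iso(2)] arg_lim)
  have "Bseq (\<lambda>i. g (y i))" "Bseq (\<lambda>i. D (y i))"
    using isCont_tendsto_compose[OF iso(1) y_lim] isCont_tendsto_compose[OF iso(2) y_lim]
    by (simp_all add: convergentI convergent_imp_Bseq)
  then obtain G A where G: "\<And>i. \<bar>g (y i)\<bar> \<le> G" and A: "\<And>i. norm (D (y i)) \<le> A"
    unfolding Bseq_def by (metis real_norm_def)
  have A0: "A \<ge> 0" using order_trans[OF norm_ge_zero A[of 0]] .
  define k where "k = (1 - \<mu>) / 2"
  have k: "k > 0" using constants by (simp add: k_def)
  \<comment> \<open>The 1 in the linear rate pays for the factor \<open>exp (norm n)\<close> with
    which \<open>norm_D_le\<close> bounds the growth of \<open>D\<close>.\<close>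
  define B where "B n = exp G * exp ((A + L + 1) * norm n - k * (norm n)\<^sup>2)" for n :: 'a
  have B_int: "integrable lborel B"
    unfolding B_def using k by (intro integrable_mult_right integrable_exp_linear_gaussian)
  have weight_B: "weight (y i) (q i) n * exp (norm n) \<le> B n" for i n
  proof -
    have "- g (y i) \<le> G" using G[of i] by linarith
    moreover have "(norm (D (y i)) + L) * norm n \<le> (A + L) * norm n"
      using A by (intro mult_right_mono) auto
    ultimately have "weight (y i) (q i) n \<le> exp G * exp ((A + L) * norm n - k * (norm n)\<^sup>2)"
      using weight_le[OF q, of "y i" i n] unfolding k_def exp_add[symmetric]
      by (smt (verit) exp_le_cancel_iff)
    from mult_right_mono[OF this, of "exp (norm n)"] show ?thesis
      unfolding B_def mult.assoc exp_add[symmetric] by (simp add: algebra_simps)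
  qed
  have weight_B': "weight (y i) (q i) n \<le> B n" for i n
  proof -
    have "weight (y i) (q i) n * 1 \<le> weight (y i) (q i) n * exp (norm n)"
      using weight_pos[of "y i" "q i" n] by (intro mult_left_mono) auto
    then show ?thesis using weight_B[of i n] by simp
  qed
  have mass_lim: "(\<lambda>i. \<integral>n. weight (y i) (q i) n \<partial>lborel) \<longlonglongrightarrow> (\<integral>n. weight y0 q0 n \<partial>lborel)"
    by (rule integral_dominated_convergence[OF _ _ B_int])
       (auto intro!: always_eventually weight_lim weight_B' simp: abs_of_pos[OF weight_pos])
  have "(\<lambda>i. \<integral>n. weight (y i) (q i) n *\<^sub>R D (y i + q i *\<^sub>R n) \<partial>lborel)
      \<longlonglongrightarrow> (\<integral>n. weight y0 q0 n *\<^sub>R D (y0 + q0 *\<^sub>R n) \<partial>lborel)"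
  proof (rule integral_dominated_convergence[OF _ _ integrable_mult_right[OF B_int, of "A + K"]])
    show "AE n in lborel. (\<lambda>i. weight (y i) (q i) n *\<^sub>R D (y i + q i *\<^sub>R n)) \<longlonglongrightarrow> weight y0 q0 n *\<^sub>R D (y0 + q0 *\<^sub>R n)"
      by (intro always_eventually allI tendsto_scaleR weight_lim D_lim)
    show "AE n in lborel. norm (weight (y i) (q i) n *\<^sub>R D (y i + q i *\<^sub>R n)) \<le> (A + K) * B n" for i
    proof (intro always_eventually allI)
      fix n
      have "norm (weight (y i) (q i) n *\<^sub>R D (y i + q i *\<^sub>R n))
          \<le> weight (y i) (q i) n * ((norm (D (y i)) + K) * exp (1 * norm n))"
        unfolding norm_scaleR abs_of_pos[OF weight_pos]
        using weight_pos[of "y i" "q i" n] by (intro mult_left_mono norm_D_le q) auto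
      also have "\<dots> \<le> weight (y i) (q i) n * ((A + K) * exp (1 * norm n))"
        using weight_pos[of "y i" "q i" n] A by (intro mult_left_mono mult_right_mono add_right_mono) auto
      also have "\<dots> = (A + K) * (weight (y i) (q i) n * exp (norm n))" by simp
      also have "\<dots> \<le> (A + K) * B n" using A0 K_nonneg by (intro mult_left_mono weight_B) auto
      finally show "norm (weight (y i) (q i) n *\<^sub>R D (y i + q i *\<^sub>R n)) \<le> (A + K) * B n" .
    qed
  qed measurable
  then have "(\<lambda>i. tilted_mean (y i) (q i)) \<longlonglongrightarrow> tilted_mean y0 q0"
    unfolding tilted_mean_def using mass_pos[OF q0, of y0] by (intro tendsto_intros mass_lim) auto
  then show "(\<lambda>i. case s i of (y, q) \<Rightarrow> tilted_mean y q) \<longlonglongrightarrow> (case a of (y, q) \<Rightarrow> tilted_mean y q)"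
    by (simp add: y_def q_def a case_prod_beta)
qed

end

section \<open>The velocity field as a tilted Gaussian mean\<close>

lemma gaussian_eq:
  assumes "\<sigma> > 0"
  shows "gaussian \<sigma> = density lborel (\<lambda>x :: real ^ 'n.
    ennreal ((1 / sqrt (2 * pi * \<sigma>\<^sup>2)) ^ CARD('n) * exp (- (norm x)\<^sup>2 / (2 * \<sigma>\<^sup>2))))"
proof -
  have "(\<Prod>i\<in>UNIV. normal_density 0 \<sigma> (x $ i))
      = (1 / sqrt (2 * pi * \<sigma>\<^sup>2)) ^ CARD('n) * exp (- (norm x)\<^sup>2 / (2 * \<sigma>\<^sup>2))" for x :: "real ^ 'n"
  proof -
    have "(norm x)\<^sup>2 = (\<Sum>i\<in>UNIV. (x $ i)\<^sup>2)"
      by (subst power2_norm_eq_inner) (simp add: inner_vec_def power2_eq_square)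
    then have "- (norm x)\<^sup>2 / (2 * \<sigma>\<^sup>2) = (\<Sum>i\<in>UNIV. - (x $ i)\<^sup>2 / (2 * \<sigma>\<^sup>2))"
      by (simp add: sum_negf sum_divide_distrib)
    then show ?thesis
      by (simp add: normal_density_def prod_dividef power_divide exp_sum)
  qed
  then show ?thesis by (simp add: gaussian_def)
qed

text \<open>For independent standard Gaussian vectors \<open>Z\<close>, \<open>Y\<close> and \<open>X = a Z + b Y\<close>, the conditional law
  of \<open>Y\<close> given \<open>X = x\<close> has mean \<open>regression a b * x\<close> and standard deviation \<open>residual a b\<close>.\<close>

definition regression :: "real \<Rightarrow> real \<Rightarrow> real" where
  "regression a b = b / (a\<^sup>2 + b\<^sup>2)"

definition residual :: "real \<Rightarrow> real \<Rightarrow> real" where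
  "residual a b = a / sqrt (a\<^sup>2 + b\<^sup>2)"

text \<open>If both parameters vanish, division by zero yields 0, which lies in the range as
  well.\<close>

lemma residual_range: "a \<ge> 0 \<Longrightarrow> residual a b \<in> {0..1}"
  using real_le_rsqrt[of a "a\<^sup>2 + b\<^sup>2"] divide_right_mono[of a "sqrt (a\<^sup>2 + b\<^sup>2)" "sqrt (a\<^sup>2 + b\<^sup>2)"]
  by (cases "sqrt (a\<^sup>2 + b\<^sup>2) = 0") (auto simp: residual_def)

text \<open>\<open>Y\<close> is the rescaled target. The joint law of \<open>Z\<close> and
  \<open>Y\<close> is then a standard Gaussian on the product space, tilted up to a constant by
  \<open>exp (- g y)\<close>.\<close>

locale gaussian_interpolation = tilt g D K L \<mu> + prob_space M
  for g :: "real ^ 'n \<Rightarrow> real" and D :: "real ^ 'n \<Rightarrow> real ^ 'n" and K L \<mu> :: real and M :: "'w measure" +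
  fixes Z Y :: "'w \<Rightarrow> real ^ 'n"
  assumes Z_meas [measurable]: "Z \<in> borel_measurable M" and Z_law: "distr M borel Z = gaussian 1"
    and Y_meas [measurable]: "Y \<in> borel_measurable M"
    and Y_law: "distr M borel Y = density lborel (\<lambda>y. ennreal (exp (- (norm y)\<^sup>2 / 2 - g y)))"
    and indep: "indep_var borel Z borel Y"
    and Y_integrable: "integrable M Y"
begin

lemma Z_integrable: "integrable M Z"
proof -
  have "integrable lborel (\<lambda>x :: real ^ 'n. ((1 / sqrt (2 * pi)) ^ CARD('n) * exp (- (norm x)\<^sup>2 / 2)) *\<^sub>R x)"
  proof (rule norm_integral_le)
    show "integrable lborel (\<lambda>x :: real ^ 'n. (1 / sqrt (2 * pi)) ^ CARD('n) * exp (1 * norm x - 1 / 2 * (norm x)\<^sup>2))"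
      by (intro integrable_mult_right integrable_exp_linear_gaussian) simp
    fix x :: "real ^ 'n"
    have "exp (- (norm x)\<^sup>2 / 2) * norm x \<le> exp (- (norm x)\<^sup>2 / 2) * exp (norm x)"
      using le_exp by (intro mult_left_mono) auto
    then have "exp (- (norm x)\<^sup>2 / 2) * norm x \<le> exp (1 * norm x - 1 / 2 * (norm x)\<^sup>2)"
      by (simp add: exp_add[symmetric] algebra_simps)
    then have "(1 / sqrt (2 * pi)) ^ CARD('n) * (exp (- (norm x)\<^sup>2 / 2) * norm x)
        \<le> (1 / sqrt (2 * pi)) ^ CARD('n) * exp (1 * norm x - 1 / 2 * (norm x)\<^sup>2)"
      by (intro mult_left_mono) auto
    then show "norm (((1 / sqrt (2 * pi)) ^ CARD('n) * exp (- (norm x)\<^sup>2 / 2)) *\<^sub>R x)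
        \<le> (1 / sqrt (2 * pi)) ^ CARD('n) * exp (1 * norm x - 1 / 2 * (norm x)\<^sup>2)"
      by (simp add: abs_mult mult.assoc)
  qed measurable
  then have "integrable (distr M borel Z) (\<lambda>x. x)"
    unfolding Z_law gaussian_eq[OF zero_less_one] by (subst integrable_density) auto
  from integrable_distr[OF Z_meas this] show ?thesis .
qed

text \<open>With \<open>r\<^sup>2 = a\<^sup>2 + b\<^sup>2\<close>, the vector \<open>N\<close>
  equals \<open>(a Y - b Z) / r\<close>, so \<open>X / r\<close> and \<open>N\<close> arise from
  \<open>Z\<close> and \<open>Y\<close> by a rotation. The Gaussian exponent keeps its form, and the
  two new variables are coupled only through \<open>g\<close>.\<close>

lemma joint_law:
  fixes a b :: real
  assumes a: "a > 0"
  defines "p \<equiv> regression a b" and "q \<equiv> residual a b"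
  defines "X \<equiv> \<lambda>\<omega>. a *\<^sub>R Z \<omega> + b *\<^sub>R Y \<omega>"
  defines "N \<equiv> \<lambda>\<omega>. (1 / q) *\<^sub>R (Y \<omega> - p *\<^sub>R X \<omega>)"
  shows "\<exists>C>0. distr M (borel \<Otimes>\<^sub>M borel) (\<lambda>\<omega>. (X \<omega>, N \<omega>))
    = density (lborel \<Otimes>\<^sub>M lborel)
        (\<lambda>w. ennreal (C * exp (- (norm (fst w))\<^sup>2 / (2 * (a\<^sup>2 + b\<^sup>2))) * weight (p *\<^sub>R fst w) q (snd w)))"
proof -
  define c where "c = a\<^sup>2 + b\<^sup>2"
  have c: "c > 0" using a by (simp add: c_def sum_power2_gt_zero_iff)
  have q: "q > 0" and cq: "c * q\<^sup>2 = a\<^sup>2" and cp: "c * p = b"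
    using a c by (simp_all add: q_def p_def residual_def regression_def c_def[symmetric] power_divide)
  define G where "G = (1 / sqrt (2 * pi)) ^ CARD('n)"
  have G: "G > 0" by (simp add: G_def)
  define u where "u z = ennreal (G * exp (- (norm z)\<^sup>2 / 2))" for z :: "real ^ 'n"
  define e where "e y = ennreal (exp (- (norm y)\<^sup>2 / 2 - g y))" for y
  have [measurable]: "u \<in> borel_measurable borel" "e \<in> borel_measurable borel"
    unfolding u_def e_def by measurable
  \<comment> \<open>The Jacobians of the two substitutions, \<open>z\<close> to \<open>x\<close> and
    \<open>y\<close> to \<open>n\<close>, and one Gaussian normalising constant; the density of
    \<open>Y\<close> carries its own constant inside \<open>g\<close>.\<close>
  define C where "C = (1 / a) ^ CARD('n) * q ^ CARD('n) * G"
  have C: "C > 0" using a q G by (simp add: C_def)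
  define \<kappa> where "\<kappa> w = ennreal (C * exp (- (norm (fst w))\<^sup>2 / (2 * c)) * weight (p *\<^sub>R fst w) q (snd w))"
    for w :: "(real ^ 'n) \<times> (real ^ 'n)"
  have weight_meas: "(\<lambda>w. weight (p *\<^sub>R fst w) q (snd w)) \<in> borel_measurable (borel \<Otimes>\<^sub>M borel)"
    unfolding weight_def by measurable
  then have [measurable]: "\<kappa> \<in> borel_measurable (borel \<Otimes>\<^sub>M borel)"
    unfolding \<kappa>_def by measurable
  \<comment> \<open>Completing the square. The first argument is \<open>(x - b y) / a\<close>, that
    is \<open>z\<close> expressed by \<open>x\<close> and \<open>y\<close>, with
    \<open>y = p x + q n\<close>.\<close>
  have kernel: "u ((1 / a) *\<^sub>R x - (b / a) *\<^sub>R (p *\<^sub>R x + q *\<^sub>R n)) * e (p *\<^sub>R x + q *\<^sub>R n)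
      = ennreal (G * exp (- (norm x)\<^sup>2 / (2 * c)) * weight (p *\<^sub>R x) q n)" for x n
  proof -
    define y where "y = p *\<^sub>R x + q *\<^sub>R n"
    have "(1 / a) *\<^sub>R x - (b / a) *\<^sub>R y = (1 / a) *\<^sub>R (x - b *\<^sub>R y)" by (simp add: scaleR_diff_right)
    then have 1: "(norm ((1 / a) *\<^sub>R x - (b / a) *\<^sub>R y))\<^sup>2 = (norm (x - b *\<^sub>R y))\<^sup>2 / a\<^sup>2"
      by (simp add: power_divide)
    have "(norm (x - b *\<^sub>R y))\<^sup>2 + a\<^sup>2 * (norm y)\<^sup>2 = (norm x)\<^sup>2 - 2 * b * (x \<bullet> y) + c * (norm y)\<^sup>2"
      unfolding power2_norm_eq_inner c_def by (simp add: inner_diff_left inner_diff_right inner_commute algebra_simps power2_eq_square)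
    also have "c * (norm y)\<^sup>2 = (c * p) * p * (norm x)\<^sup>2 + 2 * (c * p) * q * (x \<bullet> n) + (c * q\<^sup>2) * (norm n)\<^sup>2"
      unfolding power2_norm_eq_inner y_def
      by (simp add: inner_add_left inner_add_right inner_commute algebra_simps power2_eq_square)
    also have "x \<bullet> y = p * (norm x)\<^sup>2 + q * (x \<bullet> n)"
      unfolding power2_norm_eq_inner y_def by (simp add: inner_add_right)
    finally have "(norm (x - b *\<^sub>R y))\<^sup>2 + a\<^sup>2 * (norm y)\<^sup>2 = (1 - b * p) * (norm x)\<^sup>2 + a\<^sup>2 * (norm n)\<^sup>2"
      unfolding cp cq by (simp add: algebra_simps)
    also have "1 - b * p = a\<^sup>2 / c"
      using c by (simp add: p_def regression_def c_def[symmetric] field_simps) (simp add: c_def power2_eq_square)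
    finally have "(norm (x - b *\<^sub>R y))\<^sup>2 / a\<^sup>2 + (norm y)\<^sup>2 = (norm x)\<^sup>2 / c + (norm n)\<^sup>2"
      using a c by (simp add: field_simps)
    then have "- ((norm (x - b *\<^sub>R y))\<^sup>2 / a\<^sup>2) / 2 + (- (norm y)\<^sup>2 / 2 - g y)
        = - (norm x)\<^sup>2 / (2 * c) + (- (norm n)\<^sup>2 / 2 - g y)"
      by (simp add: field_simps)
    then show ?thesis
      unfolding u_def e_def y_def[symmetric] 1 weight_def
      using G by (simp add: ennreal_mult[symmetric] exp_add[symmetric] mult.assoc)
  qed
  have ZY: "distr M (borel \<Otimes>\<^sub>M borel) (\<lambda>\<omega>. (Z \<omega>, Y \<omega>)) = density (lborel \<Otimes>\<^sub>M lborel) (\<lambda>(z, y). u z * e y)"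
  proof -
    have "prob_space (density lborel e)"
      unfolding e_def Y_law[symmetric] by (rule prob_space_distr) simp
    then have "sigma_finite_measure (density lborel e)"
      by (intro finite_measure.axioms prob_space.finite_measure prob_space_imp_sigma_finite)
    then show ?thesis
      using indep unfolding indep_var_distribution_eq Z_law Y_law gaussian_eq[OF zero_less_one]
      by (subst (asm) pair_measure_density) (auto simp: sigma_finite_lborel u_def[abs_def] e_def[abs_def] G_def)
  qed
  \<comment> \<open>The rotation is factored into two scalar affine substitutions: first
    \<open>z\<close> is replaced by \<open>x\<close> at fixed \<open>y\<close>, then, after
    exchanging the integrals, \<open>y\<close> by \<open>n\<close> at fixed
    \<open>x\<close>.\<close>
  have nn: "(\<integral>\<^sup>+\<omega>. h (X \<omega>, N \<omega>) \<partial>M) = (\<integral>\<^sup>+w. \<kappa> w * h w \<partial>(lborel \<Otimes>\<^sub>M lborel))"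
    if [measurable]: "h \<in> borel_measurable (borel \<Otimes>\<^sub>M borel)" for h
  proof -
    define H where "H z y = h (a *\<^sub>R z + b *\<^sub>R y, (1 / q) *\<^sub>R (y - p *\<^sub>R (a *\<^sub>R z + b *\<^sub>R y)))" for z y
    have [measurable]: "case_prod H \<in> borel_measurable (borel \<Otimes>\<^sub>M borel)"
      unfolding H_def by measurable
    have "(\<integral>\<^sup>+\<omega>. h (X \<omega>, N \<omega>) \<partial>M) = (\<integral>\<^sup>+w. case_prod H w \<partial>distr M (borel \<Otimes>\<^sub>M borel) (\<lambda>\<omega>. (Z \<omega>, Y \<omega>)))"
      by (subst nn_integral_distr) (auto simp: H_def X_def N_def)
    also have "\<dots> = (\<integral>\<^sup>+w. u (fst w) * e (snd w) * H (fst w) (snd w) \<partial>(lborel \<Otimes>\<^sub>M lborel))"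
      unfolding ZY by (subst nn_integral_density) (auto simp: case_prod_beta)
    also have "\<dots> = (\<integral>\<^sup>+y. (\<integral>\<^sup>+z. u z * e y * H z y \<partial>lborel) \<partial>lborel)"
      by (subst lborel_pair.nn_integral_snd[symmetric]) auto
    also have "\<dots> = (\<integral>\<^sup>+y. (\<integral>\<^sup>+x. ennreal ((1 / a) ^ CARD('n)) *
        (u ((1 / a) *\<^sub>R x - (b / a) *\<^sub>R y) * e y * h (x, (1 / q) *\<^sub>R (y - p *\<^sub>R x))) \<partial>lborel) \<partial>lborel)"
    proof (rule nn_integral_cong)
      fix y :: "real ^ 'n"
      have arg1: "- (b / a) *\<^sub>R y + (1 / a) *\<^sub>R x = (1 / a) *\<^sub>R x - (b / a) *\<^sub>R y" for x
        by simp
      have arg2: "a *\<^sub>R ((1 / a) *\<^sub>R x - (b / a) *\<^sub>R y) + b *\<^sub>R y = x" for x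
        using a by (simp add: scaleR_diff_right)
      have "(\<integral>\<^sup>+z. u z * e y * H z y \<partial>lborel)
          = ennreal ((1 / a) ^ DIM(real ^ 'n)) * (\<integral>\<^sup>+x. u (- (b / a) *\<^sub>R y + (1 / a) *\<^sub>R x) * e y
              * H (- (b / a) *\<^sub>R y + (1 / a) *\<^sub>R x) y \<partial>lborel)"
        using a by (intro nn_integral_lborel_affine) auto
      also have "\<dots> = (\<integral>\<^sup>+x. ennreal ((1 / a) ^ CARD('n)) *
          (u ((1 / a) *\<^sub>R x - (b / a) *\<^sub>R y) * e y * h (x, (1 / q) *\<^sub>R (y - p *\<^sub>R x))) \<partial>lborel)"
        unfolding H_def using a by (subst nn_integral_cmult) (simp_all only: arg1 arg2, measurable)
      finally show "(\<integral>\<^sup>+z. u z * e y * H z y \<partial>lborel) = \<dots>" .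
    qed
    also have "\<dots> = (\<integral>\<^sup>+x. (\<integral>\<^sup>+y. ennreal ((1 / a) ^ CARD('n)) *
        (u ((1 / a) *\<^sub>R x - (b / a) *\<^sub>R y) * e y * h (x, (1 / q) *\<^sub>R (y - p *\<^sub>R x))) \<partial>lborel) \<partial>lborel)"
      by (rule lborel_pair.Fubini') measurable
    also have "\<dots> = (\<integral>\<^sup>+x. (\<integral>\<^sup>+n. \<kappa> (x, n) * h (x, n) \<partial>lborel) \<partial>lborel)"
    proof (rule nn_integral_cong)
      fix x
      have "(\<integral>\<^sup>+y. ennreal ((1 / a) ^ CARD('n)) *
          (u ((1 / a) *\<^sub>R x - (b / a) *\<^sub>R y) * e y * h (x, (1 / q) *\<^sub>R (y - p *\<^sub>R x))) \<partial>lborel)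
        = ennreal (q ^ DIM(real ^ 'n)) * (\<integral>\<^sup>+n. ennreal ((1 / a) ^ CARD('n)) *
          (u ((1 / a) *\<^sub>R x - (b / a) *\<^sub>R (p *\<^sub>R x + q *\<^sub>R n)) * e (p *\<^sub>R x + q *\<^sub>R n)
            * h (x, (1 / q) *\<^sub>R ((p *\<^sub>R x + q *\<^sub>R n) - p *\<^sub>R x))) \<partial>lborel)"
        by (rule nn_integral_lborel_affine) (use q in measurable)
      also have "\<dots> = (\<integral>\<^sup>+n. ennreal (q ^ CARD('n)) * (ennreal ((1 / a) ^ CARD('n)) *
          (ennreal (G * exp (- (norm x)\<^sup>2 / (2 * c)) * weight (p *\<^sub>R x) q n) * h (x, n))) \<partial>lborel)"
        unfolding kernel using q by (subst nn_integral_cmult) auto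
      also have "\<dots> = (\<integral>\<^sup>+n. \<kappa> (x, n) * h (x, n) \<partial>lborel)"
        unfolding \<kappa>_def C_def using a q G weight_pos[of "p *\<^sub>R x" q, THEN less_imp_le]
        by (intro nn_integral_cong) (simp add: ennreal_mult' mult_ac)
      finally show "(\<integral>\<^sup>+y. ennreal ((1 / a) ^ CARD('n)) *
          (u ((1 / a) *\<^sub>R x - (b / a) *\<^sub>R y) * e y * h (x, (1 / q) *\<^sub>R (y - p *\<^sub>R x))) \<partial>lborel) = \<dots>" .
    qed
    also have "\<dots> = (\<integral>\<^sup>+w. \<kappa> w * h w \<partial>(lborel \<Otimes>\<^sub>M lborel))"
      by (subst lborel.nn_integral_fst) auto
    finally show ?thesis .
  qed
  have [measurable]: "X \<in> borel_measurable M" "N \<in> borel_measurable M"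
    unfolding X_def N_def by measurable
  have "distr M (borel \<Otimes>\<^sub>M borel) (\<lambda>\<omega>. (X \<omega>, N \<omega>)) = density (lborel \<Otimes>\<^sub>M lborel) \<kappa>"
  proof (rule measure_eqI)
    fix A assume "A \<in> sets (distr M (borel \<Otimes>\<^sub>M borel) (\<lambda>\<omega>. (X \<omega>, N \<omega>)))"
    then have A [measurable]: "A \<in> sets (borel \<Otimes>\<^sub>M borel)" by simp
    have "emeasure (distr M (borel \<Otimes>\<^sub>M borel) (\<lambda>\<omega>. (X \<omega>, N \<omega>))) A
        = (\<integral>\<^sup>+w. indicator A w \<partial>distr M (borel \<Otimes>\<^sub>M borel) (\<lambda>\<omega>. (X \<omega>, N \<omega>)))"
      by (subst nn_integral_indicator) auto
    also have "\<dots> = (\<integral>\<^sup>+\<omega>. indicator A (X \<omega>, N \<omega>) \<partial>M)"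
      by (subst nn_integral_distr) auto
    also have "\<dots> = emeasure (density (lborel \<Otimes>\<^sub>M lborel) \<kappa>) A"
      using A by (subst nn) (auto simp: emeasure_density)
    finally show "emeasure (distr M (borel \<Otimes>\<^sub>M borel) (\<lambda>\<omega>. (X \<omega>, N \<omega>))) A = emeasure (density (lborel \<Otimes>\<^sub>M lborel) \<kappa>) A" .
  qed simp
  then show ?thesis using C unfolding \<kappa>_def c_def by blast
qed

text \<open>In the rotated coordinates the velocity variable is
  \<open>\<alpha> X + \<delta> N\<close>, so only \<open>N\<close> has to be averaged. Its mean
  given \<open>X = x\<close> is \<open>- q\<close> times a tilted mean, and in
  \<open>\<delta> * q\<close> the number \<open>a'\<close> occurs only multiplied by
  \<open>a\<close>.\<close>

lemma cond_mean_eq: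
  fixes a b a' b' :: real
  assumes a: "a > 0"
  shows "cond_mean M (\<lambda>\<omega>. a' *\<^sub>R Z \<omega> + b' *\<^sub>R Y \<omega>) (\<lambda>\<omega>. a *\<^sub>R Z \<omega> + b *\<^sub>R Y \<omega>)
    = (\<lambda>x. ((a * a' + b * b') / (a\<^sup>2 + b\<^sup>2)) *\<^sub>R x
        - ((a\<^sup>2 * b' - a * a' * b) / (a\<^sup>2 + b\<^sup>2)) *\<^sub>R tilted_mean (regression a b *\<^sub>R x) (residual a b))"
    (is "cond_mean M ?V ?X = ?f")
proof -
  define p where "p = regression a b"
  define q where "q = residual a b"
  define c where "c = sqrt (a\<^sup>2 + b\<^sup>2)"
  have c: "c > 0" and c2: "c\<^sup>2 = a\<^sup>2 + b\<^sup>2" using a by (simp_all add: c_def sum_power2_gt_zero_iff)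
  have q: "q \<in> {0..1}" and q0: "q > 0" and qc: "q = a / c" and pc: "p = b / c\<^sup>2"
    using residual_range[of a b] a c unfolding q_def p_def regression_def c2 by (auto simp: residual_def c_def)
  define X where "X \<omega> = a *\<^sub>R Z \<omega> + b *\<^sub>R Y \<omega>" for \<omega>
  define N where "N \<omega> = (1 / q) *\<^sub>R (Y \<omega> - p *\<^sub>R X \<omega>)" for \<omega>
  define \<phi> where "\<phi> x = - q *\<^sub>R tilted_mean (p *\<^sub>R x) q" for x
  define \<alpha> where "\<alpha> = (a * a' + b * b') / c\<^sup>2"
  define \<delta> where "\<delta> = (a * b' - a' * b) / c"
  have [measurable]: "X \<in> borel_measurable M" "N \<in> borel_measurable M"
    unfolding X_def[abs_def] N_def[abs_def] by measurable
  have f: "?f x = \<alpha> *\<^sub>R x + \<delta> *\<^sub>R \<phi> x" for x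
  proof -
    have "(a\<^sup>2 * b' - a * a' * b) / c\<^sup>2 = \<delta> * q"
      unfolding \<delta>_def qc using c by (simp add: field_simps power2_eq_square)
    then show ?thesis
      unfolding \<phi>_def \<alpha>_def c2[symmetric] p_def[symmetric] q_def[symmetric] by simp
  qed
  have V: "?V \<omega> = \<alpha> *\<^sub>R X \<omega> + \<delta> *\<^sub>R N \<omega>" for \<omega>
  proof -
    have "\<delta> / q = (a * b' - a' * b) / a" using c a unfolding \<delta>_def qc by simp
    then have 1: "\<delta> *\<^sub>R N \<omega> = ((a * b' - a' * b) / a) *\<^sub>R (Y \<omega> - p *\<^sub>R X \<omega>)"
      unfolding N_def by simp
    have 2: "\<alpha> - (a * b' - a' * b) / a * p = a' / a"
    proof -
      have "(a * a' + b * b') / s - (a * b' - a' * b) / a * (b / s) = a' * (a\<^sup>2 + b\<^sup>2) / (a * s)" if "s > 0" for s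
        using a that by (simp add: field_simps power2_eq_square)
      from this[of "c\<^sup>2"] show ?thesis
        unfolding \<alpha>_def pc using c by (simp add: c2[symmetric])
    qed
    have "\<alpha> *\<^sub>R X \<omega> + \<delta> *\<^sub>R N \<omega> = (\<alpha> - (a * b' - a' * b) / a * p) *\<^sub>R X \<omega> + ((a * b' - a' * b) / a) *\<^sub>R Y \<omega>"
      unfolding 1 by (simp add: algebra_simps)
    also have "\<dots> = a' *\<^sub>R Z \<omega> + ((a' * b) / a + (a * b' - a' * b) / a) *\<^sub>R Y \<omega>"
      unfolding 2 X_def using a by (simp add: algebra_simps)
    also have "(a' * b) / a + (a * b' - a' * b) / a = b'" using a by (simp add: field_simps)
    finally show ?thesis by simp
  qed
  obtain C where C: "C > 0" and law: "distr M (borel \<Otimes>\<^sub>M borel) (\<lambda>\<omega>. (X \<omega>, N \<omega>))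
    = density (lborel \<Otimes>\<^sub>M lborel)
        (\<lambda>w. ennreal (C * exp (- (norm (fst w))\<^sup>2 / (2 * (a\<^sup>2 + b\<^sup>2))) * weight (p *\<^sub>R fst w) q (snd w)))"
    using joint_law[OF a, of b] unfolding p_def[symmetric] q_def[symmetric] X_def[symmetric] N_def[symmetric] by blast
  define r where "r x = C * exp (- (norm x)\<^sup>2 / (2 * (a\<^sup>2 + b\<^sup>2)))" for x :: "real ^ 'n"
  have r: "r x > 0" for x using C by (simp add: r_def)
  define \<kappa> where "\<kappa> w = r (fst w) * weight (p *\<^sub>R fst w) q (snd w)" for w
  have \<kappa>_meas [measurable]: "\<kappa> \<in> borel_measurable (borel \<Otimes>\<^sub>M borel)"
    unfolding \<kappa>_def r_def weight_def by measurable
  have \<kappa>_pos: "\<kappa> w > 0" for w unfolding \<kappa>_def using r weight_pos by simp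
  have law: "distr M (borel \<Otimes>\<^sub>M borel) (\<lambda>\<omega>. (X \<omega>, N \<omega>)) = density (lborel \<Otimes>\<^sub>M lborel) (\<lambda>w. ennreal (\<kappa> w))"
    unfolding law \<kappa>_def r_def ..
  have expect: "(\<integral>\<omega>. h (X \<omega>, N \<omega>) \<partial>M) = (\<integral>x. (\<integral>n. \<kappa> (x, n) * h (x, n) \<partial>lborel) \<partial>lborel)"
    if [measurable]: "h \<in> borel_measurable (borel \<Otimes>\<^sub>M borel)" and int: "integrable M (\<lambda>\<omega>. h (X \<omega>, N \<omega>))"
    for h :: "_ \<Rightarrow> real"
  proof -
    have "integrable (distr M (borel \<Otimes>\<^sub>M borel) (\<lambda>\<omega>. (X \<omega>, N \<omega>))) h"
      using int by (subst integrable_distr_eq) auto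
    then have int': "integrable (lborel \<Otimes>\<^sub>M lborel) (\<lambda>w. \<kappa> w * h w)"
      unfolding law using \<kappa>_pos by (subst (asm) integrable_density) (auto simp: less_imp_le)
    have "(\<integral>\<omega>. h (X \<omega>, N \<omega>) \<partial>M) = integral\<^sup>L (distr M (borel \<Otimes>\<^sub>M borel) (\<lambda>\<omega>. (X \<omega>, N \<omega>))) h"
      by (subst integral_distr) auto
    also have "\<dots> = integral\<^sup>L (lborel \<Otimes>\<^sub>M lborel) (\<lambda>w. \<kappa> w * h w)"
      unfolding law using \<kappa>_pos by (subst integral_density) (auto simp: less_imp_le)
    also have "\<dots> = (\<integral>x. (\<integral>n. \<kappa> (x, n) * h (x, n) \<partial>lborel) \<partial>lborel)"
      by (rule lborel_pair.integral_fst'[OF int', symmetric])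
    finally show ?thesis .
  qed
  have X_int: "integrable M X" and N_int: "integrable M N"
    unfolding X_def[abs_def] N_def[abs_def] using Z_integrable Y_integrable by simp_all
  obtain B where B: "B-lipschitz_on UNIV (\<lambda>y. tilted_mean y q)" "B \<ge> 0"
    using tilted_mean_lipschitz q by blast
  have \<phi>_lip: "norm (\<phi> x - \<phi> y) \<le> (B * \<bar>p\<bar>) * norm (x - y)" for x y
  proof -
    have "norm (\<phi> x - \<phi> y) = q * dist (tilted_mean (p *\<^sub>R x) q) (tilted_mean (p *\<^sub>R y) q)"
      using q unfolding \<phi>_def by (simp add: dist_norm norm_minus_commute flip: scaleR_diff_right)
    also have "\<dots> \<le> 1 * (B * dist (p *\<^sub>R x) (p *\<^sub>R y))"
      using q B by (intro mult_mono lipschitz_onD[OF B(1)]) auto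
    also have "\<dots> = (B * \<bar>p\<bar>) * norm (x - y)"
      by (simp add: dist_norm flip: scaleR_diff_right)
    finally show ?thesis .
  qed
  have \<phi>_cont: "continuous_on UNIV \<phi>"
    using B \<phi>_lip by (intro lipschitz_on_continuous_on[of "B * \<bar>p\<bar>"] lipschitz_onI) (auto simp: dist_norm)
  then have [measurable]: "\<phi> \<in> borel_measurable borel" by (rule borel_measurable_continuous_onI)
  have \<phi>X_int: "integrable M (\<lambda>\<omega>. \<phi> (X \<omega>))"
  proof (rule norm_integral_le(1))
    show "integrable M (\<lambda>\<omega>. norm (\<phi> 0) + (B * \<bar>p\<bar>) * norm (X \<omega>))"
      using X_int by simp
    show "norm (\<phi> (X \<omega>)) \<le> norm (\<phi> 0) + (B * \<bar>p\<bar>) * norm (X \<omega>)" for \<omega>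
      using \<phi>_lip[of "X \<omega>" 0] norm_triangle_sub[of "\<phi> (X \<omega>)" "\<phi> 0"] by simp
  qed measurable
  have [measurable]: "(\<lambda>x :: real ^ 'n. x $ i) \<in> borel_measurable borel" for i
    by (intro borel_measurable_continuous_onI continuous_intros)
  note component = integrable_bounded_linear[OF bounded_linear_vec_nth]
  \<comment> \<open>Both expectations are integrals over \<open>x\<close> of fibre integrals in
    \<open>n\<close>. On each fibre the factors depending on \<open>x\<close> are constants, and
    Gaussian integration by parts identifies the two.\<close>
  have tower: "(\<integral>\<omega>. indicator A (X \<omega>) * N \<omega> $ i \<partial>M) = (\<integral>\<omega>. indicator A (X \<omega>) * \<phi> (X \<omega>) $ i \<partial>M)"
    if [measurable]: "A \<in> sets borel" for A :: "(real ^ 'n) set" and i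
  proof -
    have "integrable M (\<lambda>\<omega>. indicator A (X \<omega>) * N \<omega> $ i)" "integrable M (\<lambda>\<omega>. indicator A (X \<omega>) * \<phi> (X \<omega>) $ i)"
      using integrable_mult_indicator[of "X -` A \<inter> space M" M "\<lambda>\<omega>. N \<omega> $ i"] component[OF N_int]
        integrable_mult_indicator[of "X -` A \<inter> space M" M "\<lambda>\<omega>. \<phi> (X \<omega>) $ i"] component[OF \<phi>X_int]
      by (auto simp: indicator_def cong: Bochner_Integration.integrable_cong)
    then have "(\<integral>\<omega>. indicator A (X \<omega>) * N \<omega> $ i \<partial>M)
          = (\<integral>x. (\<integral>n. \<kappa> (x, n) * (indicator A x * n $ i) \<partial>lborel) \<partial>lborel)"
      and "(\<integral>\<omega>. indicator A (X \<omega>) * \<phi> (X \<omega>) $ i \<partial>M)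
          = (\<integral>x. (\<integral>n. \<kappa> (x, n) * (indicator A x * \<phi> x $ i) \<partial>lborel) \<partial>lborel)"
      using expect[of "\<lambda>w. indicator A (fst w) * snd w $ i"] expect[of "\<lambda>w. indicator A (fst w) * \<phi> (fst w) $ i"]
      by simp_all
    moreover have "(\<integral>n. \<kappa> (x, n) * (indicator A x * n $ i) \<partial>lborel) = (\<integral>n. \<kappa> (x, n) * (indicator A x * \<phi> x $ i) \<partial>lborel)" for x
    proof -
      let ?w = "weight (p *\<^sub>R x) q"
      have "(\<integral>n. ?w n * n $ i \<partial>lborel) = (\<integral>n. ?w n *\<^sub>R n \<partial>lborel) $ i"
        using integral_bounded_linear[OF bounded_linear_vec_nth[of i] integrable_weight_simps(3)[OF q], of "p *\<^sub>R x"] by simp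
      also have "\<dots> = (\<integral>n. ?w n \<partial>lborel) * \<phi> x $ i"
        unfolding gaussian_integration_by_parts[OF q] \<phi>_def tilted_mean_def using mass_pos[OF q, of "p *\<^sub>R x"] by simp
      also have "\<dots> = (\<integral>n. ?w n * \<phi> x $ i \<partial>lborel)" by simp
      finally have "r x * indicator A x * (\<integral>n. ?w n * n $ i \<partial>lborel) = r x * indicator A x * (\<integral>n. ?w n * \<phi> x $ i \<partial>lborel)"
        by simp
      moreover have "(\<integral>n. \<kappa> (x, n) * (indicator A x * n $ i) \<partial>lborel) = (\<integral>n. (r x * indicator A x) * (?w n * n $ i) \<partial>lborel)"
        unfolding \<kappa>_def by (simp add: mult_ac)
      moreover have "(\<integral>n. \<kappa> (x, n) * (indicator A x * \<phi> x $ i) \<partial>lborel) = (\<integral>n. (r x * indicator A x) * (?w n * \<phi> x $ i) \<partial>lborel)"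
        unfolding \<kappa>_def by (simp add: mult_ac)
      ultimately show ?thesis by (simp only: integral_mult_right_zero)
    qed
    ultimately show ?thesis by simp
  qed
  define F where "F = vimage_algebra (space M) X borel"
  have X_F: "X \<in> measurable F borel" unfolding F_def by (rule measurable_vimage_algebra1) simp
  have "subalgebra M F"
    unfolding subalgebra_def F_def by (auto simp: sets_vimage_algebra2)
  then interpret sigma_finite_subalgebra M F
    using finite_measure_axioms
    by (intro finite_measure_subalgebra_is_sigma_finite) (simp add: finite_measure_subalgebra_def finite_measure_subalgebra_axioms_def)
  have f_cond: "AE \<omega> in M. real_cond_exp M F (\<lambda>\<omega>. ?V \<omega> $ i) \<omega> = ?f (X \<omega>) $ i" for i
  proof (rule real_cond_exp_charact)
    show V_int: "integrable M (\<lambda>\<omega>. ?V \<omega> $ i)"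
      unfolding V by (intro component) (simp add: X_int N_int)
    show f_int: "integrable M (\<lambda>\<omega>. ?f (X \<omega>) $ i)"
      unfolding f by (intro component) (simp add: X_int \<phi>X_int)
    show "(\<lambda>\<omega>. ?f (X \<omega>) $ i) \<in> borel_measurable F"
      unfolding f by (rule measurable_compose[OF X_F]) measurable
    fix S assume "S \<in> sets F"
    then obtain A where S: "S = X -` A \<inter> space M" and A [measurable]: "A \<in> sets borel"
      unfolding F_def by (auto simp: sets_vimage_algebra2)
    have set: "(\<integral>\<omega>\<in>S. h \<omega> \<partial>M) = (\<integral>\<omega>. indicator A (X \<omega>) * h \<omega> \<partial>M)" for h :: "'w \<Rightarrow> real"
      unfolding set_lebesgue_integral_def S by (intro Bochner_Integration.integral_cong) (auto simp: indicator_def)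
    have ind_int: "integrable M (\<lambda>\<omega>. indicator A (X \<omega>) * h \<omega>)" if "integrable M h" for h :: "'w \<Rightarrow> real"
      using integrable_mult_indicator[of "X -` A \<inter> space M" M h] that
      by (auto simp: indicator_def cong: Bochner_Integration.integrable_cong)
    have split: "(\<integral>\<omega>. indicator A (X \<omega>) * (\<alpha> * X \<omega> $ i + \<delta> * h \<omega> $ i) \<partial>M)
        = \<alpha> * (\<integral>\<omega>. indicator A (X \<omega>) * X \<omega> $ i \<partial>M) + \<delta> * (\<integral>\<omega>. indicator A (X \<omega>) * h \<omega> $ i \<partial>M)"
      if "integrable M h" for h :: "'w \<Rightarrow> real ^ 'n"
    proof -
      have "(\<integral>\<omega>. indicator A (X \<omega>) * (\<alpha> * X \<omega> $ i + \<delta> * h \<omega> $ i) \<partial>M)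
          = (\<integral>\<omega>. \<alpha> * (indicator A (X \<omega>) * X \<omega> $ i) + \<delta> * (indicator A (X \<omega>) * h \<omega> $ i) \<partial>M)"
        by (simp add: algebra_simps)
      also have "\<dots> = (\<integral>\<omega>. \<alpha> * (indicator A (X \<omega>) * X \<omega> $ i) \<partial>M) + (\<integral>\<omega>. \<delta> * (indicator A (X \<omega>) * h \<omega> $ i) \<partial>M)"
        by (intro Bochner_Integration.integral_add integrable_mult_right ind_int component X_int that)
      finally show ?thesis by (simp only: integral_mult_right_zero)
    qed
    show "(\<integral>\<omega>\<in>S. ?V \<omega> $ i \<partial>M) = (\<integral>\<omega>\<in>S. ?f (X \<omega>) $ i \<partial>M)"
      unfolding set V f using split[OF N_int] split[OF \<phi>X_int] tower[OF A, of i] by simp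
  qed
  have f_cont: "continuous_on UNIV ?f"
    unfolding f by (intro continuous_intros \<phi>_cont)
  \<comment> \<open>Uniqueness of the continuous version: agreement almost surely passes to the
    joint law of \<open>X\<close> and \<open>N\<close>, then to Lebesgue measure since the density
    \<kappa> is strictly positive, and finally to all points by continuity.\<close>
  have "f' = ?f" if f': "continuous_on UNIV f'"
    and cond: "\<And>i. AE \<omega> in M. real_cond_exp M F (\<lambda>\<omega>. ?V \<omega> $ i) \<omega> = f' (X \<omega>) $ i" for f'
  proof (rule continuous_AE_eq[OF f' f_cont])
    define f0 where "f0 = ?f"
    have "{x. f' x = f0 x} \<in> sets borel"
      unfolding f0_def by (intro borel_closed closed_Collect_eq f' f_cont)
    from measurable_sets[OF measurable_fst[of borel borel] this]
    have eq_set: "{w \<in> space (borel \<Otimes>\<^sub>M (borel :: (real ^ 'n) measure)). f' (fst w) = f0 (fst w)}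
        \<in> sets (borel \<Otimes>\<^sub>M borel)"
      by (simp add: vimage_def Int_def conj_commute)
    have "AE \<omega> in M. \<forall>i\<in>UNIV. f' (X \<omega>) $ i = ?f (X \<omega>) $ i"
    proof (rule AE_finite_allI)
      fix i
      show "AE \<omega> in M. f' (X \<omega>) $ i = ?f (X \<omega>) $ i"
        using cond[of i] f_cond[of i] by eventually_elim simp
    qed simp
    then have "AE \<omega> in M. f' (fst (X \<omega>, N \<omega>)) = f0 (fst (X \<omega>, N \<omega>))"
      unfolding f0_def by (simp add: vec_eq_iff)
    then have "AE w in distr M (borel \<Otimes>\<^sub>M borel) (\<lambda>\<omega>. (X \<omega>, N \<omega>)). f' (fst w) = f0 (fst w)"
      by (subst AE_distr_iff[OF _ eq_set]) simp_all
    then have "AE w in lborel \<Otimes>\<^sub>M (lborel :: (real ^ 'n) measure). f' (fst w) = f0 (fst w)"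
      unfolding law using \<kappa>_pos by (subst (asm) AE_density) simp_all
    from lborel_pair.AE_pair[OF this]
    have "AE x in lborel. AE n in (lborel :: (real ^ 'n) measure). f' x = f0 x"
      by (simp only: fst_conv)
    then have "AE x in lborel. f' x = f0 x"
      by (simp add: eventually_const_iff ae_filter_eq_bot_iff)
    then show "AE x in lborel. f' x = ?f x"
      by (simp add: f0_def)
  qed
  then show ?thesis
    unfolding cond_mean_def X_def[abs_def, symmetric] F_def[symmetric]
    using f_cond f_cont by (intro the_equality) blast+
qed

end

context gaussian_interpolation
begin

text \<open>Written with the derivative of \<open>a\<^sup>2\<close> in place of that of \<open>a\<close>, and after the integration by parts
  behind \<open>cond_mean_eq\<close>, the velocity has no singularity at the end points of \<open>[0, 1]\<close>.\<close>

lemma lipschitz_field_velocity: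
  assumes sched: "interpolation_schedule a b" and s: "s > 0" and X1: "X1 = (\<lambda>\<omega>. s *\<^sub>R Y \<omega>)"
  shows "lipschitz_field (velocity M a b Z X1)"
proof -
  obtain da2 where da2: "\<And>t. t \<in> {0..1} \<Longrightarrow> ((\<lambda>t. (a t)\<^sup>2) has_real_derivative da2 t) (at t within {0..1})"
    and da2_cont: "continuous_on {0..1} da2"
    using sched unfolding interpolation_schedule_def C1_on_def by blast
  obtain db where db: "\<And>t. t \<in> {0..1} \<Longrightarrow> (b has_real_derivative db t) (at t within {0..1})"
    and db_cont: "continuous_on {0..1} db"
    using sched unfolding interpolation_schedule_def C1_on_def by blast
  obtain da where da: "\<And>t. t \<in> {0..<1} \<Longrightarrow> (a has_real_derivative da t) (at t within {0..<1})"
    using sched unfolding interpolation_schedule_def C2_on_def by blast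
  have ends: "a 0 > 0" "b 0 \<ge> 0" "a 1 = 0" "b 1 = 1" and pos: "\<And>t. t \<in> {0<..<1} \<Longrightarrow> a t > 0 \<and> b t > 0"
    using sched unfolding interpolation_schedule_def by auto
  have a_nonneg: "a t \<ge> 0" if "t \<in> {0..1}" for t
    using ends(1,3) pos[of t] that by (cases "t = 0 \<or> t = 1") (auto simp: less_imp_le)
  have b_cont: "continuous_on {0..1} b"
    unfolding continuous_on_eq_continuous_within using db DERIV_continuous by blast
  have a2_cont: "continuous_on {0..1} (\<lambda>t. (a t)\<^sup>2)"
    unfolding continuous_on_eq_continuous_within using da2 DERIV_continuous by blast
  \<comment> \<open>At time 1 regularity is known only for the square of \<open>a\<close>;
    continuity of \<open>a\<close> is recovered by the square root, as \<open>a\<close> is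
    nonnegative.\<close>
  have "continuous_on {0..1} (\<lambda>t. sqrt ((a t)\<^sup>2))"
    by (intro continuous_intros a2_cont)
  then have a_cont: "continuous_on {0..1} a"
    by (rule continuous_on_eq) (use a_nonneg in auto)
  define w where "w t = (a t)\<^sup>2 + (s * b t)\<^sup>2" for t
  have w_pos: "w t > 0" if t: "t \<in> {0..1}" for t
  proof -
    have "a t \<noteq> 0 \<or> s * b t \<noteq> 0"
      using ends s pos[of t] t by (cases "t = 0 \<or> t = 1") auto
    then show ?thesis by (auto simp: w_def sum_power2_gt_zero_iff)
  qed
  have w_cont: "continuous_on {0..1} w"
    unfolding w_def by (intro continuous_intros a_cont b_cont)
  \<comment> \<open>Here \<open>da2 t / 2\<close> stands for \<open>a\<close> times its derivative,
    and it is continuous up to time 1. The denominator never vanishes: \<open>a\<close> is positive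
    at time 0, both functions are positive in between, and \<open>b\<close> is 1 at time 1.\<close>
  define \<alpha> where "\<alpha> t = (da2 t / 2 + s * b t * (s * db t)) / w t" for t
  define \<delta> where "\<delta> t = ((a t)\<^sup>2 * (s * db t) - da2 t / 2 * (s * b t)) / w t" for t
  define p where "p t = regression (a t) (s * b t)" for t
  define q where "q t = residual (a t) (s * b t)" for t
  define V where "V t x = \<alpha> t *\<^sub>R x - \<delta> t *\<^sub>R tilted_mean (p t *\<^sub>R x) (q t)" for t x
  have w_ne: "\<forall>t\<in>{0..1}. w t \<noteq> 0" using w_pos by fastforce
  have \<alpha>_cont: "continuous_on {0..1} \<alpha>" and \<delta>_cont: "continuous_on {0..1} \<delta>"
    unfolding \<alpha>_def \<delta>_def
    by (intro continuous_intros w_cont da2_cont db_cont a_cont b_cont w_ne; simp)+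
  have p_cont: "continuous_on {0..1} p"
    unfolding p_def regression_def w_def[symmetric]
    by (intro continuous_intros w_cont b_cont w_ne)
  have q_cont: "continuous_on {0..1} q"
    unfolding q_def residual_def w_def[symmetric]
    by (intro continuous_intros w_cont a_cont) (use w_ne in auto)
  have q: "q t \<in> {0..1}" if "t \<in> {0..1}" for t
    unfolding q_def by (rule residual_range[OF a_nonneg[OF that]])
  have V_cont: "continuous_on {0..1} (\<lambda>t. V t x)" for x
  proof -
    have "continuous_on {0..1} (\<lambda>t. case (p t *\<^sub>R x, q t) of (y, q) \<Rightarrow> tilted_mean y q)"
      by (rule continuous_on_compose2[OF continuous_tilted_mean])
         (use q in \<open>auto intro!: continuous_intros p_cont q_cont\<close>)
    then show ?thesis
      unfolding V_def by (intro continuous_intros \<alpha>_cont \<delta>_cont) simp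
  qed
  have interior: "interior_velocity M a b Z X1 t = V t" if t: "t \<in> {0<..<1}" for t
  proof -
    \<comment> \<open>The schedule differentiates \<open>a\<close> within \<open>{0..<1}\<close>,
      the velocity within \<open>{0..1}\<close>; at an interior time both agree with the two-sided
      derivative.\<close>
    have "(a has_real_derivative da t) (at t within {0<..<1})"
      by (rule DERIV_subset[OF da]) (use t in auto)
    then have "(a has_real_derivative da t) (at t)"
      unfolding at_within_open[OF t open_greaterThanLessThan] .
    then have a': "(a has_real_derivative da t) (at t within {0..1})"
      by (rule has_field_derivative_at_within)
    have time_deriv: "time_deriv f t = d" if "(f has_real_derivative d) (at t within {0..1})" for f d
      using that t
      by (intro vector_derivative_within_closed_interval)
         (auto simp: has_real_derivative_iff_has_vector_derivative)
    have "((\<lambda>t. (a t)\<^sup>2) has_real_derivative 2 * (a t * da t)) (at t within {0..1})"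
      by (auto intro!: derivative_eq_intros a')
    then have "da2 t = 2 * (a t * da t)"
      using time_deriv[OF da2[of t]] time_deriv t by fastforce
    then have "da2 t / 2 = a t * da t" by simp
    moreover have "interior_velocity M a b Z X1 t
      = cond_mean M (\<lambda>\<omega>. da t *\<^sub>R Z \<omega> + (s * db t) *\<^sub>R Y \<omega>) (\<lambda>\<omega>. a t *\<^sub>R Z \<omega> + (s * b t) *\<^sub>R Y \<omega>)"
      unfolding interior_velocity_def X1 using time_deriv[OF a'] time_deriv[OF db[of t]] t
      by (simp add: mult.commute)
    ultimately show ?thesis
      using pos[OF t] unfolding V_def[abs_def] \<alpha>_def \<delta>_def p_def q_def w_def by (simp add: cond_mean_eq)
  qed
  have velocity: "velocity M a b Z X1 t x = V t x" if t: "t \<in> {0..1}" for t x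
  proof -
    \<comment> \<open>The end values of the velocity are limits of interior values, so continuity of
      \<open>V\<close> on the closed interval identifies them.\<close>
    have lim: "((\<lambda>s. V s x) \<longlongrightarrow> V t x) (at t within {0..1})"
      using V_cont[of x] t by (auto simp: continuous_on)
    consider "t = 0" | "t = 1" | "t \<in> {0<..<1}" using t by force
    then show ?thesis
    proof cases
      case 1
      have "((\<lambda>s. interior_velocity M a b Z X1 s x) \<longlongrightarrow> V 0 x) (at_right 0)"
      proof (rule Lim_transform_eventually)
        show "((\<lambda>s. V s x) \<longlongrightarrow> V 0 x) (at_right 0)"
          using lim unfolding 1 at_within_Icc_at_right[OF zero_less_one] .
        show "\<forall>\<^sub>F s in at_right 0. V s x = interior_velocity M a b Z X1 s x"
          using eventually_at_right_real[OF zero_less_one] by eventually_elim (simp add: interior)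
      qed
      then show ?thesis
        unfolding velocity_def 1 by (simp add: tendsto_Lim)
    next
      case 2
      have "((\<lambda>s. interior_velocity M a b Z X1 s x) \<longlongrightarrow> V 1 x) (at_left 1)"
      proof (rule Lim_transform_eventually)
        show "((\<lambda>s. V s x) \<longlongrightarrow> V 1 x) (at_left 1)"
          using lim unfolding 2 at_within_Icc_at_left[OF zero_less_one] .
        show "\<forall>\<^sub>F s in at_left 1. V s x = interior_velocity M a b Z X1 s x"
          using eventually_at_left_real[OF zero_less_one] by eventually_elim (simp add: interior)
      qed
      then show ?thesis
        unfolding velocity_def 2 by (simp add: tendsto_Lim)
    next
      case 3
      then show ?thesis by (simp add: velocity_def interior)
    qed
  qed
  obtain C where C: "C \<ge> 0" "\<And>q. q \<in> {0..1} \<Longrightarrow> C-lipschitz_on UNIV (\<lambda>y. tilted_mean y q)"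
    using tilted_mean_lipschitz by blast
  define B where "B t = \<bar>\<alpha> t\<bar> + \<bar>\<delta> t\<bar> * (C * \<bar>p t\<bar>)" for t
  have "continuous_on {0..1} B"
    unfolding B_def by (intro continuous_intros \<alpha>_cont \<delta>_cont p_cont)
  then have "bounded (B ` {0..1})"
    by (intro compact_imp_bounded compact_continuous_image) auto
  then obtain K' where K': "K' > 0" "\<And>t. t \<in> {0..1} \<Longrightarrow> norm (B t) \<le> K'"
    unfolding bounded_pos by blast
  have V_lip: "dist (V t x) (V t y) \<le> K' * dist x y" if t: "t \<in> {0..1}" for t x y
  proof -
    have "V t x - V t y = \<alpha> t *\<^sub>R (x - y) - \<delta> t *\<^sub>R (tilted_mean (p t *\<^sub>R x) (q t) - tilted_mean (p t *\<^sub>R y) (q t))"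
      by (simp add: V_def scaleR_diff_right)
    also have "norm \<dots> \<le> \<bar>\<alpha> t\<bar> * norm (x - y) + \<bar>\<delta> t\<bar> * norm (tilted_mean (p t *\<^sub>R x) (q t) - tilted_mean (p t *\<^sub>R y) (q t))"
      by (rule order_trans[OF norm_triangle_ineq4]) simp
    also have "norm (tilted_mean (p t *\<^sub>R x) (q t) - tilted_mean (p t *\<^sub>R y) (q t)) \<le> C * norm (p t *\<^sub>R x - p t *\<^sub>R y)"
      using lipschitz_onD[OF C(2)[OF q[OF t]], of "p t *\<^sub>R x" "p t *\<^sub>R y"] by (simp add: dist_norm)
    also have "norm (p t *\<^sub>R x - p t *\<^sub>R y) = \<bar>p t\<bar> * norm (x - y)"
      by (simp flip: scaleR_diff_right)
    finally have "dist (V t x) (V t y) \<le> B t * dist x y"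
      by (simp add: dist_norm B_def distrib_right mult.assoc mult_left_mono)
    also have "\<dots> \<le> K' * dist x y"
      using K'(2)[OF t] by (intro mult_right_mono) auto
    finally show ?thesis .
  qed
  show ?thesis
    unfolding lipschitz_field_def
  proof (intro conjI allI exI[of _ K'] ballI)
    show "continuous_on {0..1} (\<lambda>t. velocity M a b Z X1 t x)" for x
      by (rule continuous_on_eq[OF V_cont[of x]]) (simp add: velocity)
    show "K'-lipschitz_on UNIV (velocity M a b Z X1 t)" if "t \<in> {0..1}" for t
      using K'(1) V_lip[OF that] that by (intro lipschitz_onI) (auto simp: velocity)
  qed (rule K'(1))
qed

end

section \<open>Potentials with Lipschitz gradient\<close>

text \<open>Taylor's bound along a segment by two monotonicity arguments: the Hessian bound makes
  \<open>s \<mapsto> G (x + s *\<^sub>R h) \<bullet> h - k * s\<close> nondecreasing, and this in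
  turn makes \<open>u\<close> nondecreasing.\<close>

lemma second_order_lower:
  fixes U :: "'a::real_inner \<Rightarrow> real"
  assumes U: "\<And>x. (U has_derivative (\<lambda>h. G x \<bullet> h)) (at x)" and G: "\<And>x. (G has_derivative H x) (at x)"
    and H: "\<And>x h. h \<bullet> H x h \<ge> \<kappa> * (h \<bullet> h)"
  shows "U (x + h) \<ge> U x + G x \<bullet> h + \<kappa> / 2 * (norm h)\<^sup>2"
proof -
  define k where "k = \<kappa> * (h \<bullet> h)"
  have line: "((\<lambda>s. x + s *\<^sub>R h) has_derivative (\<lambda>r. r *\<^sub>R h)) (at s)" for s
    by (auto intro!: derivative_eq_intros)
  have dG: "((\<lambda>s. G (x + s *\<^sub>R h) \<bullet> h) has_real_derivative h \<bullet> H (x + s *\<^sub>R h) h) (at s)" for s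
  proof -
    have "((\<lambda>s. G (x + s *\<^sub>R h)) has_derivative (\<lambda>r. H (x + s *\<^sub>R h) (r *\<^sub>R h))) (at s)"
      by (rule has_derivative_compose[OF line G])
    then have "((\<lambda>s. G (x + s *\<^sub>R h) \<bullet> h) has_derivative (\<lambda>r. H (x + s *\<^sub>R h) (r *\<^sub>R h) \<bullet> h)) (at s)"
      by (rule has_derivative_inner_left)
    then show ?thesis
      unfolding has_field_derivative_def linear_scale[OF has_derivative_linear[OF G]]
      by (simp add: inner_commute mult.commute[of _ "h \<bullet> _"])
  qed
  have dU: "((\<lambda>s. U (x + s *\<^sub>R h)) has_real_derivative G (x + s *\<^sub>R h) \<bullet> h) (at s)" for s
    using has_derivative_compose[OF line U, of s] unfolding has_field_derivative_def
    by (simp add: mult.commute[of _ "_ \<bullet> h"])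
  have grad: "G (x + s *\<^sub>R h) \<bullet> h - k * s \<ge> G x \<bullet> h" if "s \<ge> 0" for s
  proof -
    have "\<exists>y. ((\<lambda>s. G (x + s *\<^sub>R h) \<bullet> h - k * s) has_real_derivative y) (at r) \<and> y \<ge> 0" for r
      using H[where x = "x + r *\<^sub>R h" and h = h] unfolding k_def
      by (intro exI[of _ "h \<bullet> H (x + r *\<^sub>R h) h - \<kappa> * (h \<bullet> h)"]) (auto intro!: derivative_eq_intros dG)
    from DERIV_nonneg_imp_nondecreasing[OF that this] show ?thesis by simp
  qed
  define u where "u s = U (x + s *\<^sub>R h) - (G x \<bullet> h) * s - k / 2 * s\<^sup>2" for s
  have "\<exists>y. (u has_real_derivative y) (at s) \<and> y \<ge> 0" if "0 \<le> s" for s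
    using grad[OF that] unfolding u_def
    by (intro exI[of _ "G (x + s *\<^sub>R h) \<bullet> h - G x \<bullet> h - k * s"]) (auto intro!: derivative_eq_intros dU)
  from DERIV_nonneg_imp_nondecreasing[OF zero_le_one this] show ?thesis
    by (simp add: u_def k_def power2_norm_eq_inner)
qed

text \<open>Cocoercivity: for a convex function lying below its tangent parabolas of curvature \<open>l\<close>, compare
  the tangent at \<open>x\<close> with the value at the minimiser \<open>y - d / l\<close> of the tangent parabola at \<open>y\<close>.\<close>

lemma lipschitz_gradient_of_quadratic_bounds:
  fixes U :: "'a::real_inner \<Rightarrow> real"
  assumes lower: "\<And>x h. U (x + h) \<ge> U x + G x \<bullet> h + \<kappa> / 2 * (norm h)\<^sup>2"
    and upper: "\<And>x h. U (x + h) \<le> U x + G x \<bullet> h + \<beta> / 2 * (norm h)\<^sup>2"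
    and less: "\<kappa> < \<beta>"
  shows "(\<beta> - \<kappa> + \<bar>\<kappa>\<bar>)-lipschitz_on UNIV G"
proof (rule lipschitz_onI)
  fix x y
  define l where "l = \<beta> - \<kappa>"
  \<comment> \<open>Subtracting the quadratic moves the curvature range from \<kappa> and \<beta> to
    0 and \<open>l\<close>, so \<open>u\<close> lies above its tangents. Adding
    \<open>\<kappa> *\<^sub>R x\<close> back to the gradient costs the term
    \<open>\<bar>\<kappa>\<bar>\<close>.\<close>
  define u where "u x = U x - \<kappa> / 2 * (norm x)\<^sup>2" for x
  define \<gamma> where "\<gamma> x = G x - \<kappa> *\<^sub>R x" for x
  have l: "l > 0" using less by (simp add: l_def)
  have sq: "(norm (x + h))\<^sup>2 = (norm x)\<^sup>2 + 2 * (x \<bullet> h) + (norm h)\<^sup>2" for x h :: 'a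
    unfolding power2_norm_eq_inner by (simp add: inner_add_left inner_add_right inner_commute)
  have u_lower: "u (x + h) \<ge> u x + \<gamma> x \<bullet> h" for x h
    using lower[of x h] unfolding u_def \<gamma>_def sq by (simp add: inner_diff_left algebra_simps)
  have u_upper: "u (x + h) \<le> u x + \<gamma> x \<bullet> h + l / 2 * (norm h)\<^sup>2" for x h
    using upper[of x h] unfolding u_def \<gamma>_def l_def sq by (simp add: inner_diff_left field_simps)
  define d where "d = \<gamma> y - \<gamma> x"
  define e where "e = - (1 / l) *\<^sub>R d"
  have "u x + \<gamma> x \<bullet> (y + e - x) \<le> u (y + e)"
    using u_lower[of x "y + e - x"] by simp
  also have "\<dots> \<le> u y + \<gamma> y \<bullet> e + l / 2 * (norm e)\<^sup>2" by (rule u_upper)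
  also have "u y \<le> u x + \<gamma> x \<bullet> (y - x) + l / 2 * (norm (y - x))\<^sup>2"
    using u_upper[of x "y - x"] by simp
  finally have "- (d \<bullet> e) - l / 2 * (norm e)\<^sup>2 \<le> l / 2 * (norm (y - x))\<^sup>2"
    by (simp add: d_def inner_diff_left inner_diff_right inner_add_right)
  moreover have "- (d \<bullet> e) - l / 2 * (norm e)\<^sup>2 = (norm d)\<^sup>2 / (2 * l)"
    using l by (simp add: e_def power2_norm_eq_inner[symmetric] power_mult_distrib field_simps)
      (simp add: power2_eq_square)
  ultimately have "(norm d)\<^sup>2 / (2 * l) \<le> l / 2 * (norm (y - x))\<^sup>2"
    by simp
  then have "(norm d)\<^sup>2 \<le> (l * norm (y - x))\<^sup>2"
    using l by (simp add: divide_le_eq power2_eq_square mult_ac)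
  then have "norm d \<le> l * norm (y - x)"
    by (rule power2_le_imp_le) (use l in simp)
  moreover have "G y - G x = d + \<kappa> *\<^sub>R (y - x)" by (simp add: d_def \<gamma>_def algebra_simps)
  then have "norm (G y - G x) \<le> norm d + \<bar>\<kappa>\<bar> * norm (y - x)"
    using norm_triangle_ineq[of d "\<kappa> *\<^sub>R (y - x)"] by simp
  ultimately show "dist (G x) (G y) \<le> (\<beta> - \<kappa> + \<bar>\<kappa>\<bar>) * dist x y"
    by (simp add: dist_norm norm_minus_commute l_def algebra_simps)
qed (use less in simp)

lemma gradient_le_lipschitz:
  fixes g :: "'a::real_inner \<Rightarrow> real"
  assumes g: "(g has_derivative (\<lambda>h. D \<bullet> h)) (at x)" and lip: "L-lipschitz_on UNIV g"
  shows "\<bar>D \<bullet> h\<bar> \<le> L * norm h"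
proof -
  have "((\<lambda>s. g (x + s *\<^sub>R h)) has_derivative (\<lambda>r. D \<bullet> (r *\<^sub>R h))) (at 0)"
    by (rule has_derivative_compose[of "\<lambda>s. x + s *\<^sub>R h"]) (use g in \<open>auto intro!: derivative_eq_intros\<close>)
  then have "((\<lambda>s. g (x + s *\<^sub>R h)) has_real_derivative D \<bullet> h) (at 0)"
    unfolding has_field_derivative_def by (simp add: mult.commute[of _ "D \<bullet> h"])
  then have "((\<lambda>s. (g (x + s *\<^sub>R h) - g x) / s) \<longlongrightarrow> D \<bullet> h) (at 0)"
    by (simp add: DERIV_def)
  then have lim: "((\<lambda>s. \<bar>(g (x + s *\<^sub>R h) - g x) / s\<bar>) \<longlongrightarrow> \<bar>D \<bullet> h\<bar>) (at 0)"
    by (rule tendsto_rabs)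
  have "\<bar>(g (x + s *\<^sub>R h) - g x) / s\<bar> \<le> L * norm h" if "s \<noteq> 0" for s
    using lipschitz_onD[OF lip, of "x + s *\<^sub>R h" x] that
    by (simp add: dist_norm dist_real_def divide_le_eq mult_ac)
  then show ?thesis
    by (intro tendsto_upperbound[OF lim]) (auto simp: eventually_at_filter)
qed

lemma tilt_of_quadratic_bounds:
  fixes g :: "'a::euclidean_space \<Rightarrow> real"
  assumes g: "\<And>x. (g has_derivative (\<lambda>h. D x \<bullet> h)) (at x)"
    and lower: "\<And>x h. g (x + h) \<ge> g x + D x \<bullet> h + \<kappa> / 2 * (norm h)\<^sup>2"
    and upper: "\<And>x h. g (x + h) \<le> g x + D x \<bullet> h + \<beta> / 2 * (norm h)\<^sup>2"
    and cases: "\<kappa> > -1 \<or> L-lipschitz_on UNIV g"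
  shows "\<exists>K L \<mu>. tilt g D K L \<mu>"
proof -
  \<comment> \<open>Enlarging \<beta> secures the strict gap above \<kappa> that the gradient
    estimate divides by.\<close>
  define \<beta>' where "\<beta>' = max \<beta> (\<kappa> + 1)"
  have "\<beta> / 2 * (norm h)\<^sup>2 \<le> \<beta>' / 2 * (norm h)\<^sup>2" for h :: 'a
    by (intro mult_right_mono) (auto simp: \<beta>'_def)
  then have "g (x + h) \<le> g x + D x \<bullet> h + \<beta>' / 2 * (norm h)\<^sup>2" for x h
    using upper order_trans by (meson add_left_mono)
  from lipschitz_gradient_of_quadratic_bounds[OF lower this]
  have K: "(\<beta>' - \<kappa> + \<bar>\<kappa>\<bar>)-lipschitz_on UNIV D" by (auto simp: \<beta>'_def)
  from cases show ?thesis
  proof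
    assume \<kappa>: "\<kappa> > -1"
    have "tilt g D (\<beta>' - \<kappa> + \<bar>\<kappa>\<bar>) 0 (max 0 (- \<kappa>))"
    proof
      fix x h :: 'a
      have "- max 0 (- \<kappa>) / 2 * (norm h)\<^sup>2 \<le> \<kappa> / 2 * (norm h)\<^sup>2"
        by (intro mult_right_mono) auto
      then show "g x + D x \<bullet> h - max 0 (- \<kappa>) / 2 * (norm h)\<^sup>2 - 0 * norm h \<le> g (x + h)"
        using lower[of x h] by simp
    qed (use g K \<kappa> in auto)
    then show ?thesis by blast
  next
    assume L: "L-lipschitz_on UNIV g"
    \<comment> \<open>One \<open>L\<close> bounds the increment of \<open>g\<close>, the other the
      linear term, whose gradient has norm at most \<open>L\<close>.\<close>
    have "tilt g D (\<beta>' - \<kappa> + \<bar>\<kappa>\<bar>) (2 * L) 0"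
    proof
      fix x h :: 'a
      show "g x + D x \<bullet> h - 0 / 2 * (norm h)\<^sup>2 - 2 * L * norm h \<le> g (x + h)"
        using gradient_le_lipschitz[OF g L, of x h] lipschitz_onD[OF L, of "x + h" x]
        by (simp add: dist_real_def dist_norm abs_le_iff)
    qed (use g K lipschitz_on_nonneg[OF L] in auto)
    then show ?thesis by blast
  qed
qed

section \<open>Potentials determined by the target density\<close>

lemma C2_potential_UNIV:
  assumes "C2_potential \<nu> U H" "msupport \<nu> = UNIV"
  obtains G where "\<nu> = density lborel (\<lambda>x. ennreal (exp (- U x)))"
    "\<And>x. (U has_derivative (\<lambda>h. G x \<bullet> h)) (at x)" "\<And>x. (G has_derivative blinfun_apply (H x)) (at x)"
    "continuous_on UNIV U"
proof -
  obtain G where G: "\<And>x. (U has_derivative (\<lambda>h. G x \<bullet> h)) (at x)" "\<And>x. (G has_derivative blinfun_apply (H x)) (at x)"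
    using assms unfolding C2_potential_def by auto
  moreover have "continuous_on UNIV U"
    using has_derivative_continuous[OF G(1)] continuous_at_imp_continuous_on by blast
  moreover have "\<nu> = density lborel (\<lambda>x. ennreal (exp (- U x)))"
  proof -
    have "\<nu> = density lborel (\<lambda>x. ennreal (indicator (msupport \<nu>) x * exp (- U x)))"
      using assms(1) unfolding C2_potential_def by blast
    then show ?thesis unfolding assms(2) by simp
  qed
  ultimately show thesis by (intro that)
qed

lemma density_exp_unique:
  fixes U V :: "'a::euclidean_space \<Rightarrow> real"
  assumes "continuous_on UNIV U" "continuous_on UNIV V"
    and "density lborel (\<lambda>x. ennreal (exp (- U x))) = density lborel (\<lambda>x. ennreal (exp (- V x)))"
  shows "U = V"
proof (rule continuous_AE_eq)
  have "U \<in> borel_measurable borel" "V \<in> borel_measurable borel"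
    using assms by (simp_all add: borel_measurable_continuous_onI)
  then show "AE x in lborel. U x = V x"
    using assms(3) by (subst (asm) sigma_finite_measure.density_unique_iff[OF sigma_finite_lborel]) auto
qed (use assms in auto)

text \<open>The two curvature hypotheses come with potentials of their own. Equal densities and
  continuity make these potentials coincide, hence also their gradients, so that one function
  satisfies both bounds.\<close>

lemma semi_log_bounds:
  assumes "semi_log_convex \<beta> \<nu>" "semi_log_concave \<kappa> \<nu>" "msupport \<nu> = UNIV"
  obtains U G where "\<nu> = density lborel (\<lambda>x. ennreal (exp (- U x)))"
    "\<And>x. (U has_derivative (\<lambda>h. G x \<bullet> h)) (at x)"
    "\<And>x h. U (x + h) \<ge> U x + G x \<bullet> h + \<kappa> / 2 * (norm h)\<^sup>2"
    "\<And>x h. U (x + h) \<le> U x + G x \<bullet> h + \<beta> / 2 * (norm h)\<^sup>2"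
proof -
  obtain U1 H1 where 1: "C2_potential \<nu> U1 H1" "\<And>x h. h \<bullet> blinfun_apply (H1 x) h \<le> \<beta> * (h \<bullet> h)"
    using assms(1,3) unfolding semi_log_convex_def by auto
  obtain U2 H2 where 2: "C2_potential \<nu> U2 H2" "\<And>x h. h \<bullet> blinfun_apply (H2 x) h \<ge> \<kappa> * (h \<bullet> h)"
    using assms(2,3) unfolding semi_log_concave_def by auto
  from C2_potential_UNIV[OF 1(1) assms(3)] obtain G1 where
    G1: "\<nu> = density lborel (\<lambda>x. ennreal (exp (- U1 x)))"
      "\<And>x. (U1 has_derivative (\<lambda>h. G1 x \<bullet> h)) (at x)" "\<And>x. (G1 has_derivative blinfun_apply (H1 x)) (at x)"
      "continuous_on UNIV U1" by blast
  from C2_potential_UNIV[OF 2(1) assms(3)] obtain G2 where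
    G2: "\<nu> = density lborel (\<lambda>x. ennreal (exp (- U2 x)))"
      "\<And>x. (U2 has_derivative (\<lambda>h. G2 x \<bullet> h)) (at x)" "\<And>x. (G2 has_derivative blinfun_apply (H2 x)) (at x)"
      "continuous_on UNIV U2" by blast
  have U: "U2 = U1"
    by (rule density_exp_unique) (use G1 G2 in simp_all)
  have G: "G2 x = G1 x" for x
  proof -
    have "(\<lambda>h. G2 x \<bullet> h) = (\<lambda>h. G1 x \<bullet> h)"
      using G1(2)[of x] G2(2)[of x] unfolding U by (rule has_derivative_unique[OF _ _, rotated])
    then show ?thesis by (metis inner_commute vector_eq_rdot)
  qed
  \<comment> \<open>The upper bound is the lower one applied to the negated potential.\<close>
  have "- U1 (x + h) \<ge> - U1 x + - G1 x \<bullet> h + - \<beta> / 2 * (norm h)\<^sup>2" for x h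
  proof (rule second_order_lower)
    show "((\<lambda>x. - U1 x) has_derivative (\<lambda>h. - G1 x \<bullet> h)) (at x)" for x
      using has_derivative_minus[OF G1(2)] by simp
    show "((\<lambda>x. - G1 x) has_derivative (\<lambda>h. - blinfun_apply (H1 x) h)) (at x)" for x
      by (rule has_derivative_minus[OF G1(3)])
    show "- \<beta> * (h \<bullet> h) \<le> h \<bullet> - blinfun_apply (H1 x) h" for x h
      using 1(2)[of h x] by simp
  qed
  moreover have "U1 (x + h) \<ge> U1 x + G1 x \<bullet> h + \<kappa> / 2 * (norm h)\<^sup>2" for x h
    using second_order_lower[OF G2(2,3) 2(2)] unfolding U G .
  ultimately show thesis
    using G1(1,2) by (intro that[of U1 G1]) (auto simp: field_simps)
qed

text \<open>Splitting off the Gaussian factor \<open>exp (- (norm x)\<^sup>2 / 2)\<close> shifts the curvature bounds by one.\<close>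

lemma tilt_of_semi_log_bounds:
  assumes "semi_log_convex \<beta> \<nu>" "semi_log_concave \<kappa> \<nu>" "msupport \<nu> = UNIV"
    and cases: "\<kappa> > 0 \<or>
      (\<exists>U. continuous_on UNIV U \<and> \<nu> = density lborel (\<lambda>x. ennreal (exp (- U x))) \<and>
        L-lipschitz_on UNIV (\<lambda>x. U x - (norm x)\<^sup>2 / 2))"
  shows "\<exists>g D K L \<mu>. tilt g D K L \<mu> \<and> \<nu> = density lborel (\<lambda>x. ennreal (exp (- (norm x)\<^sup>2 / 2 - g x)))"
proof -
  obtain U G where U: "\<nu> = density lborel (\<lambda>x. ennreal (exp (- U x)))"
    and grad: "\<And>x. (U has_derivative (\<lambda>h. G x \<bullet> h)) (at x)"
    and lower: "\<And>x h. U (x + h) \<ge> U x + G x \<bullet> h + \<kappa> / 2 * (norm h)\<^sup>2"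
    and upper: "\<And>x h. U (x + h) \<le> U x + G x \<bullet> h + \<beta> / 2 * (norm h)\<^sup>2"
    using semi_log_bounds[OF assms(1-3)] by blast
  define g where "g x = U x - (norm x)\<^sup>2 / 2" for x
  define D where "D x = G x - x" for x
  have U_cont: "continuous_on UNIV U"
    using has_derivative_continuous[OF grad] continuous_at_imp_continuous_on by blast
  have sq: "(norm (x + h))\<^sup>2 = (norm x)\<^sup>2 + 2 * (x \<bullet> h) + (norm h)\<^sup>2" for x h :: "real ^ 'n"
    unfolding power2_norm_eq_inner by (simp add: inner_add_left inner_add_right inner_commute)
  have "\<exists>K L \<mu>. tilt g D K L \<mu>"
  proof (rule tilt_of_quadratic_bounds)
    show "(g has_derivative (\<lambda>h. D x \<bullet> h)) (at x)" for x
      unfolding g_def D_def power2_norm_eq_inner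
      by (auto intro!: derivative_eq_intros grad ext simp: inner_diff_left inner_diff_right inner_commute)
    show "g x + D x \<bullet> h + (\<kappa> - 1) / 2 * (norm h)\<^sup>2 \<le> g (x + h)" for x h
      using lower[of x h] unfolding g_def D_def sq by (simp add: inner_diff_left field_simps)
    show "g (x + h) \<le> g x + D x \<bullet> h + (\<beta> - 1) / 2 * (norm h)\<^sup>2" for x h
      using upper[of x h] unfolding g_def D_def sq by (simp add: inner_diff_left field_simps)
    \<comment> \<open>After the Gaussian factor is removed, a positive \<kappa> means a curvature
      loss strictly below 1; otherwise the Lipschitz alternative takes over.\<close>
    show "\<kappa> - 1 > -1 \<or> L-lipschitz_on UNIV g"
      using cases
    proof
      assume "\<exists>V. continuous_on UNIV V \<and> \<nu> = density lborel (\<lambda>x. ennreal (exp (- V x))) \<and>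
        L-lipschitz_on UNIV (\<lambda>x. V x - (norm x)\<^sup>2 / 2)"
      then obtain V where V: "continuous_on UNIV V" "\<nu> = density lborel (\<lambda>x. ennreal (exp (- V x)))"
        "L-lipschitz_on UNIV (\<lambda>x. V x - (norm x)\<^sup>2 / 2)" by blast
      have "V = U" using V(2) by (intro density_exp_unique V(1) U_cont) (simp add: U)
      then show ?thesis using V(3) by (simp add: g_def[abs_def])
    qed simp
  qed
  then show ?thesis
    using U by (intro exI[of _ g] exI[of _ D]) (simp add: g_def)
qed

lemma finite_measure_gaussian:
  assumes "\<sigma> > 0"
  shows "finite_measure (gaussian \<sigma> :: (real ^ 'n) measure)"
proof (rule finite_measureI)
  have "integrable lborel (\<lambda>x :: real ^ 'n. (1 / sqrt (2 * pi * \<sigma>\<^sup>2)) ^ CARD('n) * exp (- (1 / (2 * \<sigma>\<^sup>2)) * (norm x)\<^sup>2))"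
    using assms by (intro integrable_mult_right integrable_gaussian) simp
  then have "integrable lborel (\<lambda>x :: real ^ 'n. (1 / sqrt (2 * pi * \<sigma>\<^sup>2)) ^ CARD('n) * exp (- (norm x)\<^sup>2 / (2 * \<sigma>\<^sup>2)))"
    by simp
  from nn_integral_eq_integral[OF this]
  show "emeasure (gaussian \<sigma> :: (real ^ 'n) measure) (space (gaussian \<sigma>)) \<noteq> \<infinity>"
    unfolding gaussian_eq[OF assms] by (simp add: emeasure_density)
qed

text \<open>Multiplying the relative density by the Gaussian one gives the potential
  \<open>(norm x)\<^sup>2 / 2 - ln G - ln (f x)\<close>; removing the quadratic leaves a constant
  minus \<open>ln (f x)\<close>.\<close>

lemma log_lipschitz_density:
  fixes \<nu> :: "(real ^ 'n) measure"
  assumes ac: "absolutely_continuous lborel \<nu>" "sets \<nu> = sets borel"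
    and f: "AE x in gaussian 1. RN_deriv (gaussian 1) \<nu> x = ennreal (f x)" "log_lipschitz L f"
  shows "\<exists>U. continuous_on UNIV U \<and> \<nu> = density lborel (\<lambda>x. ennreal (exp (- U x))) \<and>
    L-lipschitz_on UNIV (\<lambda>x. U x - (norm x)\<^sup>2 / 2)"
proof -
  define G where "G = (1 / sqrt (2 * pi)) ^ CARD('n)"
  have G: "G > 0" by (simp add: G_def)
  define u where "u x = G * exp (- (norm x)\<^sup>2 / 2)" for x :: "real ^ 'n"
  have u: "u x > 0" for x using G by (simp add: u_def)
  have [measurable]: "u \<in> borel_measurable borel" unfolding u_def by measurable
  have gauss: "gaussian 1 = density lborel (\<lambda>x. ennreal (u x))"
    by (subst gaussian_eq) (simp_all add: u_def G_def)
  have f_pos: "f x > 0" for x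
    using f(2) by (auto simp: log_lipschitz_def)
  have lip: "L-lipschitz_on UNIV (\<lambda>x. ln (f x))"
    using f(2) by (auto simp: log_lipschitz_def)
  have ln_cont: "continuous_on UNIV (\<lambda>x. ln (f x))" by (rule lipschitz_on_continuous_on[OF lip])
  then have "(\<lambda>x. exp (ln (f x))) \<in> borel_measurable borel"
    by (intro borel_measurable_continuous_onI continuous_on_exp ln_cont)
  then have [measurable]: "f \<in> borel_measurable borel" using f_pos by simp
  \<comment> \<open>The Gaussian density is positive everywhere, so Gaussian null sets are Lebesgue
    null; this makes the Radon-Nikodym derivative an actual density of \<nu>.\<close>
  have "absolutely_continuous (gaussian 1) \<nu>"
    unfolding absolutely_continuous_def
  proof
    fix A assume "A \<in> null_sets (gaussian 1 :: (real ^ 'n) measure)"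
    then have A: "A \<in> sets borel" "AE x in lborel. x \<in> A \<longrightarrow> ennreal (u x) = 0"
      unfolding gauss by (simp_all add: null_sets_density_iff)
    from A(2) have "AE x in lborel. x \<notin> A"
      by eventually_elim (metis ennreal_eq_0_iff not_le u)
    then have "A \<in> null_sets lborel"
      using A(1) by (simp add: AE_iff_null_sets)
    then show "A \<in> null_sets \<nu>"
      using ac(1) unfolding absolutely_continuous_def by blast
  qed
  moreover have "sigma_finite_measure (gaussian 1 :: (real ^ 'n) measure)"
    by (intro finite_measure.sigma_finite_measure finite_measure_gaussian) simp
  ultimately have "\<nu> = density (gaussian 1) (RN_deriv (gaussian 1) \<nu>)"
    using ac(2) by (intro sigma_finite_measure.density_RN_deriv[symmetric]) (auto simp: gauss)
  also have "\<dots> = density (gaussian 1) (\<lambda>x. ennreal (f x))"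
    by (intro density_cong f(1)) (auto simp: gauss)
  also have "\<dots> = density lborel (\<lambda>x. ennreal (u x) * ennreal (f x))"
    unfolding gauss by (rule density_density_eq) auto
  finally have \<nu>: "\<nu> = density lborel (\<lambda>x. ennreal (u x) * ennreal (f x))" .
  define U where "U x = (norm x)\<^sup>2 / 2 - ln G - ln (f x)" for x
  have "ennreal (u x) * ennreal (f x) = ennreal (exp (- U x))" for x
  proof -
    have "exp (- U x) = exp (ln G + - (norm x)\<^sup>2 / 2 + ln (f x))" by (simp add: U_def)
    then show ?thesis
      unfolding u_def exp_add using G f_pos[of x] by (simp add: ennreal_mult'[symmetric] less_imp_le)
  qed
  moreover have "continuous_on UNIV U"
    unfolding U_def by (intro continuous_on_diff ln_cont) (intro continuous_intros; simp)+
  moreover have "L-lipschitz_on UNIV (\<lambda>x. U x - (norm x)\<^sup>2 / 2)"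
    using lip unfolding U_def lipschitz_on_def by (simp add: dist_real_def abs_minus_commute)
  ultimately show ?thesis using \<nu> by auto
qed

section \<open>Gaussian mixtures over a bounded set\<close>

lemma abs_exp_second_order_le: "\<bar>exp x - 1 - x\<bar> \<le> x\<^sup>2 * exp \<bar>x\<bar>" for x :: real
proof -
  have "\<exists>s\<in>{0<..<1}. exp (0 + x) - exp 0 = exp (0 + s *\<^sub>R x) \<bullet> x"
    by (rule gradient_mvt) (auto intro!: derivative_eq_intros)
  then obtain s where s: "s \<in> {0<..<1}" "exp x - 1 = exp (s * x) * x" by auto
  have "\<bar>exp x - 1 - x\<bar> = \<bar>exp (s * x) - 1\<bar> * \<bar>x\<bar>"
    unfolding s(2) abs_mult[symmetric] by (simp add: algebra_simps)
  also have "\<dots> \<le> (\<bar>s * x\<bar> * exp \<bar>s * x\<bar>) * \<bar>x\<bar>"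
    by (intro mult_right_mono abs_exp_minus_1_le) auto
  also have "\<dots> \<le> (\<bar>x\<bar> * exp \<bar>x\<bar>) * \<bar>x\<bar>"
  proof -
    have "\<bar>s * x\<bar> \<le> \<bar>x\<bar>" using s(1) by (simp add: abs_mult mult_left_le_one_le)
    then show ?thesis by (intro mult_right_mono mult_mono) auto
  qed
  also have "\<dots> = x\<^sup>2 * exp \<bar>x\<bar>" by (simp add: power2_eq_square mult_ac flip: abs_mult)
  finally show ?thesis .
qed

lemma has_derivative_quadratic_remainder:
  fixes h :: "'a::real_inner \<Rightarrow> real"
  assumes "\<And>u. norm u \<le> 1 \<Longrightarrow> \<bar>h (x + u) - h x - v \<bullet> u\<bar> \<le> C * (norm u)\<^sup>2"
  shows "(h has_derivative (\<lambda>u. v \<bullet> u)) (at x)"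
proof (rule has_derivativeI_sandwich[where e = 1 and H = "\<lambda>y. C * norm (y - x)"])
  show "((\<lambda>y. C * norm (y - x)) \<longlongrightarrow> 0) (at x)"
    by (auto intro!: tendsto_eq_intros)
  fix y assume "y \<noteq> x" "dist y x < 1"
  then have "\<bar>h y - h x - v \<bullet> (y - x)\<bar> \<le> C * norm (y - x) * norm (y - x)"
    using assms[of "y - x"] by (simp add: dist_norm power2_eq_square)
  then show "norm (h y - h x - v \<bullet> (y - x)) / norm (y - x) \<le> C * norm (y - x)"
    using \<open>y \<noteq> x\<close> by (simp add: divide_le_eq)
qed (auto intro: bounded_linear_inner_right)

text \<open>The log-Laplace transform of a bounded measure: its gradient is a mean over an exponentially
  tilted measure.\<close>

locale bounded_mixture = prob_space \<rho> for \<rho> :: "'a::euclidean_space measure" +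
  fixes R :: real
  assumes sets_\<rho> [measurable_cong]: "sets \<rho> = sets borel"
    and R: "R \<ge> 0" and bounded: "AE \<theta> in \<rho>. norm \<theta> \<le> R"
begin

text \<open>The Gaussian kernel \<open>exp (- (norm (y - \<theta>))\<^sup>2 / 2)\<close> with its
  factor \<open>exp (- (norm y)\<^sup>2 / 2)\<close> removed.\<close>

definition w :: "'a \<Rightarrow> 'a \<Rightarrow> real" where
  "w y \<theta> = exp (y \<bullet> \<theta> - (norm \<theta>)\<^sup>2 / 2)"

definition mass :: "'a \<Rightarrow> real" where "mass y = (\<integral>\<theta>. w y \<theta> \<partial>\<rho>)"

text \<open>The posterior mean of \<theta> after observing \<open>y\<close> in standard Gaussian
  noise.\<close>

definition center :: "'a \<Rightarrow> 'a" where "center y = (1 / mass y) *\<^sub>R (\<integral>\<theta>. w y \<theta> *\<^sub>R \<theta> \<partial>\<rho>)"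

lemma w_meas [measurable]: "w y \<in> borel_measurable \<rho>"
  unfolding w_def by measurable

lemma w_pos: "w y \<theta> > 0" by (simp add: w_def)

lemma w_add: "w (y + u) \<theta> = w y \<theta> * exp (u \<bullet> \<theta>)"
  unfolding w_def exp_add[symmetric] by (simp add: inner_add_left)

lemma abs_inner_le: "norm \<theta> \<le> R \<Longrightarrow> \<bar>u \<bullet> \<theta>\<bar> \<le> R * norm u"
  using Cauchy_Schwarz_ineq2[of u \<theta>] mult_right_mono[of "norm \<theta>" R "norm u"] by (simp add: mult.commute)

lemma w_int: "integrable \<rho> (w y)"
proof (rule integrable_const_bound[of _ "exp (R * norm y)"])
  show "AE \<theta> in \<rho>. norm (w y \<theta>) \<le> exp (R * norm y)"
    using bounded
  proof eventually_elim
    fix \<theta> :: 'a assume "norm \<theta> \<le> R"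
    from abs_inner_le[OF this, of y] have "y \<bullet> \<theta> - (norm \<theta>)\<^sup>2 / 2 \<le> R * norm y"
      using zero_le_power2[of "norm \<theta>"] by linarith
    then show "norm (w y \<theta>) \<le> exp (R * norm y)" by (simp add: w_def)
  qed
qed measurable

lemma mass_pos: "mass y > 0"
proof -
  have "mass y \<noteq> 0"
    unfolding mass_def using w_int w_pos
    by (subst integral_nonneg_eq_0_iff_AE) (auto simp: less_imp_le less_imp_neq[OF w_pos, THEN not_sym])
  moreover have "mass y \<ge> 0" unfolding mass_def using w_pos by (simp add: less_imp_le)
  ultimately show ?thesis by simp
qed

lemma weighted_integral:
  fixes f :: "'a \<Rightarrow> 'b::{banach, second_countable_topology}"
  assumes [measurable]: "f \<in> borel_measurable \<rho>" and f: "\<And>\<theta>. norm \<theta> \<le> R \<Longrightarrow> norm (f \<theta>) \<le> B"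
  shows "integrable \<rho> (\<lambda>\<theta>. w y \<theta> *\<^sub>R f \<theta>)" and "norm (\<integral>\<theta>. w y \<theta> *\<^sub>R f \<theta> \<partial>\<rho>) \<le> B * mass y"
proof -
  have bound: "AE \<theta> in \<rho>. norm (w y \<theta> *\<^sub>R f \<theta>) \<le> B * w y \<theta>"
    using bounded
  proof eventually_elim
    fix \<theta> :: 'a assume "norm \<theta> \<le> R"
    from mult_left_mono[OF f[OF this], of "w y \<theta>"] show "norm (w y \<theta> *\<^sub>R f \<theta>) \<le> B * w y \<theta>"
      using w_pos[of y \<theta>] by (simp add: mult.commute)
  qed
  have Bw: "integrable \<rho> (\<lambda>\<theta>. B * w y \<theta>)" using w_int by simp
  have "AE \<theta> in \<rho>. norm (w y \<theta> *\<^sub>R f \<theta>) \<le> norm (B * w y \<theta>)"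
    using bound by eventually_elim (metis abs_ge_self order_trans real_norm_def)
  then show int: "integrable \<rho> (\<lambda>\<theta>. w y \<theta> *\<^sub>R f \<theta>)"
    by (intro Bochner_Integration.integrable_bound[OF Bw]) measurable
  have "norm (\<integral>\<theta>. w y \<theta> *\<^sub>R f \<theta> \<partial>\<rho>) \<le> (\<integral>\<theta>. norm (w y \<theta> *\<^sub>R f \<theta>) \<partial>\<rho>)"
    by (rule integral_norm_bound)
  also have "\<dots> \<le> (\<integral>\<theta>. B * w y \<theta> \<partial>\<rho>)"
    by (intro integral_mono_AE integrable_norm int Bw bound)
  finally show "norm (\<integral>\<theta>. w y \<theta> *\<^sub>R f \<theta> \<partial>\<rho>) \<le> B * mass y" by (simp add: mass_def)
qed

lemma w_id_int: "integrable \<rho> (\<lambda>\<theta>. w y \<theta> *\<^sub>R \<theta>)" and norm_center_le: "norm (center y) \<le> R"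
proof -
  show "integrable \<rho> (\<lambda>\<theta>. w y \<theta> *\<^sub>R \<theta>)" by (rule weighted_integral(1)) auto
  have "norm (\<integral>\<theta>. w y \<theta> *\<^sub>R \<theta> \<partial>\<rho>) \<le> R * mass y" by (rule weighted_integral(2)) auto
  then show "norm (center y) \<le> R"
    using mass_pos[of y] by (simp add: center_def divide_le_eq)
qed

text \<open>On the ball of radius \<open>R\<close> the exponent moves by at most
  \<open>R * norm u\<close>, so the second-order remainder of the exponential is uniform in \<theta>
  and survives averaging.\<close>

lemma mass_deriv: "(mass has_derivative (\<lambda>u. (mass y *\<^sub>R center y) \<bullet> u)) (at y)"
proof (rule has_derivative_quadratic_remainder)
  fix u :: 'a assume u: "norm u \<le> 1"
  have "norm (\<integral>\<theta>. w y \<theta> *\<^sub>R (exp (u \<bullet> \<theta>) - 1 - u \<bullet> \<theta>) \<partial>\<rho>) \<le> ((R * norm u)\<^sup>2 * exp R) * mass y"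
  proof (rule weighted_integral(2))
    fix \<theta> :: 'a assume "norm \<theta> \<le> R"
    then have le: "\<bar>u \<bullet> \<theta>\<bar> \<le> R * norm u" by (rule abs_inner_le)
    have "R * norm u \<le> R" using u R by (simp add: mult_left_le)
    then have "(u \<bullet> \<theta>)\<^sup>2 * exp \<bar>u \<bullet> \<theta>\<bar> \<le> (R * norm u)\<^sup>2 * exp R"
      using le abs_le_square_iff[of "u \<bullet> \<theta>" "R * norm u"] R by (intro mult_mono) auto
    then show "norm (exp (u \<bullet> \<theta>) - 1 - u \<bullet> \<theta>) \<le> (R * norm u)\<^sup>2 * exp R"
      using abs_exp_second_order_le[of "u \<bullet> \<theta>"] by simp
  qed measurable
  moreover have "(\<integral>\<theta>. w y \<theta> *\<^sub>R (exp (u \<bullet> \<theta>) - 1 - u \<bullet> \<theta>) \<partial>\<rho>) = mass (y + u) - mass y - (mass y *\<^sub>R center y) \<bullet> u"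
  proof -
    have "(\<integral>\<theta>. w y \<theta> *\<^sub>R (exp (u \<bullet> \<theta>) - 1 - u \<bullet> \<theta>) \<partial>\<rho>)
        = (\<integral>\<theta>. w (y + u) \<theta> - w y \<theta> - (w y \<theta> *\<^sub>R \<theta>) \<bullet> u \<partial>\<rho>)"
      by (rule Bochner_Integration.integral_cong) (simp_all add: w_add right_diff_distrib inner_commute)
    also have "\<dots> = mass (y + u) - mass y - (\<integral>\<theta>. w y \<theta> *\<^sub>R \<theta> \<partial>\<rho>) \<bullet> u"
    proof -
      have i: "integrable \<rho> (\<lambda>\<theta>. (w y \<theta> *\<^sub>R \<theta>) \<bullet> u)" by (intro integrable_inner_left impI w_id_int)
      have "(\<integral>\<theta>. (w y \<theta> *\<^sub>R \<theta>) \<bullet> u \<partial>\<rho>) = (\<integral>\<theta>. w y \<theta> *\<^sub>R \<theta> \<partial>\<rho>) \<bullet> u"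
        by (rule integral_inner_left) (rule w_id_int)
      then show ?thesis
        unfolding mass_def using i w_int by (simp del: inner_scaleR_left)
    qed
    finally show ?thesis using mass_pos[of y] by (simp add: center_def)
  qed
  ultimately show "\<bar>mass (y + u) - mass y - (mass y *\<^sub>R center y) \<bullet> u\<bar> \<le> (R\<^sup>2 * exp R * mass y) * (norm u)\<^sup>2"
    by (simp add: power_mult_distrib mult_ac)
qed

text \<open>The derivative of \<open>center\<close> is the covariance of a law on a ball, hence
  bounded. The proof estimates increments directly, comparing numerator and normalising
  constant.\<close>

lemma center_lipschitz: "\<exists>C. C-lipschitz_on UNIV center"
proof -
  \<comment> \<open>The 2 counts the numerator and the normaliser, each contributing
    \<open>R * R * exp R\<close>; the second \<open>exp R\<close> is the price of replacing
    \<open>mass y\<close> by \<open>mass (y + u)\<close>.\<close>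
  define C where "C = 2 * R * R * exp R * exp R"
  have "norm (center (y + u) - center y) \<le> C * norm u" if u: "norm u \<le> 1" for y u
  proof -
    have e: "\<bar>exp (u \<bullet> \<theta>) - 1\<bar> \<le> R * norm u * exp R" and e': "exp (u \<bullet> \<theta>) \<ge> exp (- R)" if "norm \<theta> \<le> R" for \<theta>
    proof -
      have le: "\<bar>u \<bullet> \<theta>\<bar> \<le> R * norm u" using that by (rule abs_inner_le)
      have "R * norm u \<le> R" using u R by (simp add: mult_left_le)
      then have "\<bar>u \<bullet> \<theta>\<bar> * exp \<bar>u \<bullet> \<theta>\<bar> \<le> (R * norm u) * exp R"
        using le R by (intro mult_mono) auto
      then show "\<bar>exp (u \<bullet> \<theta>) - 1\<bar> \<le> R * norm u * exp R"
        using abs_exp_minus_1_le[of "u \<bullet> \<theta>"] by simp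
      show "exp (u \<bullet> \<theta>) \<ge> exp (- R)" using le \<open>R * norm u \<le> R\<close> by simp
    qed
    define v where "v y = (\<integral>\<theta>. w y \<theta> *\<^sub>R \<theta> \<partial>\<rho>)" for y
    have v: "v y = mass y *\<^sub>R center y" for y using mass_pos[of y] by (simp add: v_def center_def)
    have dv: "norm (v (y + u) - v y) \<le> (R * norm u * exp R * R) * mass y"
    proof -
      have "v (y + u) - v y = (\<integral>\<theta>. w y \<theta> *\<^sub>R ((exp (u \<bullet> \<theta>) - 1) *\<^sub>R \<theta>) \<partial>\<rho>)"
        unfolding v_def using w_id_int[of y] w_id_int[of "y + u"]
        by (subst Bochner_Integration.integral_diff[symmetric]) (auto simp: w_add scaleR_diff_left scaleR_diff_right)
      also have "norm \<dots> \<le> (R * norm u * exp R * R) * mass y"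
        by (rule weighted_integral(2)) (auto intro!: mult_mono e simp: R)
      finally show ?thesis .
    qed
    have dm: "\<bar>mass (y + u) - mass y\<bar> \<le> (R * norm u * exp R) * mass y"
    proof -
      have "mass (y + u) - mass y = (\<integral>\<theta>. w y \<theta> *\<^sub>R (exp (u \<bullet> \<theta>) - 1) \<partial>\<rho>)"
        unfolding mass_def using w_int[of y] w_int[of "y + u"]
        by (subst Bochner_Integration.integral_diff[symmetric]) (auto simp: w_add right_diff_distrib)
      also have "norm \<dots> \<le> (R * norm u * exp R) * mass y"
        by (rule weighted_integral(2)) (auto intro!: e)
      finally show ?thesis by simp
    qed
    have m: "exp (- R) * mass y \<le> mass (y + u)"
    proof -
      have "(\<integral>\<theta>. exp (- R) * w y \<theta> \<partial>\<rho>) \<le> (\<integral>\<theta>. w (y + u) \<theta> \<partial>\<rho>)"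
      proof (rule integral_mono_AE)
        show "AE \<theta> in \<rho>. exp (- R) * w y \<theta> \<le> w (y + u) \<theta>"
          using bounded by eventually_elim (use e' w_pos in \<open>simp add: w_add mult.commute\<close>)
      qed (use w_int in auto)
      then show ?thesis by (simp add: mass_def)
    qed
    have "mass (y + u) *\<^sub>R (center (y + u) - center y) = (v (y + u) - v y) - (mass (y + u) - mass y) *\<^sub>R center y"
      by (simp add: v algebra_simps)
    then have "mass (y + u) * norm (center (y + u) - center y)
        = norm ((v (y + u) - v y) - (mass (y + u) - mass y) *\<^sub>R center y)"
      using mass_pos[of "y + u"] by (metis abs_of_pos norm_scaleR)
    also have "\<dots> \<le> norm (v (y + u) - v y) + \<bar>mass (y + u) - mass y\<bar> * norm (center y)"
      by (rule order_trans[OF norm_triangle_ineq4]) simp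
    also have "\<dots> \<le> (R * norm u * exp R * R) * mass y + ((R * norm u * exp R) * mass y) * R"
      using R mass_pos[of y] by (intro add_mono dv mult_mono dm norm_center_le) auto
    also have "\<dots> = (2 * R * R * exp R * norm u) * mass y" by (simp add: algebra_simps)
    also have "\<dots> \<le> (2 * R * R * exp R * norm u) * (exp R * mass (y + u))"
      using m R by (intro mult_left_mono) (auto simp: exp_minus field_simps)
    also have "\<dots> = mass (y + u) * (C * norm u)" by (simp add: C_def mult_ac)
    finally show ?thesis using mass_pos[of "y + u"] by simp
  qed
  moreover have "C \<ge> 0" using R by (simp add: C_def)
  ultimately show ?thesis using lipschitz_on_UNIV_local by metis
qed

text \<open>The gradient has norm at most \<open>R\<close>, so the Lipschitz regime applies with
  \<mu> equal to 0: \<open>R\<close> for the increment and \<open>R\<close> for the linear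
  term.\<close>

lemma tilt_mixture: "\<exists>K. tilt (\<lambda>y. c - ln (mass y)) (\<lambda>y. - center y) K (2 * R) 0"
proof -
  obtain K where K: "K-lipschitz_on UNIV center" using center_lipschitz by blast
  have grad: "((\<lambda>y. c - ln (mass y)) has_derivative (\<lambda>h. - center y \<bullet> h)) (at y)" for y
  proof -
    have "((\<lambda>y. c - ln (mass y)) has_derivative (\<lambda>h. - ((mass y *\<^sub>R center y) \<bullet> h / mass y))) (at y)"
      using mass_pos[of y] by (auto intro!: derivative_eq_intros mass_deriv simp: field_simps)
    then show ?thesis using mass_pos[of y] by simp
  qed
  have inner_le: "\<bar>center y \<bullet> h\<bar> \<le> R * norm h" for y h
    using Cauchy_Schwarz_ineq2[of "center y" h] mult_right_mono[OF norm_center_le[of y], of "norm h"] by simp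
  have "tilt (\<lambda>y. c - ln (mass y)) (\<lambda>y. - center y) K (2 * R) 0"
  proof
    show "K-lipschitz_on UNIV (\<lambda>y. - center y)" using K by (rule lipschitz_on_minus)
    fix x h
    obtain s where "(c - ln (mass (x + h))) - (c - ln (mass x)) = - center (x + s *\<^sub>R h) \<bullet> h"
      using gradient_mvt[of "\<lambda>y. c - ln (mass y)" "\<lambda>y. - center y", OF grad] by blast
    then show "c - ln (mass x) + - center x \<bullet> h - 0 / 2 * (norm h)\<^sup>2 - 2 * R * norm h \<le> c - ln (mass (x + h))"
      using inner_le[of x h] inner_le[of "x + s *\<^sub>R h" h] by (simp add: abs_le_iff)
  qed (use grad R in auto)
  then show ?thesis by blast
qed

end

lemma gaussian_mixture_density:
  fixes \<rho> :: "(real ^ 'n) measure"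
  assumes \<sigma>: "\<sigma> > 0" and \<rho>: "prob_space \<rho>" "sets \<rho> = sets borel" "AE x in \<rho>. x \<in> cball c R"
  shows "\<exists>g D K L \<mu>. tilt g D K L \<mu> \<and> distr (convolution (gaussian \<sigma>) \<rho>) borel (\<lambda>x. (1 / \<sigma>) *\<^sub>R x)
    = density lborel (\<lambda>y. ennreal (exp (- (norm y)\<^sup>2 / 2 - g y)))"
proof -
  interpret \<rho>: prob_space \<rho> by fact
  note [measurable_cong] = \<rho>(2)
  define \<rho>' where "\<rho>' = distr \<rho> borel (\<lambda>\<theta>. (1 / \<sigma>) *\<^sub>R \<theta>)"
  \<comment> \<open>The given ball may have any centre \<open>c\<close>; it is placed in a ball
    around the origin and then rescaled.\<close>
  define R' where "R' = (1 / \<sigma>) * (norm c + \<bar>R\<bar>)"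
  interpret bounded_mixture \<rho>' R'
  proof (intro bounded_mixture.intro bounded_mixture_axioms.intro)
    show "prob_space \<rho>'" unfolding \<rho>'_def by (rule \<rho>.prob_space_distr) measurable
    show "sets \<rho>' = sets borel" by (simp add: \<rho>'_def)
    show "R' \<ge> 0" using \<sigma> by (simp add: R'_def)
    have "AE x in \<rho>. norm ((1 / \<sigma>) *\<^sub>R x) \<le> R'"
      using \<rho>(3)
    proof eventually_elim
      fix x assume "x \<in> cball c R"
      then have "norm x \<le> norm c + \<bar>R\<bar>"
        using norm_triangle_sub[of x c] by (simp add: dist_norm norm_minus_commute)
      from mult_left_mono[OF this, of "1 / \<sigma>"] show "norm ((1 / \<sigma>) *\<^sub>R x) \<le> R'"
        using \<sigma> by (simp add: R'_def)
    qed
    then show "AE \<theta> in \<rho>'. norm \<theta> \<le> R'"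
      unfolding \<rho>'_def by (subst AE_distr_iff) auto
  qed
  define G where "G = (1 / sqrt (2 * pi)) ^ CARD('n)"
  have G: "G > 0" by (simp add: G_def)
  \<comment> \<open>The form required of the density has no normalising constant, so the Gaussian
    constant is stored in \<open>g\<close>.\<close>
  define g where "g y = - ln G - ln (mass y)" for y
  define u where "u x = (1 / sqrt (2 * pi * \<sigma>\<^sup>2)) ^ CARD('n) * exp (- (norm x)\<^sup>2 / (2 * \<sigma>\<^sup>2))" for x :: "real ^ 'n"
  have [measurable]: "u \<in> borel_measurable borel" unfolding u_def by measurable
  \<comment> \<open>The power of \<sigma> is the Jacobian of
    \<open>x = \<sigma> y - \<theta>\<close>. Expanding the square separates the standard Gaussian
    in \<open>y\<close> from the weight \<open>w\<close> at the rescaled \<theta>.\<close>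
  have kernel: "ennreal (\<sigma> ^ CARD('n)) * ennreal (u (\<sigma> *\<^sub>R y - \<theta>))
      = ennreal (G * exp (- (norm y)\<^sup>2 / 2)) * ennreal (w y ((1 / \<sigma>) *\<^sub>R \<theta>))" for y \<theta>
  proof -
    have 1: "\<sigma> ^ CARD('n) * (1 / sqrt (2 * pi * \<sigma>\<^sup>2)) ^ CARD('n) = G"
      unfolding G_def power_mult_distrib[symmetric] using \<sigma> by (simp add: real_sqrt_mult)
    have "\<sigma> *\<^sub>R y - \<theta> = \<sigma> *\<^sub>R (y - (1 / \<sigma>) *\<^sub>R \<theta>)" using \<sigma> by (simp add: scaleR_diff_right)
    then have "(norm (\<sigma> *\<^sub>R y - \<theta>))\<^sup>2 = \<sigma>\<^sup>2 * (norm (y - (1 / \<sigma>) *\<^sub>R \<theta>))\<^sup>2"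
      by (simp add: power_mult_distrib)
    also have "(norm (y - (1 / \<sigma>) *\<^sub>R \<theta>))\<^sup>2 = (norm y)\<^sup>2 - 2 * (y \<bullet> ((1 / \<sigma>) *\<^sub>R \<theta>)) + (norm ((1 / \<sigma>) *\<^sub>R \<theta>))\<^sup>2"
      unfolding power2_norm_eq_inner by (simp add: inner_diff_left inner_diff_right inner_commute)
    finally have sq: "(norm (\<sigma> *\<^sub>R y - \<theta>))\<^sup>2
        = \<sigma>\<^sup>2 * ((norm y)\<^sup>2 - 2 * (y \<bullet> ((1 / \<sigma>) *\<^sub>R \<theta>)) + (norm ((1 / \<sigma>) *\<^sub>R \<theta>))\<^sup>2)" .
    have "- (\<sigma>\<^sup>2 * (r - 2 * i + t)) / (2 * \<sigma>\<^sup>2) = - r / 2 + (i - t / 2)" for r i t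
      using \<sigma> by (simp add: field_simps)
    then have "- (norm (\<sigma> *\<^sub>R y - \<theta>))\<^sup>2 / (2 * \<sigma>\<^sup>2)
        = - (norm y)\<^sup>2 / 2 + (y \<bullet> ((1 / \<sigma>) *\<^sub>R \<theta>) - (norm ((1 / \<sigma>) *\<^sub>R \<theta>))\<^sup>2 / 2)"
      unfolding sq .
    then have "\<sigma> ^ CARD('n) * u (\<sigma> *\<^sub>R y - \<theta>) = G * exp (- (norm y)\<^sup>2 / 2) * w y ((1 / \<sigma>) *\<^sub>R \<theta>)"
      unfolding u_def w_def 1[symmetric] by (simp only: exp_add mult_ac)
    then show ?thesis
      using \<sigma> G w_pos by (simp add: ennreal_mult'[symmetric] less_imp_le)
  qed
  have mass: "(\<integral>\<^sup>+\<theta>. ennreal (w y ((1 / \<sigma>) *\<^sub>R \<theta>)) \<partial>\<rho>) = ennreal (mass y)" for y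
  proof -
    have "(\<integral>\<^sup>+\<theta>. ennreal (w y ((1 / \<sigma>) *\<^sub>R \<theta>)) \<partial>\<rho>) = (\<integral>\<^sup>+\<theta>. ennreal (w y \<theta>) \<partial>\<rho>')"
      unfolding \<rho>'_def w_def by (subst nn_integral_distr) auto
    also have "\<dots> = ennreal (mass y)"
      unfolding mass_def using w_int w_pos by (intro nn_integral_eq_integral) (auto simp: less_imp_le)
    finally show ?thesis .
  qed
  have density_eq: "ennreal (G * exp (- (norm y)\<^sup>2 / 2)) * ennreal (mass y) = ennreal (exp (- (norm y)\<^sup>2 / 2 - g y))" for y
  proof -
    have "exp (- (norm y)\<^sup>2 / 2 - g y) = exp (ln G + - (norm y)\<^sup>2 / 2 + ln (mass y))" by (simp add: g_def)
    then show ?thesis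
      unfolding exp_add using G mass_pos[of y] by (simp add: ennreal_mult'[symmetric] less_imp_le)
  qed
  have "continuous_on UNIV mass"
    using has_derivative_continuous[OF mass_deriv] continuous_at_imp_continuous_on by blast
  then have [measurable]: "mass \<in> borel_measurable borel" by (rule borel_measurable_continuous_onI)
  have [measurable]: "g \<in> borel_measurable borel" unfolding g_def by measurable
  have "pair_sigma_finite (lborel :: (real ^ 'n) measure) \<rho>"
    by (intro pair_sigma_finite.intro sigma_finite_lborel \<rho>.sigma_finite_measure)
  then interpret P: pair_sigma_finite "lborel :: (real ^ 'n) measure" \<rho> .
  have gauss: "gaussian \<sigma> = density lborel (\<lambda>x. ennreal (u x))"
    unfolding u_def by (rule gaussian_eq[OF \<sigma>])
  have "distr (convolution (gaussian \<sigma>) \<rho>) borel (\<lambda>x. (1 / \<sigma>) *\<^sub>R x)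
      = density lborel (\<lambda>y. ennreal (exp (- (norm y)\<^sup>2 / 2 - g y)))"
  proof (rule measure_eqI)
    fix A assume "A \<in> sets (distr (convolution (gaussian \<sigma>) \<rho>) borel (\<lambda>x. (1 / \<sigma>) *\<^sub>R x))"
    then have A [measurable]: "A \<in> sets borel" by simp
    have conv_meas: "(\<lambda>x. (1 / \<sigma>) *\<^sub>R x) \<in> borel_measurable (convolution (gaussian \<sigma>) \<rho>)"
      by (simp add: convolution_def)
    have "emeasure (distr (convolution (gaussian \<sigma>) \<rho>) borel (\<lambda>x. (1 / \<sigma>) *\<^sub>R x)) A
        = (\<integral>\<^sup>+x. indicator A x \<partial>distr (convolution (gaussian \<sigma>) \<rho>) borel (\<lambda>x. (1 / \<sigma>) *\<^sub>R x))"
      by (subst nn_integral_indicator) auto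
    also have "\<dots> = (\<integral>\<^sup>+x. indicator A ((1 / \<sigma>) *\<^sub>R x) \<partial>convolution (gaussian \<sigma>) \<rho>)"
      by (subst nn_integral_distr[OF conv_meas]) auto
    also have "\<dots> = (\<integral>\<^sup>+x. \<integral>\<^sup>+\<theta>. indicator A ((1 / \<sigma>) *\<^sub>R (x + \<theta>)) \<partial>\<rho> \<partial>gaussian \<sigma>)"
      by (intro nn_integral_convolution finite_measure_gaussian \<sigma> \<rho>.finite_measure_axioms)
         (auto simp: \<rho> gauss)
    also have "\<dots> = (\<integral>\<^sup>+x. ennreal (u x) * (\<integral>\<^sup>+\<theta>. indicator A ((1 / \<sigma>) *\<^sub>R (x + \<theta>)) \<partial>\<rho>) \<partial>lborel)"
      unfolding gauss by (subst nn_integral_density) auto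
    also have "\<dots> = (\<integral>\<^sup>+x. \<integral>\<^sup>+\<theta>. ennreal (u x) * indicator A ((1 / \<sigma>) *\<^sub>R (x + \<theta>)) \<partial>\<rho> \<partial>lborel)"
      by (intro nn_integral_cong nn_integral_cmult[symmetric]) measurable
    also have "\<dots> = (\<integral>\<^sup>+\<theta>. \<integral>\<^sup>+x. ennreal (u x) * indicator A ((1 / \<sigma>) *\<^sub>R (x + \<theta>)) \<partial>lborel \<partial>\<rho>)"
      by (rule P.Fubini'[symmetric]) measurable
    also have "\<dots> = (\<integral>\<^sup>+\<theta>. \<integral>\<^sup>+y. ennreal (G * exp (- (norm y)\<^sup>2 / 2)) * ennreal (w y ((1 / \<sigma>) *\<^sub>R \<theta>)) * indicator A y \<partial>lborel \<partial>\<rho>)"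
    proof (rule nn_integral_cong)
      fix \<theta>
      have "(\<integral>\<^sup>+x. ennreal (u x) * indicator A ((1 / \<sigma>) *\<^sub>R (x + \<theta>)) \<partial>lborel)
          = ennreal (\<sigma> ^ DIM(real ^ 'n)) * (\<integral>\<^sup>+y. ennreal (u (- \<theta> + \<sigma> *\<^sub>R y)) * indicator A ((1 / \<sigma>) *\<^sub>R (- \<theta> + \<sigma> *\<^sub>R y + \<theta>)) \<partial>lborel)"
        by (rule nn_integral_lborel_affine) (use \<sigma> in measurable)
      also have "\<dots> = (\<integral>\<^sup>+y. (ennreal (\<sigma> ^ CARD('n)) * ennreal (u (\<sigma> *\<^sub>R y - \<theta>))) * indicator A y \<partial>lborel)"
        using \<sigma> by (subst nn_integral_cmult[symmetric]) (auto simp: mult.assoc)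
      finally show "(\<integral>\<^sup>+x. ennreal (u x) * indicator A ((1 / \<sigma>) *\<^sub>R (x + \<theta>)) \<partial>lborel)
          = (\<integral>\<^sup>+y. ennreal (G * exp (- (norm y)\<^sup>2 / 2)) * ennreal (w y ((1 / \<sigma>) *\<^sub>R \<theta>)) * indicator A y \<partial>lborel)"
        unfolding kernel .
    qed
    also have "\<dots> = (\<integral>\<^sup>+y. \<integral>\<^sup>+\<theta>. ennreal (G * exp (- (norm y)\<^sup>2 / 2)) * ennreal (w y ((1 / \<sigma>) *\<^sub>R \<theta>)) * indicator A y \<partial>\<rho> \<partial>lborel)"
      unfolding w_def by (rule P.Fubini') measurable
    also have "\<dots> = (\<integral>\<^sup>+y. ennreal (exp (- (norm y)\<^sup>2 / 2 - g y)) * indicator A y \<partial>lborel)"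
    proof (rule nn_integral_cong)
      fix y
      have [measurable]: "(\<lambda>\<theta>. w y ((1 / \<sigma>) *\<^sub>R \<theta>)) \<in> borel_measurable \<rho>" unfolding w_def by measurable
      have "(\<integral>\<^sup>+\<theta>. ennreal (G * exp (- (norm y)\<^sup>2 / 2)) * ennreal (w y ((1 / \<sigma>) *\<^sub>R \<theta>)) * indicator A y \<partial>\<rho>)
          = ennreal (G * exp (- (norm y)\<^sup>2 / 2)) * ennreal (mass y) * indicator A y"
        by (subst nn_integral_multc, measurable, subst nn_integral_cmult, measurable) (simp add: mass)
      then show "(\<integral>\<^sup>+\<theta>. ennreal (G * exp (- (norm y)\<^sup>2 / 2)) * ennreal (w y ((1 / \<sigma>) *\<^sub>R \<theta>)) * indicator A y \<partial>\<rho>)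
          = ennreal (exp (- (norm y)\<^sup>2 / 2 - g y)) * indicator A y"
        unfolding density_eq .
    qed
    also have "\<dots> = emeasure (density lborel (\<lambda>y. ennreal (exp (- (norm y)\<^sup>2 / 2 - g y)))) A"
      by (subst emeasure_density) auto
    finally show "emeasure (distr (convolution (gaussian \<sigma>) \<rho>) borel (\<lambda>x. (1 / \<sigma>) *\<^sub>R x)) A
        = emeasure (density lborel (\<lambda>y. ennreal (exp (- (norm y)\<^sup>2 / 2 - g y)))) A" .
  qed simp
  moreover have "\<exists>K. tilt g (\<lambda>y. - center y) K (2 * R') 0"
    unfolding g_def by (rule tilt_mixture)
  ultimately show ?thesis by blast
qed

section \<open>The auto-encoder\<close>

lemma lipschitz_field_autoencoder:
  assumes "lipschitz_field F"
  shows "(\<forall>x. \<exists>!\<phi>. is_flow_line F x \<phi>) \<and>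
         (\<forall>x. \<exists>!\<phi>. is_flow_line (time_reversal F) x \<phi>) \<and>
         (\<exists>C. C-lipschitz_on UNIV (flow (time_reversal F) 1)) \<and>
         (\<exists>C. C-lipschitz_on UNIV (flow F 1)) \<and>
         flow F 1 \<circ> flow (time_reversal F) 1 = id"
  using ex1_flow_line[OF assms] ex1_flow_line[OF lipschitz_field_time_reversal[OF assms]]
    flow_lipschitz[OF assms] flow_lipschitz[OF lipschitz_field_time_reversal[OF assms]]
    flow_inverts_time_reversal[OF assms]
  by blast

text \<open>The first two conjuncts ensure that the definite descriptions behind \<open>flow\<close>
  denote, so that the remaining ones speak about actual solutions. All five follow from
  \<open>lipschitz_field v\<close>, and the three cases differ only in how they provide an instance
  of \<open>tilt\<close>.\<close>

theorem corollary34: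
  fixes a b :: "real \<Rightarrow> real"
    and \<nu> :: "(real ^ 'n) measure"
    and M :: "'w measure"
    and Z X1 :: "'w \<Rightarrow> real ^ 'n"
    and v :: "real \<Rightarrow> real ^ 'n \<Rightarrow> real ^ 'n"
  assumes schedule: "interpolation_schedule a b"
    and M: "prob_space M"
    and Z: "Z \<in> borel_measurable M" "distr M borel Z = gaussian 1"
    and X1: "X1 \<in> borel_measurable M" "distr M borel X1 = \<nu>"
    and indep: "prob_space.indep_var M borel Z borel X1"
    and nu: "prob_space \<nu>" "sets \<nu> = sets borel"
    and ac: "absolutely_continuous lborel \<nu>"
    and second_moment: "integrable \<nu> (\<lambda>x. (norm x)\<^sup>2)"
    and cases:
      "(\<exists>\<beta>>0. \<exists>\<kappa>>0. semi_log_convex \<beta> \<nu> \<and> semi_log_concave \<kappa> \<nu> \<and> msupport \<nu> = UNIV) \<or>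
       (\<exists>\<sigma>>0. \<exists>R>0. \<exists>c \<rho>. prob_space \<rho> \<and> sets \<rho> = sets borel \<and> (AE x in \<rho>. x \<in> cball c R) \<and>
          \<nu> = convolution (gaussian \<sigma>) \<rho>) \<or>
       (\<exists>\<beta>>0. \<exists>\<kappa>\<le>0. \<exists>L\<ge>0. semi_log_convex \<beta> \<nu> \<and> semi_log_concave \<kappa> \<nu> \<and>
          (\<exists>f. (AE x in gaussian 1. RN_deriv (gaussian 1) \<nu> x = ennreal (f x)) \<and> log_lipschitz L f) \<and>
          msupport \<nu> = UNIV)"
  defines "v \<equiv> velocity M a b Z X1"
  shows "(\<forall>x. \<exists>!\<phi>. is_flow_line v x \<phi>) \<and>
         (\<forall>x. \<exists>!\<phi>. is_flow_line (time_reversal v) x \<phi>) \<and>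
         (\<exists>C. C-lipschitz_on UNIV (flow (time_reversal v) 1)) \<and>
         (\<exists>C. C-lipschitz_on UNIV (flow v 1)) \<and>
         flow v 1 \<circ> flow (time_reversal v) 1 = id"
proof -
  interpret M: prob_space M by fact
  interpret \<nu>: prob_space \<nu> by fact
  \<comment> \<open>The second moment enters through the first: integrability of the target makes
    the velocity variable integrable.\<close>
  have "integrable \<nu> (\<lambda>x. x)"
  proof (rule norm_integral_le(1))
    show "integrable \<nu> (\<lambda>x. 1 + (norm x)\<^sup>2)" using second_moment by simp
    show "norm x \<le> 1 + (norm x)\<^sup>2" for x :: "real ^ 'n"
      using zero_le_power2[of "norm x - 1"] norm_ge_zero[of x] unfolding power2_diff
      by (smt (verit) mult_cancel_left2 one_power2)
    show "(\<lambda>x. x) \<in> borel_measurable \<nu>" using nu(2) by (simp add: measurable_ident_sets)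
  qed
  then have X1_int: "integrable M X1"
    using integrable_distr[OF X1(1), of "\<lambda>x. x"] unfolding X1(2) by blast
  \<comment> \<open>Here \<open>s\<close> is the standard deviation of the Gaussian factor split off
    from the target, and the schedule of the rescaled target is \<open>s * b t\<close>.\<close>
  have field: "lipschitz_field v"
    if s: "s > 0" and tilt: "tilt g D K L \<mu>"
      and law: "distr \<nu> borel (\<lambda>x. (1 / s) *\<^sub>R x) = density lborel (\<lambda>y. ennreal (exp (- (norm y)\<^sup>2 / 2 - g y)))"
    for s g D K L \<mu>
  proof -
    define Y where "Y \<omega> = (1 / s) *\<^sub>R X1 \<omega>" for \<omega>
    have Y_law: "distr M borel Y = density lborel (\<lambda>y. ennreal (exp (- (norm y)\<^sup>2 / 2 - g y)))"
      unfolding law[symmetric] X1(2)[symmetric] Y_def[abs_def]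
      by (subst distr_distr) (auto simp: X1(1) o_def)
    have "M.indep_var borel ((\<lambda>x. x) \<circ> Z) borel ((\<lambda>x. (1 / s) *\<^sub>R x) \<circ> X1)"
      by (rule M.indep_var_compose[OF indep]) auto
    then have indep: "M.indep_var borel Z borel Y"
      by (simp add: o_def Y_def[abs_def])
    interpret gaussian_interpolation g D K L \<mu> M Z Y
      using tilt Z Y_law indep X1(1) X1_int
      by (intro gaussian_interpolation.intro gaussian_interpolation_axioms.intro M.prob_space_axioms)
         (auto simp: Y_def[abs_def])
    show ?thesis
      unfolding v_def using s by (intro lipschitz_field_velocity[OF schedule s]) (simp add: Y_def)
  qed
  have field1: "lipschitz_field v"
    if "\<exists>g D K L \<mu>. tilt g D K L \<mu> \<and> \<nu> = density lborel (\<lambda>x. ennreal (exp (- (norm x)\<^sup>2 / 2 - g x)))"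
  proof -
    have "distr \<nu> borel (\<lambda>x. (1 / 1) *\<^sub>R x) = \<nu>"
      using nu(2) by (simp add: distr_id2)
    then show ?thesis using that field[OF zero_less_one] by fastforce
  qed
  from cases have "lipschitz_field v"
  proof (elim disjE exE conjE)
    fix \<beta> \<kappa> :: real assume "\<kappa> > 0" "semi_log_convex \<beta> \<nu>" "semi_log_concave \<kappa> \<nu>" "msupport \<nu> = UNIV"
    then show ?thesis by (intro field1 tilt_of_semi_log_bounds) auto
  next
    fix \<sigma> R :: real and c \<rho>
    assume "\<sigma> > 0" "prob_space \<rho>" "sets \<rho> = sets borel" "AE x in \<rho>. x \<in> cball c R"
      and \<nu>: "\<nu> = convolution (gaussian \<sigma>) \<rho>"
    then obtain g D K L \<mu> where "tilt g D K L \<mu>"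
      "distr \<nu> borel (\<lambda>x. (1 / \<sigma>) *\<^sub>R x) = density lborel (\<lambda>y. ennreal (exp (- (norm y)\<^sup>2 / 2 - g y)))"
      using gaussian_mixture_density by blast
    then show ?thesis by (rule field[OF \<open>\<sigma> > 0\<close>])
  next
    fix \<beta> \<kappa> L :: real and f
    assume "semi_log_convex \<beta> \<nu>" "semi_log_concave \<kappa> \<nu>" "msupport \<nu> = UNIV"
      "AE x in gaussian 1. RN_deriv (gaussian 1) \<nu> x = ennreal (f x)" "log_lipschitz L f"
    then show ?thesis
      using log_lipschitz_density[OF ac nu(2)] by (intro field1 tilt_of_semi_log_bounds) auto
  qed
  then show ?thesis by (rule lipschitz_field_autoencoder)
qed

end
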